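(* Let $G$ be a finite group, let $\mathbf A_\bullet(G)$ be the additive completion of the $G$-Burnside category of bifree bisets, and let $j\colon \mathcal D(G)\to\mathbf B_\bullet(G)\subseteq\mathbf A_\bullet(G)$ be the bivariant functor described in the context. For any additive functor $F\colon\mathbf A_\bullet(G)\to\mathcal Ab$, the composition $F\circ j\colon\mathcal D(G)\to\mathcal Ab$ is a Mackey functor.
   Context: $G$ is a finite group; $\mathcal Ab$ is the category of abelian groups; $\mathcal D(G)$ is the category of finite left $G$-sets and $G$-maps. Bivariant functor. A bivariant functor $\mathcal M=(\mathcal M_*,\mathcal M^* )$ is a pair consisting of a covariant functor $\mathcal M_*$ and a contravariant functor $\mathcal M^*$ which agree on objects (write $\mathcal M(S)$ for the common value). For a morphism $\varphi$ write $\varphi_{\mathcal M}=\mathcal M_*(\varphi)$ and $\varphi^{\mathcal M}=\mathcal M^*(\varphi)$. Mackey functor. A Mackey functor is a bivariant functor $\mathcal M\colon\mathcal D(G)\to\mathcal Ab$ such that: (M1) for every pullback square of finite $G$-sets with $\Psi\colon S\to S_1$, $\Phi\colon S\to S_2$, $\varphi\colon S_1\to T$, $\psi\colon S_2\to T$, one has $\varphi^{\mathcal M}\circ\psi_{\mathcal M}=\Psi_{\mathcal M}\circ\Phi^{\mathcal M}$; (M2) the embeddings of $S_1,S_2$ in $S_1\sqcup S_2$ induce an isomorphism $\mathcal M^*(S_1\sqcup S_2)\to\mathcal M^*(S_1)\oplus\mathcal M^*(S_2)$, and $\mathcal M(\emptyset)=0$. Bisets. For subgroups $H_1,H_2\subseteq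 G$, a finite $H_2$-$H_1$ biset is a finite set with commuting left $H_2$- and right $H_1$-actions; it is bifree if both actions are free. For a bifree biset $X$ and $x\in X$ put $L_x=\{h_2\in H_2: h_2x\in xH_1\}$, let $\gamma_{X,x}(h_2)$ be the unique $h_1\in H_1$ with $h_2x=xh_1$ for $h_2\in L_x$, and let $K_x=\gamma_{X,x}(L_x)\subseteq H_1$. A bifree biset $X$ is a conjugation biset if for each $x\in X$ there is $g\in G$ with $g^{-1}L_xg=K_x$ and $\gamma_{X,x}(h)=g^{-1}hg$ for all $h\in L_x$. The categories. $\mathbf A(G)$ has the subgroups of $G$ as objects, and $\mathrm{Hom}_{\mathbf A(G)}(H_1,H_2)$ is the Grothendieck group, under disjoint union, of isomorphism classes of finite bifree $H_2$-$H_1$ bisets; composition is induced by the balanced product $X\circ Y=X\times_{H_2}Y$ for $X$ an $H_3$-$H_2$ biset and $Y$ an $H_2$-$H_1$ biset. $\mathbf B(G)\subseteq\mathbf A(G)$ is the subcategory with the same objects whose morphisms are generated by conjugation bisets. $\mathbf A_\bullet(G)$ and $\mathbf B_\bullet(G)$ are the free additive completions: objects are finite ordered tuples of subgroups of $G$ (including the empty tuple), and morphisms are matrices of morphisms of $\mathbf A(G)$, respectively $\mathbf B(G)$. The bivariant functor $j=(j_*,j^* )$. Choose for each finite $G$-set $S$ an ordered list $b_1,\dots,b_k$ of base points, one in each $G$-orbit (the choice can be made compatibly with disjoint unions, the list for $S\sqcup T$ being the concatenation of those for $S$ and $T$); let $H_i$ be the stabilizer of $b_i$ and put $j(S)=(H_1,\dots,H_k)$.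 Let $\varphi\colon S\to T$ be a $G$-map, let $c_1,\dots,c_m$ be the base points of $T$ with stabilizers $K_1,\dots,K_m$, and write $\varphi(b_i)=g_ic_{f(i)}$ with $g_i\in G$, so that $g_i^{-1}H_ig_i\subseteq K_{f(i)}$. The component of $j_*(\varphi)$ from $H_i$ to $K_{f(i)}$ is the set $K_{f(i)}$, as a $K_{f(i)}$-$H_i$ biset with actions $k'\cdot k\cdot h=k'k\,(g_i^{-1}hg_i)$; all other components are $0$ (the class of the empty biset). The component of $j^*(\varphi)$ from $K_{f(i)}$ to $H_i$ is the set $K_{f(i)}$, as an $H_i$-$K_{f(i)}$ biset with actions $h\cdot k\cdot k'=(g_i^{-1}hg_i)kk'$; all other components are $0$. $F\circ j$ denotes the bivariant functor $(F\circ j_*,F\circ j^* )$, where $j$ is regarded as taking values in $\mathbf A_\bullet(G)$ via the inclusion $\mathbf B_\bullet(G)\subseteq\mathbf A_\bullet(G)$. *)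

theory Defs
  imports "HOL-Algebra.Group_Action" "HOL-Algebra.Generated_Groups" "HOL-Algebra.FiniteProduct"
begin

section \<open>Categories and functors\<close>

text \<open>
  A category is given by a set of objects, hom-sets that may overlap, and operations that
  carry the objects involved as arguments: \<open>Comp C X Y Z g f\<close> is \<open>g\<close> after \<open>f\<close> for
  \<open>f : X \<rightarrow> Y\<close> and \<open>g : Y \<rightarrow> Z\<close>.
\<close>

record ('o, 'm) cat =
  Ob :: "'o set"
  Mor :: "'o \<Rightarrow> 'o \<Rightarrow> 'm set"
  Comp :: "'o \<Rightarrow> 'o \<Rightarrow> 'o \<Rightarrow> 'm \<Rightarrow> 'm \<Rightarrow> 'm"
  Ident :: "'o \<Rightarrow> 'm"

record ('o, 'm) precat = "('o, 'm) cat" +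
  Add :: "'o \<Rightarrow> 'o \<Rightarrow> 'm \<Rightarrow> 'm \<Rightarrow> 'm"
  Zero :: "'o \<Rightarrow> 'o \<Rightarrow> 'm"

definition hom_group :: "('o, 'm, 'x) precat_scheme \<Rightarrow> 'o \<Rightarrow> 'o \<Rightarrow> 'm monoid" where
  "hom_group C X Y = \<lparr>carrier = Mor C X Y, mult = Add C X Y, one = Zero C X Y\<rparr>"

definition opposite :: "('o, 'm, 'x) cat_scheme \<Rightarrow> ('o, 'm) cat" where
  "opposite C = \<lparr>Ob = Ob C, Mor = (\<lambda>X Y. Mor C Y X),
     Comp = (\<lambda>X Y Z g f. Comp C Z Y X f g), Ident = Ident C\<rparr>"

record ('o, 'm, 'p, 'n) cfunctor =
  on_ob :: "'o \<Rightarrow> 'p"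
  on_mor :: "'o \<Rightarrow> 'o \<Rightarrow> 'm \<Rightarrow> 'n"

definition is_functor ::
  "('o, 'm, 'x) cat_scheme \<Rightarrow> ('p, 'n, 'y) cat_scheme \<Rightarrow> ('o, 'm, 'p, 'n) cfunctor \<Rightarrow> bool" where
  "is_functor C D F \<longleftrightarrow>
     (\<forall>X \<in> Ob C. on_ob F X \<in> Ob D) \<and>
     (\<forall>X \<in> Ob C. \<forall>Y \<in> Ob C. \<forall>f \<in> Mor C X Y. on_mor F X Y f \<in> Mor D (on_ob F X) (on_ob F Y)) \<and>
     (\<forall>X \<in> Ob C. on_mor F X X (Ident C X) = Ident D (on_ob F X)) \<and>
     (\<forall>X \<in> Ob C. \<forall>Y \<in> Ob C. \<forall>Z \<in> Ob C. \<forall>f \<in> Mor C X Y. \<forall>g \<in> Mor C Y Z.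
        on_mor F X Z (Comp C X Y Z g f) =
        Comp D (on_ob F X) (on_ob F Y) (on_ob F Z) (on_mor F Y Z g) (on_mor F X Y f))"

definition additive_functor ::
  "('o, 'm, 'x) precat_scheme \<Rightarrow> ('p, 'n, 'y) precat_scheme \<Rightarrow> ('o, 'm, 'p, 'n) cfunctor \<Rightarrow> bool"
  where
  "additive_functor C D F \<longleftrightarrow> is_functor C D F \<and>
     (\<forall>X \<in> Ob C. \<forall>Y \<in> Ob C. \<forall>f \<in> Mor C X Y. \<forall>g \<in> Mor C X Y.
        on_mor F X Y (Add C X Y f g) =
        Add D (on_ob F X) (on_ob F Y) (on_mor F X Y f) (on_mor F X Y g))"

text \<open>
  In a bivariant functor both \<open>bi_cov M S T \<phi>\<close> and \<open>bi_con M S T \<phi>\<close> belong to a morphism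
  \<open>\<phi> : S \<rightarrow> T\<close>; the former is a morphism \<open>M S \<rightarrow> M T\<close>, the latter a morphism \<open>M T \<rightarrow> M S\<close>.
\<close>

record ('o, 'm, 'p, 'n) bifunctor =
  bi_ob :: "'o \<Rightarrow> 'p"
  bi_cov :: "'o \<Rightarrow> 'o \<Rightarrow> 'm \<Rightarrow> 'n"
  bi_con :: "'o \<Rightarrow> 'o \<Rightarrow> 'm \<Rightarrow> 'n"

definition bivariant_functor ::
  "('o, 'm, 'x) cat_scheme \<Rightarrow> ('p, 'n, 'y) cat_scheme \<Rightarrow> ('o, 'm, 'p, 'n) bifunctor \<Rightarrow> bool" where
  "bivariant_functor C D M \<longleftrightarrow>
     is_functor C D \<lparr>on_ob = bi_ob M, on_mor = bi_cov M\<rparr> \<and>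
     is_functor (opposite C) D \<lparr>on_ob = bi_ob M, on_mor = (\<lambda>T S. bi_con M S T)\<rparr>"

definition comp_bi ::
  "('p, 'n, 'q, 'l) cfunctor \<Rightarrow> ('o, 'm, 'p, 'n) bifunctor \<Rightarrow> ('o, 'm, 'q, 'l) bifunctor"
  (infixl "\<circ>\<^sub>b" 55) where
  "F \<circ>\<^sub>b M =
     \<lparr>bi_ob = (\<lambda>S. on_ob F (bi_ob M S)),
      bi_cov = (\<lambda>S T \<phi>. on_mor F (bi_ob M S) (bi_ob M T) (bi_cov M S T \<phi>)),
      bi_con = (\<lambda>S T \<phi>. on_mor F (bi_ob M T) (bi_ob M S) (bi_con M S T \<phi>))\<rparr>"

text \<open>
  The free additive completion. The \<open>(a, b)\<close> entry of a matrix \<open>X \<rightarrow> Y\<close> is a morphism from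
  the \<open>b\<close>-th entry of \<open>X\<close> to the \<open>a\<close>-th entry of \<open>Y\<close>. As \<open>hom_group\<close> is written
  multiplicatively, \<open>finprod\<close> is the sum in the matrix product.
\<close>

definition additive_completion ::
  "('o, 'm, 'x) precat_scheme \<Rightarrow> ('o list, nat \<times> nat \<Rightarrow> 'm) precat" where
  "additive_completion C =
     \<lparr>Ob = lists (Ob C),
      Mor = (\<lambda>X Y. \<Pi>\<^sub>E (a, b) \<in> {..<length Y} \<times> {..<length X}. Mor C (X ! b) (Y ! a)),
      Comp = (\<lambda>X Y Z g f. \<lambda>(a, c) \<in> {..<length Z} \<times> {..<length X}.
        finprod (hom_group C (X ! c) (Z ! a))
          (\<lambda>b. Comp C (X ! c) (Y ! b) (Z ! a) (g (a, b)) (f (b, c))) {..<length Y}),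
      Ident = (\<lambda>X. \<lambda>(a, b) \<in> {..<length X} \<times> {..<length X}.
        if a = b then Ident C (X ! a) else Zero C (X ! b) (X ! a)),
      Add = (\<lambda>X Y f g. \<lambda>(a, b) \<in> {..<length Y} \<times> {..<length X}.
        Add C (X ! b) (Y ! a) (f (a, b)) (g (a, b))),
      Zero = (\<lambda>X Y. \<lambda>(a, b) \<in> {..<length Y} \<times> {..<length X}. Zero C (X ! b) (Y ! a))\<rparr>"

text \<open>
  Abelian groups (written multiplicatively) with elements in a given type. Homomorphisms are
  made extensional so that equality of morphisms is equality on the carrier.
\<close>

definition Ab :: "('b monoid, 'b \<Rightarrow> 'b) precat" where
  "Ab =
     \<lparr>Ob = {A. comm_group A},
      Mor = (\<lambda>A B. hom A B \<inter> extensional (carrier A)),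
      Comp = (\<lambda>A B C g f. compose (carrier A) g f),
      Ident = (\<lambda>A. \<lambda>x \<in> carrier A. x),
      Add = (\<lambda>A B f g. \<lambda>x \<in> carrier A. f x \<otimes>\<^bsub>B\<^esub> g x),
      Zero = (\<lambda>A B. \<lambda>x \<in> carrier A. \<one>\<^bsub>B\<^esub>)\<rparr>"


section \<open>Finite G-sets and Mackey functors\<close>

text \<open>
  A \<open>G\<close>-set is a pair of a carrier set and an action. If the type \<open>'s\<close> is infinite, every
  finite \<open>G\<close>-set is isomorphic to one with elements in \<open>'s\<close>.
\<close>

type_synonym ('g, 's) gset = "'s set \<times> ('g \<Rightarrow> 's \<Rightarrow> 's)"

definition GSets :: "'g monoid \<Rightarrow> (('g, 's) gset, 's \<Rightarrow> 's) cat" where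
  "GSets G =
     \<lparr>Ob = {(E, act). group_action G E act \<and> finite E},
      Mor = (\<lambda>(E, act) (E', act').
        {f \<in> E \<rightarrow>\<^sub>E E'. \<forall>g \<in> carrier G. \<forall>x \<in> E. f (act g x) = act' g (f x)}),
      Comp = (\<lambda>S T U g f. compose (fst S) g f),
      Ident = (\<lambda>S. \<lambda>x \<in> fst S. x)\<rparr>"

text \<open>
  Pullbacks and disjoint unions are not built on a fixed carrier: a square of \<open>G\<close>-maps is a
  pullback if the map to the fibre product is bijective, and \<open>i\<^sub>1, i\<^sub>2\<close> exhibit \<open>S\<close> as
  \<open>S\<^sub>1 \<squnion> S\<^sub>2\<close> if they are the embeddings of two complementary parts.
\<close>

definition pullback_square ::
  "'g monoid \<Rightarrow> ('g, 's) gset \<Rightarrow> ('g, 's) gset \<Rightarrow> ('g, 's) gset \<Rightarrow> ('g, 's) gset \<Rightarrow>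
   ('s \<Rightarrow> 's) \<Rightarrow> ('s \<Rightarrow> 's) \<Rightarrow> ('s \<Rightarrow> 's) \<Rightarrow> ('s \<Rightarrow> 's) \<Rightarrow> bool" where
  "pullback_square G S S\<^sub>1 S\<^sub>2 T \<Psi> \<Phi> \<phi> \<psi> \<longleftrightarrow>
     S \<in> Ob (GSets G) \<and> S\<^sub>1 \<in> Ob (GSets G) \<and> S\<^sub>2 \<in> Ob (GSets G) \<and> T \<in> Ob (GSets G) \<and>
     \<Psi> \<in> Mor (GSets G) S S\<^sub>1 \<and> \<Phi> \<in> Mor (GSets G) S S\<^sub>2 \<and>
     \<phi> \<in> Mor (GSets G) S\<^sub>1 T \<and> \<psi> \<in> Mor (GSets G) S\<^sub>2 T \<and>
     bij_betw (\<lambda>x. (\<Psi> x, \<Phi> x)) (fst S) {(x, y) \<in> fst S\<^sub>1 \<times> fst S\<^sub>2. \<phi> x = \<psi> y}"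

definition disjoint_union ::
  "'g monoid \<Rightarrow> ('g, 's) gset \<Rightarrow> ('g, 's) gset \<Rightarrow> ('g, 's) gset \<Rightarrow> ('s \<Rightarrow> 's) \<Rightarrow> ('s \<Rightarrow> 's) \<Rightarrow> bool"
  where
  "disjoint_union G S S\<^sub>1 S\<^sub>2 i\<^sub>1 i\<^sub>2 \<longleftrightarrow>
     S \<in> Ob (GSets G) \<and> S\<^sub>1 \<in> Ob (GSets G) \<and> S\<^sub>2 \<in> Ob (GSets G) \<and>
     i\<^sub>1 \<in> Mor (GSets G) S\<^sub>1 S \<and> i\<^sub>2 \<in> Mor (GSets G) S\<^sub>2 S \<and>
     inj_on i\<^sub>1 (fst S\<^sub>1) \<and> inj_on i\<^sub>2 (fst S\<^sub>2) \<and>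
     i\<^sub>1 ` fst S\<^sub>1 \<inter> i\<^sub>2 ` fst S\<^sub>2 = {} \<and> i\<^sub>1 ` fst S\<^sub>1 \<union> i\<^sub>2 ` fst S\<^sub>2 = fst S"

definition mackey_functor ::
  "'g monoid \<Rightarrow> (('g, 's) gset, 's \<Rightarrow> 's, 'b monoid, 'b \<Rightarrow> 'b) bifunctor \<Rightarrow> bool" where
  "mackey_functor G M \<longleftrightarrow> bivariant_functor (GSets G) Ab M \<and>
     (\<forall>S S\<^sub>1 S\<^sub>2 T \<Psi> \<Phi> \<phi> \<psi>. pullback_square G S S\<^sub>1 S\<^sub>2 T \<Psi> \<Phi> \<phi> \<psi> \<longrightarrow>
        Comp Ab (bi_ob M S\<^sub>2) (bi_ob M T) (bi_ob M S\<^sub>1) (bi_con M S\<^sub>1 T \<phi>) (bi_cov M S\<^sub>2 T \<psi>) =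
        Comp Ab (bi_ob M S\<^sub>2) (bi_ob M S) (bi_ob M S\<^sub>1) (bi_cov M S S\<^sub>1 \<Psi>) (bi_con M S S\<^sub>2 \<Phi>)) \<and>
     (\<forall>S S\<^sub>1 S\<^sub>2 i\<^sub>1 i\<^sub>2. disjoint_union G S S\<^sub>1 S\<^sub>2 i\<^sub>1 i\<^sub>2 \<longrightarrow>
        (\<lambda>x. (bi_con M S\<^sub>1 S i\<^sub>1 x, bi_con M S\<^sub>2 S i\<^sub>2 x))
          \<in> iso (bi_ob M S) (bi_ob M S\<^sub>1 \<times>\<times> bi_ob M S\<^sub>2)) \<and>
     (\<forall>S \<in> Ob (GSets G). fst S = {} \<longrightarrow> carrier (bi_ob M S) = {\<one>\<^bsub>bi_ob M S\<^esub>})"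


section \<open>Bisets\<close>

record ('g, 'x) biset =
  pts :: "'x set"
  lact :: "'g \<Rightarrow> 'x \<Rightarrow> 'x"
  ract :: "'x \<Rightarrow> 'g \<Rightarrow> 'x"

text \<open>Everywhere below \<open>H\<^sub>2\<close> acts from the left and \<open>H\<^sub>1\<close> from the right.\<close>

definition is_biset :: "'g monoid \<Rightarrow> 'g set \<Rightarrow> 'g set \<Rightarrow> ('g, 'x) biset \<Rightarrow> bool" where
  "is_biset G H\<^sub>2 H\<^sub>1 X \<longleftrightarrow>
     (\<forall>h \<in> H\<^sub>2. \<forall>x \<in> pts X. lact X h x \<in> pts X) \<and>
     (\<forall>x \<in> pts X. lact X \<one>\<^bsub>G\<^esub> x = x) \<and>
     (\<forall>h \<in> H\<^sub>2. \<forall>k \<in> H\<^sub>2. \<forall>x \<in> pts X. lact X (h \<otimes>\<^bsub>G\<^esub> k) x = lact X h (lact X k x)) \<and>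
     (\<forall>h \<in> H\<^sub>1. \<forall>x \<in> pts X. ract X x h \<in> pts X) \<and>
     (\<forall>x \<in> pts X. ract X x \<one>\<^bsub>G\<^esub> = x) \<and>
     (\<forall>h \<in> H\<^sub>1. \<forall>k \<in> H\<^sub>1. \<forall>x \<in> pts X. ract X x (h \<otimes>\<^bsub>G\<^esub> k) = ract X (ract X x h) k) \<and>
     (\<forall>h \<in> H\<^sub>2. \<forall>k \<in> H\<^sub>1. \<forall>x \<in> pts X. lact X h (ract X x k) = ract X (lact X h x) k)"

definition bifree_biset :: "'g monoid \<Rightarrow> 'g set \<Rightarrow> 'g set \<Rightarrow> ('g, 'x) biset \<Rightarrow> bool" where
  "bifree_biset G H\<^sub>2 H\<^sub>1 X \<longleftrightarrow> is_biset G H\<^sub>2 H\<^sub>1 X \<and> finite (pts X) \<and>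
     (\<forall>h \<in> H\<^sub>2. \<forall>x \<in> pts X. lact X h x = x \<longrightarrow> h = \<one>\<^bsub>G\<^esub>) \<and>
     (\<forall>h \<in> H\<^sub>1. \<forall>x \<in> pts X. ract X x h = x \<longrightarrow> h = \<one>\<^bsub>G\<^esub>)"

definition biset_iso :: "'g set \<Rightarrow> 'g set \<Rightarrow> ('g, 'x) biset \<Rightarrow> ('g, 'y) biset \<Rightarrow> bool" where
  "biset_iso H\<^sub>2 H\<^sub>1 X Y \<longleftrightarrow> (\<exists>f. bij_betw f (pts X) (pts Y) \<and>
     (\<forall>h \<in> H\<^sub>2. \<forall>x \<in> pts X. f (lact X h x) = lact Y h (f x)) \<and>
     (\<forall>h \<in> H\<^sub>1. \<forall>x \<in> pts X. f (ract X x h) = ract Y (f x) h))"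

definition biset_sum :: "('g, 'x) biset \<Rightarrow> ('g, 'y) biset \<Rightarrow> ('g, 'x + 'y) biset" where
  "biset_sum X Y =
     \<lparr>pts = pts X <+> pts Y,
      lact = (\<lambda>h. map_sum (lact X h) (lact Y h)),
      ract = (\<lambda>z h. map_sum (\<lambda>x. ract X x h) (\<lambda>y. ract Y y h) z)\<rparr>"

definition biset_empty :: "('g, 'x) biset" where
  "biset_empty = \<lparr>pts = {}, lact = (\<lambda>h x. x), ract = (\<lambda>x h. x)\<rparr>"

definition balanced_rel ::
  "'g set \<Rightarrow> ('g, 'x) biset \<Rightarrow> ('g, 'y) biset \<Rightarrow> (('x \<times> 'y) \<times> ('x \<times> 'y)) set" where
  "balanced_rel H\<^sub>2 X Y =
     {((ract X x h, y), (x, lact Y h y)) | x y h. x \<in> pts X \<and> y \<in> pts Y \<and> h \<in> H\<^sub>2}"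

definition balanced_product ::
  "'g set \<Rightarrow> ('g, 'x) biset \<Rightarrow> ('g, 'y) biset \<Rightarrow> ('g, ('x \<times> 'y) set) biset" where
  "balanced_product H\<^sub>2 X Y =
     \<lparr>pts = (pts X \<times> pts Y) // balanced_rel H\<^sub>2 X Y,
      lact = (\<lambda>h c. (\<lambda>(x, y). (lact X h x, y)) ` c),
      ract = (\<lambda>c h. (\<lambda>(x, y). (x, ract Y y h)) ` c)\<rparr>"

text \<open>
  The isomorphism class of a finite bifree biset, represented by all its members with points
  in \<open>nat\<close>; the biset itself may live over any type.
\<close>

type_synonym 'g bclass = "('g, nat) biset set"

definition biset_class :: "'g monoid \<Rightarrow> 'g set \<Rightarrow> 'g set \<Rightarrow> ('g, 'x) biset \<Rightarrow> 'g bclass" where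
  "biset_class G H\<^sub>2 H\<^sub>1 X = {Z. bifree_biset G H\<^sub>2 H\<^sub>1 Z \<and> biset_iso H\<^sub>2 H\<^sub>1 X Z}"

definition biset_monoid :: "'g monoid \<Rightarrow> 'g set \<Rightarrow> 'g set \<Rightarrow> 'g bclass monoid" where
  "biset_monoid G H\<^sub>2 H\<^sub>1 =
     \<lparr>carrier = {biset_class G H\<^sub>2 H\<^sub>1 X | X :: ('g, nat) biset. bifree_biset G H\<^sub>2 H\<^sub>1 X},
      mult = (\<lambda>A B. \<Union>X \<in> A. \<Union>Y \<in> B. biset_class G H\<^sub>2 H\<^sub>1 (biset_sum X Y)),
      one = biset_class G H\<^sub>2 H\<^sub>1 (biset_empty :: ('g, nat) biset)\<rparr>"

definition bclass_comp ::
  "'g monoid \<Rightarrow> 'g set \<Rightarrow> 'g set \<Rightarrow> 'g set \<Rightarrow> 'g bclass \<Rightarrow> 'g bclass \<Rightarrow> 'g bclass" where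
  "bclass_comp G H\<^sub>3 H\<^sub>2 H\<^sub>1 A B =
     (\<Union>X \<in> A. \<Union>Y \<in> B. biset_class G H\<^sub>3 H\<^sub>1 (balanced_product H\<^sub>2 X Y))"


section \<open>The categories A(G) and B(G)\<close>

text \<open>
  The Grothendieck group of a commutative monoid, a pair \<open>(a, b)\<close> standing for \<open>a - b\<close>.
\<close>

definition groth_rel :: "'a monoid \<Rightarrow> (('a \<times> 'a) \<times> ('a \<times> 'a)) set" where
  "groth_rel M = {((a, b), (c, d)). a \<in> carrier M \<and> b \<in> carrier M \<and> c \<in> carrier M \<and> d \<in> carrier M \<and>
     (\<exists>k \<in> carrier M. a \<otimes>\<^bsub>M\<^esub> d \<otimes>\<^bsub>M\<^esub> k = c \<otimes>\<^bsub>M\<^esub> b \<otimes>\<^bsub>M\<^esub> k)}"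

definition groth_of :: "'a monoid \<Rightarrow> 'a \<Rightarrow> ('a \<times> 'a) set" where
  "groth_of M a = groth_rel M `` {(a, \<one>\<^bsub>M\<^esub>)}"

definition groth_group :: "'a monoid \<Rightarrow> ('a \<times> 'a) set monoid" where
  "groth_group M =
     \<lparr>carrier = (carrier M \<times> carrier M) // groth_rel M,
      mult = (\<lambda>p q. groth_rel M `` {(a \<otimes>\<^bsub>M\<^esub> c, b \<otimes>\<^bsub>M\<^esub> d) | a b c d. (a, b) \<in> p \<and> (c, d) \<in> q}),
      one = groth_of M \<one>\<^bsub>M\<^esub>\<rparr>"

type_synonym 'g vbiset = "('g bclass \<times> 'g bclass) set"

definition biset_mor :: "'g monoid \<Rightarrow> 'g set \<Rightarrow> 'g set \<Rightarrow> ('g, 'x) biset \<Rightarrow> 'g vbiset" where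
  "biset_mor G H\<^sub>2 H\<^sub>1 X = groth_of (biset_monoid G H\<^sub>2 H\<^sub>1) (biset_class G H\<^sub>2 H\<^sub>1 X)"

text \<open>
  The composition is the biadditive extension of the balanced product:
  \<open>(a - b) \<circ> (c - d) = (ac + bd) - (ad + bc)\<close>.
\<close>

definition burnside_cat :: "'g monoid \<Rightarrow> ('g set, 'g vbiset) precat" where
  "burnside_cat G =
     \<lparr>Ob = {H. subgroup H G},
      Mor = (\<lambda>H\<^sub>1 H\<^sub>2. carrier (groth_group (biset_monoid G H\<^sub>2 H\<^sub>1))),
      Comp = (\<lambda>H\<^sub>1 H\<^sub>2 H\<^sub>3 p q.
        let M = biset_monoid G H\<^sub>3 H\<^sub>1; m = bclass_comp G H\<^sub>3 H\<^sub>2 H\<^sub>1 in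
          groth_rel M `` {(m a c \<otimes>\<^bsub>M\<^esub> m b d, m a d \<otimes>\<^bsub>M\<^esub> m b c) | a b c d. (a, b) \<in> p \<and> (c, d) \<in> q}),
      Ident = (\<lambda>H. biset_mor G H H \<lparr>pts = H, lact = mult G, ract = mult G\<rparr>),
      Add = (\<lambda>H\<^sub>1 H\<^sub>2. mult (groth_group (biset_monoid G H\<^sub>2 H\<^sub>1))),
      Zero = (\<lambda>H\<^sub>1 H\<^sub>2. one (groth_group (biset_monoid G H\<^sub>2 H\<^sub>1)))\<rparr>"

definition biset_L :: "'g set \<Rightarrow> 'g set \<Rightarrow> ('g, 'x) biset \<Rightarrow> 'x \<Rightarrow> 'g set" where
  "biset_L H\<^sub>2 H\<^sub>1 X x = {h\<^sub>2 \<in> H\<^sub>2. \<exists>h\<^sub>1 \<in> H\<^sub>1. lact X h\<^sub>2 x = ract X x h\<^sub>1}"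

definition biset_\<gamma> :: "'g set \<Rightarrow> ('g, 'x) biset \<Rightarrow> 'x \<Rightarrow> 'g \<Rightarrow> 'g" where
  "biset_\<gamma> H\<^sub>1 X x h\<^sub>2 = (THE h\<^sub>1. h\<^sub>1 \<in> H\<^sub>1 \<and> lact X h\<^sub>2 x = ract X x h\<^sub>1)"

definition conjugation_biset :: "'g monoid \<Rightarrow> 'g set \<Rightarrow> 'g set \<Rightarrow> ('g, 'x) biset \<Rightarrow> bool" where
  "conjugation_biset G H\<^sub>2 H\<^sub>1 X \<longleftrightarrow> bifree_biset G H\<^sub>2 H\<^sub>1 X \<and>
     (\<forall>x \<in> pts X. \<exists>g \<in> carrier G.
        (\<lambda>h. inv\<^bsub>G\<^esub> g \<otimes>\<^bsub>G\<^esub> h \<otimes>\<^bsub>G\<^esub> g) ` biset_L H\<^sub>2 H\<^sub>1 X x = biset_\<gamma> H\<^sub>1 X x ` biset_L H\<^sub>2 H\<^sub>1 X x \<and>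
        (\<forall>h \<in> biset_L H\<^sub>2 H\<^sub>1 X x. biset_\<gamma> H\<^sub>1 X x h = inv\<^bsub>G\<^esub> g \<otimes>\<^bsub>G\<^esub> h \<otimes>\<^bsub>G\<^esub> g))"

definition conj_cat :: "'g monoid \<Rightarrow> ('g set, 'g vbiset) precat" where
  "conj_cat G = burnside_cat G
     \<lparr>Mor := (\<lambda>H\<^sub>1 H\<^sub>2. generate (hom_group (burnside_cat G) H\<^sub>1 H\<^sub>2)
        {biset_mor G H\<^sub>2 H\<^sub>1 X | X :: ('g, nat) biset. conjugation_biset G H\<^sub>2 H\<^sub>1 X})\<rparr>"

abbreviation A_bullet :: "'g monoid \<Rightarrow> ('g set list, nat \<times> nat \<Rightarrow> 'g vbiset) precat" where
  "A_bullet G \<equiv> additive_completion (burnside_cat G)"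

abbreviation B_bullet :: "'g monoid \<Rightarrow> ('g set list, nat \<times> nat \<Rightarrow> 'g vbiset) precat" where
  "B_bullet G \<equiv> additive_completion (conj_cat G)"


section \<open>The bivariant functor j\<close>

definition base_point_choice :: "'g monoid \<Rightarrow> (('g, 's) gset \<Rightarrow> 's list) \<Rightarrow> bool" where
  "base_point_choice G bp \<longleftrightarrow> (\<forall>S \<in> Ob (GSets G). set (bp S) \<subseteq> fst S \<and>
     (\<forall>Q \<in> orbits G (fst S) (snd S). \<exists>!i. i < length (bp S) \<and> bp S ! i \<in> Q))"

definition j_ob :: "'g monoid \<Rightarrow> (('g, 's) gset \<Rightarrow> 's list) \<Rightarrow> ('g, 's) gset \<Rightarrow> 'g set list" where
  "j_ob G bp S = map (stabilizer G (snd S)) (bp S)"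

text \<open>
  \<open>j_index\<close> and \<open>j_elem\<close> are the \<open>f\<close> and the \<open>g\<close> in \<open>\<phi> (b\<^sub>i) = g\<^sub>i c\<^bsub>f i\<^esub>\<close>. Another choice of \<open>g\<^sub>i\<close> changes the bisets below only by an
  isomorphism (multiplication by an element of the stabilizer of \<open>c\<^bsub>f i\<^esub>\<close>).
\<close>

definition j_index ::
  "'g monoid \<Rightarrow> (('g, 's) gset \<Rightarrow> 's list) \<Rightarrow> ('g, 's) gset \<Rightarrow> ('g, 's) gset \<Rightarrow> ('s \<Rightarrow> 's) \<Rightarrow> nat \<Rightarrow> nat"
  where
  "j_index G bp S T \<phi> i =
     (THE a. a < length (bp T) \<and> (\<exists>g \<in> carrier G. \<phi> (bp S ! i) = snd T g (bp T ! a)))"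

definition j_elem ::
  "'g monoid \<Rightarrow> (('g, 's) gset \<Rightarrow> 's list) \<Rightarrow> ('g, 's) gset \<Rightarrow> ('g, 's) gset \<Rightarrow> ('s \<Rightarrow> 's) \<Rightarrow> nat \<Rightarrow> 'g"
  where
  "j_elem G bp S T \<phi> i =
     (SOME g. g \<in> carrier G \<and> \<phi> (bp S ! i) = snd T g (bp T ! j_index G bp S T \<phi> i))"

definition cov_biset :: "'g monoid \<Rightarrow> 'g set \<Rightarrow> 'g \<Rightarrow> ('g, 'g) biset" where
  "cov_biset G K g =
     \<lparr>pts = K, lact = (\<lambda>k' k. k' \<otimes>\<^bsub>G\<^esub> k), ract = (\<lambda>k h. k \<otimes>\<^bsub>G\<^esub> (inv\<^bsub>G\<^esub> g \<otimes>\<^bsub>G\<^esub> h \<otimes>\<^bsub>G\<^esub> g))\<rparr>"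

definition con_biset :: "'g monoid \<Rightarrow> 'g set \<Rightarrow> 'g \<Rightarrow> ('g, 'g) biset" where
  "con_biset G K g =
     \<lparr>pts = K, lact = (\<lambda>h k. (inv\<^bsub>G\<^esub> g \<otimes>\<^bsub>G\<^esub> h \<otimes>\<^bsub>G\<^esub> g) \<otimes>\<^bsub>G\<^esub> k), ract = (\<lambda>k k'. k \<otimes>\<^bsub>G\<^esub> k')\<rparr>"

definition j_cov ::
  "'g monoid \<Rightarrow> (('g, 's) gset \<Rightarrow> 's list) \<Rightarrow> ('g, 's) gset \<Rightarrow> ('g, 's) gset \<Rightarrow> ('s \<Rightarrow> 's) \<Rightarrow>
   nat \<times> nat \<Rightarrow> 'g vbiset" where
  "j_cov G bp S T \<phi> = (\<lambda>(a, i) \<in> {..<length (bp T)} \<times> {..<length (bp S)}.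
     biset_mor G (j_ob G bp T ! a) (j_ob G bp S ! i)
       (if a = j_index G bp S T \<phi> i
        then cov_biset G (j_ob G bp T ! a) (j_elem G bp S T \<phi> i) else biset_empty))"

definition j_con ::
  "'g monoid \<Rightarrow> (('g, 's) gset \<Rightarrow> 's list) \<Rightarrow> ('g, 's) gset \<Rightarrow> ('g, 's) gset \<Rightarrow> ('s \<Rightarrow> 's) \<Rightarrow>
   nat \<times> nat \<Rightarrow> 'g vbiset" where
  "j_con G bp S T \<phi> = (\<lambda>(i, a) \<in> {..<length (bp S)} \<times> {..<length (bp T)}.
     biset_mor G (j_ob G bp S ! i) (j_ob G bp T ! a)
       (if a = j_index G bp S T \<phi> i
        then con_biset G (j_ob G bp T ! a) (j_elem G bp S T \<phi> i) else biset_empty))"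

definition j_functor ::
  "'g monoid \<Rightarrow> (('g, 's) gset \<Rightarrow> 's list) \<Rightarrow>
   (('g, 's) gset, 's \<Rightarrow> 's, 'g set list, nat \<times> nat \<Rightarrow> 'g vbiset) bifunctor" where
  "j_functor G bp = \<lparr>bi_ob = j_ob G bp, bi_cov = j_cov G bp, bi_con = j_con G bp\<rparr>"


subsection \<open>The values of j lie in the conjugation subcategory\<close>

lemma biset_iso_transport:
  fixes X :: "('g, 'x) biset"
  assumes "conjugation_biset G H\<^sub>2 H\<^sub>1 X"
  obtains Z :: "('g, nat) biset" where "conjugation_biset G H\<^sub>2 H\<^sub>1 Z" "biset_iso H\<^sub>2 H\<^sub>1 X Z"
proof -
  from assms have bif: "bifree_biset G H\<^sub>2 H\<^sub>1 X" by (simp add: conjugation_biset_def)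
  then have bis: "is_biset G H\<^sub>2 H\<^sub>1 X" and fin: "finite (pts X)" by (auto simp: bifree_biset_def)
  obtain f :: "'x \<Rightarrow> nat" and n where f: "f ` pts X = {i. i < n}" "inj_on f (pts X)"
    using finite_imp_inj_to_nat_seg[OF fin] by blast
  define u where "u = inv_into (pts X) f"
  have uf: "u (f x) = x" if "x \<in> pts X" for x
    using that f(2) by (simp add: u_def)
  define Z :: "('g, nat) biset" where
    "Z = \<lparr>pts = f ` pts X, lact = (\<lambda>h z. f (lact X h (u z))), ract = (\<lambda>z h. f (ract X (u z) h))\<rparr>"
  have p: "pts Z = f ` pts X" by (simp add: Z_def)
  have l: "lact Z h (f x) = f (lact X h x)" if "x \<in> pts X" for h x
    using that by (simp add: Z_def uf)
  have r: "ract Z (f x) h = f (ract X x h)" if "x \<in> pts X" for h x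
    using that by (simp add: Z_def uf)
  have lX: "lact X h x \<in> pts X" if "x \<in> pts X" "h \<in> H\<^sub>2" for h x
    using that bis by (simp add: is_biset_def)
  have rX: "ract X x h \<in> pts X" if "x \<in> pts X" "h \<in> H\<^sub>1" for h x
    using that bis by (simp add: is_biset_def)
  have inj: "f x = f y \<longleftrightarrow> x = y" if "x \<in> pts X" "y \<in> pts X" for x y
    using that f(2) by (auto dest: inj_onD)
  have bisZ: "is_biset G H\<^sub>2 H\<^sub>1 Z"
    using bis unfolding is_biset_def p by (simp add: l r)
  have bifZ: "bifree_biset G H\<^sub>2 H\<^sub>1 Z"
    using bif bisZ unfolding bifree_biset_def p by (auto simp: l r lX rX inj)
  have eqv: "lact Z h (f x) = ract Z (f x) k \<longleftrightarrow> lact X h x = ract X x k"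
    if "x \<in> pts X" "h \<in> H\<^sub>2" "k \<in> H\<^sub>1" for x h k
    using that by (simp add: l r lX rX inj)
  have L: "biset_L H\<^sub>2 H\<^sub>1 Z (f x) = biset_L H\<^sub>2 H\<^sub>1 X x" if "x \<in> pts X" for x
    using that by (auto simp: biset_L_def eqv)
  have g: "biset_\<gamma> H\<^sub>1 Z (f x) h = biset_\<gamma> H\<^sub>1 X x h" if "x \<in> pts X" "h \<in> H\<^sub>2" for x h
    unfolding biset_\<gamma>_def using that by (auto simp: eqv cong: conj_cong)
  have g': "biset_\<gamma> H\<^sub>1 Z (f x) h = biset_\<gamma> H\<^sub>1 X x h"
    if "x \<in> pts X" "h \<in> biset_L H\<^sub>2 H\<^sub>1 X x" for x h
    using that by (intro g) (auto simp: biset_L_def)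
  have "conjugation_biset G H\<^sub>2 H\<^sub>1 Z"
    using assms bifZ unfolding conjugation_biset_def p by (auto simp: L g' cong: image_cong)
  moreover have "biset_iso H\<^sub>2 H\<^sub>1 X Z"
    unfolding biset_iso_def using f(2) by (intro exI[of _ f]) (auto simp: p l r bij_betw_def)
  ultimately show thesis by (rule that)
qed

lemma biset_iso_trans:
  assumes "is_biset G H\<^sub>2 H\<^sub>1 X" "biset_iso H\<^sub>2 H\<^sub>1 X Y" "biset_iso H\<^sub>2 H\<^sub>1 Y Z"
  shows "biset_iso H\<^sub>2 H\<^sub>1 X Z"
proof -
  obtain f g where f: "bij_betw f (pts X) (pts Y)"
      "\<forall>h \<in> H\<^sub>2. \<forall>x \<in> pts X. f (lact X h x) = lact Y h (f x)"
      "\<forall>h \<in> H\<^sub>1. \<forall>x \<in> pts X. f (ract X x h) = ract Y (f x) h"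
    and g: "bij_betw g (pts Y) (pts Z)"
      "\<forall>h \<in> H\<^sub>2. \<forall>x \<in> pts Y. g (lact Y h x) = lact Z h (g x)"
      "\<forall>h \<in> H\<^sub>1. \<forall>x \<in> pts Y. g (ract Y x h) = ract Z (g x) h"
    using assms(2,3) unfolding biset_iso_def by blast
  show ?thesis unfolding biset_iso_def
    using bij_betw_trans[OF f(1) g(1)] f g bij_betwE[OF f(1)]
    by (intro exI[of _ "g \<circ> f"]) auto
qed

lemma biset_iso_sym:
  assumes "is_biset G H\<^sub>2 H\<^sub>1 X" "biset_iso H\<^sub>2 H\<^sub>1 X Y"
  shows "biset_iso H\<^sub>2 H\<^sub>1 Y X"
proof -
  obtain f where f: "bij_betw f (pts X) (pts Y)"
      "\<forall>h \<in> H\<^sub>2. \<forall>x \<in> pts X. f (lact X h x) = lact Y h (f x)"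
      "\<forall>h \<in> H\<^sub>1. \<forall>x \<in> pts X. f (ract X x h) = ract Y (f x) h"
    using assms(2) unfolding biset_iso_def by blast
  define u where "u = inv_into (pts X) f"
  have u: "bij_betw u (pts Y) (pts X)" using f(1) by (simp add: u_def bij_betw_inv_into)
  have uf: "u (f x) = x" if "x \<in> pts X" for x
    using f(1) that by (simp add: u_def bij_betw_inv_into_left)
  have fu: "f (u y) = y" if "y \<in> pts Y" for y
    using f(1) that by (simp add: u_def bij_betw_inv_into_right)
  have uY: "u y \<in> pts X" if "y \<in> pts Y" for y using bij_betwE[OF u] that by blast
  have "u (lact Y h y) = lact X h (u y)" if "h \<in> H\<^sub>2" "y \<in> pts Y" for h y
  proof -
    have "lact X h (u y) \<in> pts X" using assms(1) that uY by (simp add: is_biset_def)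
    from uf[OF this] show ?thesis using f(2) that uY fu by simp
  qed
  moreover have "u (ract Y y h) = ract X (u y) h" if "h \<in> H\<^sub>1" "y \<in> pts Y" for h y
  proof -
    have "ract X (u y) h \<in> pts X" using assms(1) that uY by (simp add: is_biset_def)
    from uf[OF this] show ?thesis using f(3) that uY fu by simp
  qed
  ultimately show ?thesis unfolding biset_iso_def using u by blast
qed

lemma biset_class_cong:
  assumes "is_biset G H\<^sub>2 H\<^sub>1 X" "is_biset G H\<^sub>2 H\<^sub>1 Y" "biset_iso H\<^sub>2 H\<^sub>1 X Y"
  shows "biset_class G H\<^sub>2 H\<^sub>1 X = biset_class G H\<^sub>2 H\<^sub>1 Y"
  unfolding biset_class_def
  using biset_iso_trans[OF assms(1,3)] biset_iso_trans[OF assms(2) biset_iso_sym[OF assms(1,3)]]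
  by blast

lemma conjugation_biset_mor:
  assumes "conjugation_biset G H\<^sub>2 H\<^sub>1 X"
  shows "biset_mor G H\<^sub>2 H\<^sub>1 X \<in> Mor (conj_cat G) H\<^sub>1 H\<^sub>2"
proof -
  obtain Z :: "('a, nat) biset" where Z: "conjugation_biset G H\<^sub>2 H\<^sub>1 Z" "biset_iso H\<^sub>2 H\<^sub>1 X Z"
    using biset_iso_transport[OF assms] .
  have "biset_class G H\<^sub>2 H\<^sub>1 X = biset_class G H\<^sub>2 H\<^sub>1 Z"
    using assms Z by (intro biset_class_cong) (auto simp: conjugation_biset_def bifree_biset_def)
  then have "biset_mor G H\<^sub>2 H\<^sub>1 X = biset_mor G H\<^sub>2 H\<^sub>1 Z" by (simp add: biset_mor_def)
  then show ?thesis using Z(1) by (auto simp: conj_cat_def intro!: generate.incl)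
qed

lemma conjugation_bisetI:
  assumes bif: "bifree_biset G H\<^sub>2 H\<^sub>1 X"
    and c: "\<And>x. x \<in> pts X \<Longrightarrow> \<exists>g \<in> carrier G. \<forall>h\<^sub>2 \<in> H\<^sub>2. \<forall>h\<^sub>1 \<in> H\<^sub>1.
      lact X h\<^sub>2 x = ract X x h\<^sub>1 \<longrightarrow> h\<^sub>1 = inv\<^bsub>G\<^esub> g \<otimes>\<^bsub>G\<^esub> h\<^sub>2 \<otimes>\<^bsub>G\<^esub> g"
  shows "conjugation_biset G H\<^sub>2 H\<^sub>1 X"
  unfolding conjugation_biset_def
proof (intro conjI ballI bif)
  fix x assume "x \<in> pts X"
  then obtain g where g: "g \<in> carrier G" and eq: "\<And>h\<^sub>2 h\<^sub>1. h\<^sub>2 \<in> H\<^sub>2 \<Longrightarrow> h\<^sub>1 \<in> H\<^sub>1 \<Longrightarrow>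
      lact X h\<^sub>2 x = ract X x h\<^sub>1 \<Longrightarrow> h\<^sub>1 = inv\<^bsub>G\<^esub> g \<otimes>\<^bsub>G\<^esub> h\<^sub>2 \<otimes>\<^bsub>G\<^esub> g" using c by blast
  have *: "biset_\<gamma> H\<^sub>1 X x h = inv\<^bsub>G\<^esub> g \<otimes>\<^bsub>G\<^esub> h \<otimes>\<^bsub>G\<^esub> g" if "h \<in> biset_L H\<^sub>2 H\<^sub>1 X x" for h
  proof -
    from that obtain k where k: "h \<in> H\<^sub>2" "k \<in> H\<^sub>1" "lact X h x = ract X x k"
      by (auto simp: biset_L_def)
    have "biset_\<gamma> H\<^sub>1 X x h = k"
      unfolding biset_\<gamma>_def using k eq by (intro the_equality) metis+
    with k eq show ?thesis by metis
  qed
  then show "\<exists>g \<in> carrier G.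
      (\<lambda>h. inv\<^bsub>G\<^esub> g \<otimes>\<^bsub>G\<^esub> h \<otimes>\<^bsub>G\<^esub> g) ` biset_L H\<^sub>2 H\<^sub>1 X x = biset_\<gamma> H\<^sub>1 X x ` biset_L H\<^sub>2 H\<^sub>1 X x \<and>
      (\<forall>h \<in> biset_L H\<^sub>2 H\<^sub>1 X x. biset_\<gamma> H\<^sub>1 X x h = inv\<^bsub>G\<^esub> g \<otimes>\<^bsub>G\<^esub> h \<otimes>\<^bsub>G\<^esub> g)"
    using g by (intro bexI[of _ g]) (auto cong: image_cong)
qed

lemma conjugation_biset_empty: "conjugation_biset G H\<^sub>2 H\<^sub>1 biset_empty"
  by (simp add: conjugation_biset_def bifree_biset_def is_biset_def biset_empty_def)

context group begin

lemma cancel_inv: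
  assumes "g \<in> carrier G" "z \<in> carrier G"
  shows "g \<otimes> (inv g \<otimes> z) = z"
  using assms by (simp add: m_assoc[symmetric])

lemma cancel_inv':
  assumes "g \<in> carrier G" "z \<in> carrier G"
  shows "inv g \<otimes> (g \<otimes> z) = z"
  using assms by (simp add: m_assoc[symmetric])

lemma conj_mult:
  assumes "g \<in> carrier G" "h \<in> carrier G" "k \<in> carrier G"
  shows "inv g \<otimes> (h \<otimes> k) \<otimes> g = (inv g \<otimes> h \<otimes> g) \<otimes> (inv g \<otimes> k \<otimes> g)"
  using assms by (simp add: m_assoc cancel_inv)

lemma conj_eq_one:
  assumes "g \<in> carrier G" "h \<in> carrier G" "inv g \<otimes> h \<otimes> g = \<one>"
  shows "h = \<one>"
proof -
  have "h = g \<otimes> (inv g \<otimes> h \<otimes> g) \<otimes> inv g"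
    using assms(1,2) by (simp add: m_assoc cancel_inv)
  then show ?thesis using assms by simp
qed

end

lemma cov_biset_conjugation:
  fixes G :: "'g monoid" (structure)
  assumes "group G" "subgroup H G" "subgroup K G" "finite K" "g \<in> carrier G"
    and HK: "\<And>h. h \<in> H \<Longrightarrow> inv g \<otimes> h \<otimes> g \<in> K"
  shows "conjugation_biset G K H (cov_biset G K g)"
proof (rule conjugation_bisetI)
  interpret group G by fact
  note [simp] = subgroup.mem_carrier[OF assms(2)] subgroup.mem_carrier[OF assms(3)] assms(5)
    subgroup.m_closed[OF assms(2)] subgroup.m_closed[OF assms(3)]
  define c where "c = (\<lambda>h. inv g \<otimes> h \<otimes> g)"
  have c [simp]: "c h \<in> K" "c h \<in> carrier G" if "h \<in> H" for h
    using that HK by (auto simp: c_def)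
  have cm [simp]: "c (h \<otimes> k) = c h \<otimes> c k" if "h \<in> H" "k \<in> H" for h k
    using that by (simp add: c_def conj_mult)
  have c1 [simp]: "c \<one> = \<one>" by (simp add: c_def)
  have cf: "c h = \<one> \<Longrightarrow> h = \<one>" if "h \<in> H" for h
    using that conj_eq_one[of g h] by (simp add: c_def)
  have X: "cov_biset G K g = \<lparr>pts = K, lact = (\<lambda>k' k. k' \<otimes> k), ract = (\<lambda>k h. k \<otimes> c h)\<rparr>"
    by (simp add: cov_biset_def c_def)
  show "bifree_biset G K H (cov_biset G K g)"
    unfolding X using assms(4) by (auto simp: bifree_biset_def is_biset_def m_assoc cf)
  fix x assume x: "x \<in> pts (cov_biset G K g)"
  then have [simp]: "x \<in> carrier G" by (simp add: cov_biset_def)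
  have "h = inv (x \<otimes> inv g) \<otimes> k \<otimes> (x \<otimes> inv g)"
    if "k \<in> K" "h \<in> H" "k \<otimes> x = x \<otimes> (inv g \<otimes> h \<otimes> g)" for k h
  proof -
    have "inv (x \<otimes> inv g) \<otimes> k \<otimes> (x \<otimes> inv g) = g \<otimes> inv x \<otimes> (k \<otimes> x) \<otimes> inv g"
      using that(1,2) by (simp add: inv_mult_group m_assoc)
    also have "\<dots> = (g \<otimes> (inv x \<otimes> x) \<otimes> inv g) \<otimes> h \<otimes> (g \<otimes> inv g)"
      unfolding that(3) using that(1,2) by (simp add: m_assoc cancel_inv cancel_inv')
    also have "\<dots> = h" using that(2) by simp
    finally show ?thesis ..
  qed
  then show "\<exists>g' \<in> carrier G. \<forall>k \<in> K. \<forall>h \<in> H.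
      lact (cov_biset G K g) k x = ract (cov_biset G K g) x h \<longrightarrow> h = inv g' \<otimes> k \<otimes> g'"
    by (intro bexI[of _ "x \<otimes> inv g"]) (auto simp: cov_biset_def)
qed

lemma con_biset_conjugation:
  fixes G :: "'g monoid" (structure)
  assumes "group G" "subgroup H G" "subgroup K G" "finite K" "g \<in> carrier G"
    and HK: "\<And>h. h \<in> H \<Longrightarrow> inv g \<otimes> h \<otimes> g \<in> K"
  shows "conjugation_biset G H K (con_biset G K g)"
proof (rule conjugation_bisetI)
  interpret group G by fact
  note [simp] = subgroup.mem_carrier[OF assms(2)] subgroup.mem_carrier[OF assms(3)] assms(5)
    subgroup.m_closed[OF assms(2)] subgroup.m_closed[OF assms(3)]
  define c where "c = (\<lambda>h. inv g \<otimes> h \<otimes> g)"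
  have c [simp]: "c h \<in> K" "c h \<in> carrier G" if "h \<in> H" for h
    using that HK by (auto simp: c_def)
  have cm [simp]: "c (h \<otimes> k) = c h \<otimes> c k" if "h \<in> H" "k \<in> H" for h k
    using that by (simp add: c_def conj_mult)
  have c1 [simp]: "c \<one> = \<one>" by (simp add: c_def)
  have cf: "c h = \<one> \<Longrightarrow> h = \<one>" if "h \<in> H" for h
    using that conj_eq_one[of g h] by (simp add: c_def)
  have X: "con_biset G K g = \<lparr>pts = K, lact = (\<lambda>h k. c h \<otimes> k), ract = (\<lambda>k k'. k \<otimes> k')\<rparr>"
    by (simp add: con_biset_def c_def)
  show "bifree_biset G H K (con_biset G K g)"
    unfolding X using assms(4) by (auto simp: bifree_biset_def is_biset_def m_assoc cf)
  fix x assume x: "x \<in> pts (con_biset G K g)"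
  then have [simp]: "x \<in> carrier G" by (simp add: con_biset_def)
  have "k = inv (g \<otimes> x) \<otimes> h \<otimes> (g \<otimes> x)"
    if "k \<in> K" "h \<in> H" "inv g \<otimes> h \<otimes> g \<otimes> x = x \<otimes> k" for k h
  proof -
    have "inv (g \<otimes> x) \<otimes> h \<otimes> (g \<otimes> x) = inv x \<otimes> (inv g \<otimes> h \<otimes> g \<otimes> x)"
      using that(1,2) by (simp add: inv_mult_group m_assoc)
    also have "\<dots> = (inv x \<otimes> x) \<otimes> k"
      unfolding that(3) using that(1,2) by (simp add: m_assoc cancel_inv cancel_inv')
    also have "\<dots> = k" using that(1) by simp
    finally show ?thesis ..
  qed
  then show "\<exists>g' \<in> carrier G. \<forall>h \<in> H. \<forall>k \<in> K.
      lact (con_biset G K g) h x = ract (con_biset G K g) x k \<longrightarrow> k = inv g' \<otimes> h \<otimes> g'"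
    by (intro bexI[of _ "g \<otimes> x"]) (auto simp: con_biset_def)
qed

lemma j_ob_in:
  assumes "base_point_choice G bp" "S \<in> Ob (GSets G)"
  shows "j_ob G bp S \<in> Ob (B_bullet G)"
proof -
  obtain E act where S: "S = (E, act)" "group_action G E act"
    using assms(2) by (auto simp: GSets_def)
  have "set (bp S) \<subseteq> fst S" using assms unfolding base_point_choice_def by blast
  then have "set (bp S) \<subseteq> E" using S(1) by simp
  then have "x \<in> set (bp S) \<Longrightarrow> subgroup (stabilizer G act x) G" for x
    using group_action.stabilizer_subgroup[OF S(2)] by blast
  then show ?thesis using S
    by (auto simp: j_ob_def additive_completion_def conj_cat_def burnside_cat_def)
qed

lemma j_elem_props:
  fixes G :: "'g monoid" (structure)
  assumes "base_point_choice G bp" "S \<in> Ob (GSets G)" "T \<in> Ob (GSets G)"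
    and \<phi>: "\<phi> \<in> Mor (GSets G) S T" and i: "i < length (bp S)"
  shows "j_index G bp S T \<phi> i < length (bp T)" (is "?f < _")
    and "j_elem G bp S T \<phi> i \<in> carrier G" (is "?g \<in> _")
    and "\<phi> (bp S ! i) = snd T (j_elem G bp S T \<phi> i) (bp T ! j_index G bp S T \<phi> i)"
    and "\<And>h. h \<in> j_ob G bp S ! i \<Longrightarrow>
      inv (j_elem G bp S T \<phi> i) \<otimes> h \<otimes> j_elem G bp S T \<phi> i
        \<in> j_ob G bp T ! j_index G bp S T \<phi> i"
proof -
  obtain E act where S: "S = (E, act)" "group_action G E act"
    using assms(2) by (auto simp: GSets_def)
  obtain E' act' where T: "T = (E', act')" "group_action G E' act'"
    using assms(3) by (auto simp: GSets_def)
  interpret A: group_action G E' act' by (fact T(2))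
  interpret group G by (rule A.group_hom[THEN group_hom.axioms(1)])
  have bE: "bp S ! i \<in> E" using assms(1,2) S(1) i by (fastforce simp: base_point_choice_def)
  then have pE: "\<phi> (bp S ! i) \<in> E'" using \<phi> S(1) T(1) by (auto simp: GSets_def)
  have "set (bp T) \<subseteq> fst T"
    and "\<And>Q. Q \<in> orbits G (fst T) (snd T) \<Longrightarrow> \<exists>!a. a < length (bp T) \<and> bp T ! a \<in> Q"
    using assms(1,3) unfolding base_point_choice_def by blast+
  then have bT: "set (bp T) \<subseteq> E'"
    and ex: "\<And>Q. Q \<in> orbits G E' act' \<Longrightarrow> \<exists>!a. a < length (bp T) \<and> bp T ! a \<in> Q"
    unfolding T(1) by simp_all
  have eqv: "bp T ! a \<in> orbit G act' (\<phi> (bp S ! i)) \<longleftrightarrow>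
      (\<exists>g \<in> carrier G. \<phi> (bp S ! i) = snd T g (bp T ! a))" if "a < length (bp T)" for a
  proof -
    have "bp T ! a \<in> E'" using bT that by auto
    then have "bp T ! a \<in> orbit G act' (\<phi> (bp S ! i)) \<longleftrightarrow> \<phi> (bp S ! i) \<in> orbit G act' (bp T ! a)"
      using A.orbit_sym pE by blast
    then show ?thesis by (auto simp: orbit_def T(1))
  qed
  have "orbit G act' (\<phi> (bp S ! i)) \<in> orbits G E' act'" using pE by (auto simp: orbits_def)
  from ex[OF this] have "\<exists>!a. a < length (bp T) \<and> (\<exists>g \<in> carrier G. \<phi> (bp S ! i) = snd T g (bp T ! a))"
    using eqv by (simp cong: conj_cong)
  from theI'[OF this] have f: "?f < length (bp T)"
    and g: "\<exists>g. g \<in> carrier G \<and> \<phi> (bp S ! i) = snd T g (bp T ! ?f)"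
    by (auto simp: j_index_def)
  from someI_ex[OF g] have g: "?g \<in> carrier G" "\<phi> (bp S ! i) = snd T ?g (bp T ! ?f)"
    by (auto simp: j_elem_def)
  show "?f < length (bp T)" "?g \<in> carrier G" "\<phi> (bp S ! i) = snd T ?g (bp T ! ?f)" by fact+
  have cE: "bp T ! ?f \<in> E'" using bT f by auto
  fix h assume "h \<in> j_ob G bp S ! i"
  then have h: "h \<in> carrier G" "act h (bp S ! i) = bp S ! i"
    using i S(1) by (auto simp: j_ob_def stabilizer_def)
  have "\<phi> (act h (bp S ! i)) = act' h (\<phi> (bp S ! i))"
    using \<phi> S(1) T(1) h(1) bE by (auto simp: GSets_def)
  then have hp: "act' h (act' ?g (bp T ! ?f)) = act' ?g (bp T ! ?f)"
    using h g T(1) by simp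
  have "act' (inv ?g \<otimes> h \<otimes> ?g) (bp T ! ?f) = act' (inv ?g) (act' h (act' ?g (bp T ! ?f)))"
    using g(1) h(1) cE A.element_image[OF g(1) cE refl] by (simp add: A.composition_rule m_assoc)
  also have "\<dots> = bp T ! ?f"
    unfolding hp using g(1) cE by (rule A.orbit_sym_aux[OF _ _ refl])
  finally show "inv ?g \<otimes> h \<otimes> ?g \<in> j_ob G bp T ! ?f"
    using f g(1) h(1) T(1) by (simp add: j_ob_def stabilizer_def)
qed

lemma j_mor_in:
  assumes "group G" "finite (carrier G)" "base_point_choice G bp"
    and "S \<in> Ob (GSets G)" "T \<in> Ob (GSets G)" "\<phi> \<in> Mor (GSets G) S T"
  shows "j_cov G bp S T \<phi> \<in> Mor (B_bullet G) (j_ob G bp S) (j_ob G bp T)"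
    and "j_con G bp S T \<phi> \<in> Mor (B_bullet G) (j_ob G bp T) (j_ob G bp S)"
proof -
  note p = j_elem_props[OF assms(3-6)]
  have sub: "subgroup (j_ob G bp U ! i) G" if "U \<in> Ob (GSets G)" "i < length (bp U)" for U i
    using j_ob_in[OF assms(3) that(1)] that(2)
    by (auto simp: j_ob_def additive_completion_def conj_cat_def burnside_cat_def)
  have fin: "finite K" if "subgroup K G" for K
    using that assms(2) finite_subset subgroup.subset by blast
  have sub': "subgroup (j_ob G bp S ! i) G" "subgroup (j_ob G bp T ! a) G"
    if "i < length (bp S)" "a < length (bp T)" for a i
    using that sub assms(4,5) by simp_all
  have "conjugation_biset G (j_ob G bp T ! a) (j_ob G bp S ! i)
      (if a = j_index G bp S T \<phi> i
       then cov_biset G (j_ob G bp T ! a) (j_elem G bp S T \<phi> i) else biset_empty)"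
    and "conjugation_biset G (j_ob G bp S ! i) (j_ob G bp T ! a)
      (if a = j_index G bp S T \<phi> i
       then con_biset G (j_ob G bp T ! a) (j_elem G bp S T \<phi> i) else biset_empty)"
    if "a < length (bp T)" "i < length (bp S)" for a i
    using that p[of i] sub'
    by (auto intro!: cov_biset_conjugation con_biset_conjugation assms(1) conjugation_biset_empty fin)
  then show "j_cov G bp S T \<phi> \<in> Mor (B_bullet G) (j_ob G bp S) (j_ob G bp T)"
    and "j_con G bp S T \<phi> \<in> Mor (B_bullet G) (j_ob G bp T) (j_ob G bp S)"
    by (auto simp: additive_completion_def j_cov_def j_con_def j_ob_def PiE_iff
        intro!: conjugation_biset_mor split del: if_split)
qed

end

(*
  A span p : X -> S, q : X -> T of finite G-sets gives a matrix of bifree bisets, with entry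
  {(x, k). p x = b and k (q x) = c} at base points b of S and c of T. The matrices j_*(phi) and
  j^*(phi) come from the spans S = S -> T and T <- S = S. Composing matrices by balanced products
  amounts to composing spans by pullback, because every point of the pullback passes through the
  orbit of exactly one base point of T. Functoriality of j_* and j^* and axiom (M1) are all
  instances of this one fact. The matrix of a span is also additive in X, so for S = S1 + S2 the
  maps i1_*, i2_*, i1^*, i2^* satisfy the biproduct identities, which any additive functor
  preserves; this is (M2).
*)
theory Submission
  imports Defs
begin

text \<open>Bisets in the image of j are given through chosen elements g_i, and multiplying matrices
  would multiply these choices together. A point of a span biset instead carries a group element
  moving q x to the base point c as part of its data, so nothing has to be chosen or tracked;
  \<open>j_elem\<close> enters only in the comparison of \<open>j_cov\<close> and
  \<open>j_con\<close> with span matrices. All matrices that occur have classes of actual bisets as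
  entries. The formula (ac + bd) - (ad + bc) therefore has to be evaluated only on pairs
  representing actual elements, where it collapses to one balanced product. The identities for a
  disjoint union also involve zero morphisms, whereas additivity of F speaks of sums. The zero
  morphism is obtained as the matrix z of the span with empty apex: z + z = z, so its image under F
  is an idempotent of an abelian group and hence trivial. The same fact, applied to the identity of
  the empty G-set, gives the value at the empty set.\<close>

section \<open>The Grothendieck group\<close>

text \<open>The constants on Grothendieck groups and bisets take plain \<open>monoid\<close> records, not the extensible
  ones of the library locales.\<close>

locale groth_monoid = comm_monoid M for M :: "'a monoid" (structure)
begin

lemma equiv_groth_rel: "equiv (carrier M \<times> carrier M) (groth_rel M)"
proof (rule equivI)
  show "groth_rel M \<subseteq> (carrier M \<times> carrier M) \<times> (carrier M \<times> carrier M)"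
    by (auto simp: groth_rel_def)
  show "refl_on (carrier M \<times> carrier M) (groth_rel M)"
    by (auto simp: groth_rel_def refl_on_def)
  show "sym (groth_rel M)"
    by (rule symI) (force simp: groth_rel_def)
  show "trans (groth_rel M)"
  proof (rule transI, clarsimp simp: groth_rel_def)
    fix a b c d e f k l
    assume [simp]: "a \<in> carrier M" "b \<in> carrier M" "c \<in> carrier M" "d \<in> carrier M"
      "e \<in> carrier M" "f \<in> carrier M" "k \<in> carrier M" "l \<in> carrier M"
    assume 1: "a \<otimes> d \<otimes> k = c \<otimes> b \<otimes> k" and 2: "c \<otimes> f \<otimes> l = e \<otimes> d \<otimes> l"
    \<comment> \<open>The middle pair must be eliminated without cancellation, so its entry
      \<open>d\<close> joins \<open>k\<close> and \<open>l\<close> in the witness.\<close>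
    have "a \<otimes> f \<otimes> (d \<otimes> k \<otimes> l) = (a \<otimes> d \<otimes> k) \<otimes> (f \<otimes> l)" by (simp add: m_ac)
    also have "\<dots> = (c \<otimes> f \<otimes> l) \<otimes> (b \<otimes> k)" unfolding 1 by (simp add: m_ac)
    also have "\<dots> = e \<otimes> b \<otimes> (d \<otimes> k \<otimes> l)" unfolding 2 by (simp add: m_ac)
    finally show "\<exists>m \<in> carrier M. a \<otimes> f \<otimes> m = e \<otimes> b \<otimes> m"
      by (intro bexI[of _ "d \<otimes> k \<otimes> l"]) auto
  qed
qed

lemma groth_class_eq_iff:
  assumes "a \<in> carrier M" "b \<in> carrier M" "c \<in> carrier M" "d \<in> carrier M"
  shows "groth_rel M `` {(a, b)} = groth_rel M `` {(c, d)} \<longleftrightarrow>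
    (\<exists>k \<in> carrier M. a \<otimes> d \<otimes> k = c \<otimes> b \<otimes> k)"
  using eq_equiv_class_iff[OF equiv_groth_rel, of "(a, b)" "(c, d)"] assms
  by (simp add: groth_rel_def)

lemma mem_groth_class_iff:
  assumes "a \<in> carrier M" "b \<in> carrier M"
  shows "(c, d) \<in> groth_rel M `` {(a, b)} \<longleftrightarrow> c \<in> carrier M \<and> d \<in> carrier M \<and>
    groth_rel M `` {(c, d)} = groth_rel M `` {(a, b)}"
  using assms equiv_class_eq_iff[OF equiv_groth_rel, of "(a, b)" "(c, d)"] by auto

text \<open>Operations on classes are defined as the image under \<open>groth_rel\<close> of the set
  of results over all representatives. This is the form that well-definedness takes: as soon as
  there is a result and all results lie in one class, the image is that class.\<close>

lemma groth_Image_eq: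
  assumes "a \<in> carrier M" "b \<in> carrier M" "U \<noteq> {}" "U \<subseteq> groth_rel M `` {(a, b)}"
  shows "groth_rel M `` U = groth_rel M `` {(a, b)}"
proof -
  have "groth_rel M `` {u} = groth_rel M `` {(a, b)}" if "u \<in> U" for u
    using assms that by (cases u) (use mem_groth_class_iff[OF assms(1,2)] in blast)
  then show ?thesis using assms(3) by (subst Image_eq_UN) auto
qed

lemma groth_carrier_cases:
  assumes "p \<in> carrier (groth_group M)"
  obtains a b where "a \<in> carrier M" "b \<in> carrier M" "p = groth_rel M `` {(a, b)}"
  using assms by (auto simp: groth_group_def elim!: quotientE)

lemma groth_class_in [simp]:
  "a \<in> carrier M \<Longrightarrow> b \<in> carrier M \<Longrightarrow> groth_rel M `` {(a, b)} \<in> carrier (groth_group M)"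
  by (auto simp: groth_group_def intro: quotientI)

lemma groth_mult:
  assumes [simp]: "a \<in> carrier M" "b \<in> carrier M" "c \<in> carrier M" "d \<in> carrier M"
  shows "groth_rel M `` {(a, b)} \<otimes>\<^bsub>groth_group M\<^esub> groth_rel M `` {(c, d)} =
    groth_rel M `` {(a \<otimes> c, b \<otimes> d)}"
proof -
  have eq: "groth_rel M `` {(a' \<otimes> c', b' \<otimes> d')} = groth_rel M `` {(a \<otimes> c, b \<otimes> d)}"
    if [simp]: "a' \<in> carrier M" "b' \<in> carrier M" "c' \<in> carrier M" "d' \<in> carrier M"
      and ab: "groth_rel M `` {(a', b')} = groth_rel M `` {(a, b)}"
      and cd: "groth_rel M `` {(c', d')} = groth_rel M `` {(c, d)}" for a' b' c' d'
  proof -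
    obtain k l where [simp]: "k \<in> carrier M" "l \<in> carrier M"
      and 1: "a' \<otimes> b \<otimes> k = a \<otimes> b' \<otimes> k" and 2: "c' \<otimes> d \<otimes> l = c \<otimes> d' \<otimes> l"
      using ab cd by (auto simp: groth_class_eq_iff)
    have "a' \<otimes> c' \<otimes> (b \<otimes> d) \<otimes> (k \<otimes> l) = (a' \<otimes> b \<otimes> k) \<otimes> (c' \<otimes> d \<otimes> l)" by (simp add: m_ac)
    also have "\<dots> = a \<otimes> c \<otimes> (b' \<otimes> d') \<otimes> (k \<otimes> l)" unfolding 1 2 by (simp add: m_ac)
    finally show ?thesis by (subst groth_class_eq_iff) (auto intro!: bexI[of _ "k \<otimes> l"])
  qed
  let ?U = "{(a' \<otimes> c', b' \<otimes> d') | a' b' c' d'.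
    (a', b') \<in> groth_rel M `` {(a, b)} \<and> (c', d') \<in> groth_rel M `` {(c, d)}}"
  have "(a, b) \<in> groth_rel M `` {(a, b)}" "(c, d) \<in> groth_rel M `` {(c, d)}"
    by (simp_all add: mem_groth_class_iff del: Image_singleton_iff)
  then have "?U \<noteq> {}" by blast
  moreover have "?U \<subseteq> groth_rel M `` {(a \<otimes> c, b \<otimes> d)}"
  proof
    fix u assume "u \<in> ?U"
    then obtain a' b' c' d' where u: "u = (a' \<otimes> c', b' \<otimes> d')"
      "(a', b') \<in> groth_rel M `` {(a, b)}" "(c', d') \<in> groth_rel M `` {(c, d)}"
      by blast
    then show "u \<in> groth_rel M `` {(a \<otimes> c, b \<otimes> d)}"
      using eq[of a' b' c' d'] by (simp add: mem_groth_class_iff del: Image_singleton_iff)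
  qed
  ultimately have "groth_rel M `` ?U = groth_rel M `` {(a \<otimes> c, b \<otimes> d)}"
    by (intro groth_Image_eq) simp_all
  then show ?thesis by (simp add: groth_group_def)
qed

lemma groth_one: "\<one>\<^bsub>groth_group M\<^esub> = groth_rel M `` {(\<one>, \<one>)}"
  by (simp add: groth_group_def groth_of_def)

lemma comm_group_groth_group: "comm_group (groth_group M)"
proof (rule comm_groupI)
  show "\<one>\<^bsub>groth_group M\<^esub> \<in> carrier (groth_group M)" by (simp add: groth_one)
next
  fix x assume "x \<in> carrier (groth_group M)"
  then obtain a b where [simp]: "a \<in> carrier M" "b \<in> carrier M" and x: "x = groth_rel M `` {(a, b)}"
    by (rule groth_carrier_cases)
  have "groth_rel M `` {(b, a)} \<otimes>\<^bsub>groth_group M\<^esub> x = \<one>\<^bsub>groth_group M\<^esub>"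
    unfolding x groth_one by (subst groth_mult) (auto simp: groth_class_eq_iff m_ac intro!: bexI[of _ \<one>])
  then show "\<exists>y \<in> carrier (groth_group M). y \<otimes>\<^bsub>groth_group M\<^esub> x = \<one>\<^bsub>groth_group M\<^esub>"
    by (rule bexI) simp
  show "\<one>\<^bsub>groth_group M\<^esub> \<otimes>\<^bsub>groth_group M\<^esub> x = x" by (simp add: x groth_one groth_mult)
next
  fix x y assume "x \<in> carrier (groth_group M)" "y \<in> carrier (groth_group M)"
  then obtain a b c d where [simp]: "a \<in> carrier M" "b \<in> carrier M" "c \<in> carrier M" "d \<in> carrier M"
    and x: "x = groth_rel M `` {(a, b)}" and y: "y = groth_rel M `` {(c, d)}"
    by (meson groth_carrier_cases)
  show "x \<otimes>\<^bsub>groth_group M\<^esub> y \<in> carrier (groth_group M)"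
    and "x \<otimes>\<^bsub>groth_group M\<^esub> y = y \<otimes>\<^bsub>groth_group M\<^esub> x"
    by (simp_all add: x y groth_mult m_comm)
  fix z assume "z \<in> carrier (groth_group M)"
  then obtain e f where [simp]: "e \<in> carrier M" "f \<in> carrier M" and z: "z = groth_rel M `` {(e, f)}"
    by (rule groth_carrier_cases)
  show "x \<otimes>\<^bsub>groth_group M\<^esub> y \<otimes>\<^bsub>groth_group M\<^esub> z =
      x \<otimes>\<^bsub>groth_group M\<^esub> (y \<otimes>\<^bsub>groth_group M\<^esub> z)"
    by (simp add: x y z groth_mult m_assoc)
qed

lemma groth_of_in [simp]: "a \<in> carrier M \<Longrightarrow> groth_of M a \<in> carrier (groth_group M)"
  by (simp add: groth_of_def)

lemma groth_of_mult:
  "a \<in> carrier M \<Longrightarrow> b \<in> carrier M \<Longrightarrow>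
    groth_of M (a \<otimes> b) = groth_of M a \<otimes>\<^bsub>groth_group M\<^esub> groth_of M b"
  by (simp add: groth_of_def groth_mult)

lemma groth_of_eq_iff:
  "a \<in> carrier M \<Longrightarrow> b \<in> carrier M \<Longrightarrow>
    groth_of M a = groth_of M b \<longleftrightarrow> (\<exists>k \<in> carrier M. a \<otimes> k = b \<otimes> k)"
  by (simp add: groth_of_def groth_class_eq_iff)

text \<open>A pair stands for \<open>a - b\<close>, so membership amounts to the equation
  \<open>a = c + b\<close> in the Grothendieck group, where group laws apply.\<close>

lemma mem_groth_of_iff:
  assumes "c \<in> carrier M"
  shows "(a, b) \<in> groth_of M c \<longleftrightarrow>
    a \<in> carrier M \<and> b \<in> carrier M \<and> groth_of M a = groth_of M (c \<otimes> b)"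
  using assms
  by (auto simp: groth_of_def mem_groth_class_iff groth_class_eq_iff
      simp del: Image_singleton_iff cong: conj_cong)

lemma groth_of_one: "groth_of M \<one> = \<one>\<^bsub>groth_group M\<^esub>"
  by (simp add: groth_group_def)

end

text \<open>Representatives satisfy \<open>a - b = x\<close> and \<open>c - d = y\<close>, and
  biadditivity gives \<open>(a - b)(c - d) = x y\<close> in the Grothendieck group of
  \<open>L\<close>. Hence every choice of representatives produces a pair in the class of
  \<open>m x y\<close>.\<close>

lemma groth_biadditive:
  fixes M :: "'a monoid" and N :: "'b monoid" and L :: "'c monoid"
  assumes "comm_monoid M" "comm_monoid N" "comm_monoid L"
    and cl: "\<And>a c. a \<in> carrier M \<Longrightarrow> c \<in> carrier N \<Longrightarrow> m a c \<in> carrier L"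
    and l: "\<And>a b c. a \<in> carrier M \<Longrightarrow> b \<in> carrier M \<Longrightarrow> c \<in> carrier N \<Longrightarrow>
      m (a \<otimes>\<^bsub>M\<^esub> b) c = m a c \<otimes>\<^bsub>L\<^esub> m b c"
    and r: "\<And>a c d. a \<in> carrier M \<Longrightarrow> c \<in> carrier N \<Longrightarrow> d \<in> carrier N \<Longrightarrow>
      m a (c \<otimes>\<^bsub>N\<^esub> d) = m a c \<otimes>\<^bsub>L\<^esub> m a d"
    and x: "x \<in> carrier M" and y: "y \<in> carrier N"
  shows "groth_rel L `` {(m a c \<otimes>\<^bsub>L\<^esub> m b d, m a d \<otimes>\<^bsub>L\<^esub> m b c) | a b c d.
      (a, b) \<in> groth_of M x \<and> (c, d) \<in> groth_of N y} = groth_of L (m x y)"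
proof -
  interpret M: groth_monoid M using assms by (intro groth_monoid.intro)
  interpret N: groth_monoid N using assms by (intro groth_monoid.intro)
  interpret L: groth_monoid L using assms by (intro groth_monoid.intro)
  interpret K: comm_group "groth_group L" by (rule L.comm_group_groth_group)
  note [simp] = x y cl
  \<comment> \<open>The monoid \<open>L\<close> may fail to be cancellative. Reading the values of
    \<open>m\<close> in its Grothendieck group makes common summands cancel.\<close>
  define \<mu> where "\<mu> = (\<lambda>a c. groth_of L (m a c))"
  have [simp]: "\<mu> a c \<in> carrier (groth_group L)" if "a \<in> carrier M" "c \<in> carrier N" for a c
    using that by (simp add: \<mu>_def)
  have l\<mu>: "\<mu> (a \<otimes>\<^bsub>M\<^esub> b) c = \<mu> a c \<otimes>\<^bsub>groth_group L\<^esub> \<mu> b c"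
    if "a \<in> carrier M" "b \<in> carrier M" "c \<in> carrier N" for a b c
    using that by (simp add: \<mu>_def l L.groth_of_mult)
  have r\<mu>: "\<mu> a (c \<otimes>\<^bsub>N\<^esub> d) = \<mu> a c \<otimes>\<^bsub>groth_group L\<^esub> \<mu> a d"
    if "a \<in> carrier M" "c \<in> carrier N" "d \<in> carrier N" for a c d
    using that by (simp add: \<mu>_def r L.groth_of_mult)
  \<comment> \<open>Some \<open>k\<close> satisfies \<open>a + k = x + b + k\<close>. Additivity in
    the first argument carries this over to \<open>\<mu>\<close>, where the summand
    \<open>\<mu> k c\<close> cancels.\<close>
  have l': "\<mu> a c = \<mu> x c \<otimes>\<^bsub>groth_group L\<^esub> \<mu> b c"
    if ab: "(a, b) \<in> groth_of M x" and cd: "c \<in> carrier N" for a b c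
  proof -
    obtain k where k: "a \<in> carrier M" "b \<in> carrier M" "k \<in> carrier M"
      "a \<otimes>\<^bsub>M\<^esub> k = x \<otimes>\<^bsub>M\<^esub> b \<otimes>\<^bsub>M\<^esub> k"
      using ab by (auto simp: M.mem_groth_of_iff M.groth_of_eq_iff)
    have "\<mu> a c \<otimes>\<^bsub>groth_group L\<^esub> \<mu> k c = \<mu> x c \<otimes>\<^bsub>groth_group L\<^esub> \<mu> b c \<otimes>\<^bsub>groth_group L\<^esub> \<mu> k c"
      using k cd by (metis l\<mu> M.m_closed x)
    then show ?thesis using k cd by simp
  qed
  have r': "\<mu> a c = \<mu> a y \<otimes>\<^bsub>groth_group L\<^esub> \<mu> a d"
    if ab: "(c, d) \<in> groth_of N y" and cd: "a \<in> carrier M" for a c d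
  proof -
    obtain k where k: "c \<in> carrier N" "d \<in> carrier N" "k \<in> carrier N"
      "c \<otimes>\<^bsub>N\<^esub> k = y \<otimes>\<^bsub>N\<^esub> d \<otimes>\<^bsub>N\<^esub> k"
      using ab by (auto simp: N.mem_groth_of_iff N.groth_of_eq_iff)
    have "\<mu> a c \<otimes>\<^bsub>groth_group L\<^esub> \<mu> a k = \<mu> a y \<otimes>\<^bsub>groth_group L\<^esub> \<mu> a d \<otimes>\<^bsub>groth_group L\<^esub> \<mu> a k"
      using k cd by (metis r\<mu> N.m_closed y)
    then show ?thesis using k cd by simp
  qed
  have in_M: "a \<in> carrier M \<and> b \<in> carrier M" if "(a, b) \<in> groth_of M x" for a b
    using that by (simp add: M.mem_groth_of_iff)
  have in_N: "c \<in> carrier N \<and> d \<in> carrier N" if "(c, d) \<in> groth_of N y" for c d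
    using that by (simp add: N.mem_groth_of_iff)
  have "(m a c \<otimes>\<^bsub>L\<^esub> m b d, m a d \<otimes>\<^bsub>L\<^esub> m b c) \<in> groth_of L (m x y)"
    if ab: "(a, b) \<in> groth_of M x" and cd: "(c, d) \<in> groth_of N y" for a b c d
  proof -
    note [simp] = in_M[OF ab, THEN conjunct1] in_M[OF ab, THEN conjunct2]
      in_N[OF cd, THEN conjunct1] in_N[OF cd, THEN conjunct2]
    have "\<mu> a c \<otimes>\<^bsub>groth_group L\<^esub> \<mu> b d =
        \<mu> x y \<otimes>\<^bsub>groth_group L\<^esub> (\<mu> a d \<otimes>\<^bsub>groth_group L\<^esub> \<mu> b c)"
      unfolding l'[OF ab, of c, simplified] l'[OF ab, of d, simplified] r'[OF cd x]
      by (simp add: K.m_ac)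
    then have "groth_of L (m a c \<otimes>\<^bsub>L\<^esub> m b d) = groth_of L (m x y \<otimes>\<^bsub>L\<^esub> (m a d \<otimes>\<^bsub>L\<^esub> m b c))"
      by (simp add: \<mu>_def L.groth_of_mult)
    then show ?thesis by (simp add: L.mem_groth_of_iff)
  qed
  \<comment> \<open>These pairs show that the set of results is not empty.\<close>
  moreover have "(x, \<one>\<^bsub>M\<^esub>) \<in> groth_of M x" "(y, \<one>\<^bsub>N\<^esub>) \<in> groth_of N y"
    by (simp_all add: M.mem_groth_of_iff N.mem_groth_of_iff)
  ultimately show ?thesis
    unfolding groth_of_def[of L] by (intro L.groth_Image_eq) (fastforce simp: groth_of_def[symmetric])+
qed

section \<open>Bisets and balanced products\<close>

lemma mem_Plus_iff: "Inl a \<in> A <+> B \<longleftrightarrow> a \<in> A" "Inr b \<in> A <+> B \<longleftrightarrow> b \<in> B"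
  by auto

text \<open>With the two quotient maps in place of \<open>F\<close> and \<open>F'\<close>, this is
  the surjectivity in the proof that balanced products distribute over sums.\<close>

lemma image_map_sum_left:
  "(\<lambda>(s, y). map_sum (\<lambda>x. F {(x, y)}) (\<lambda>x. F' {(x, y)}) s) ` ((A <+> B) \<times> Y) =
    (\<lambda>z. F {z}) ` (A \<times> Y) <+> (\<lambda>z. F' {z}) ` (B \<times> Y)"
  by (force simp: Plus_def image_iff)

lemma image_map_sum_right:
  "(\<lambda>(x, s). map_sum (\<lambda>y. F {(x, y)}) (\<lambda>y. F' {(x, y)}) s) ` (X \<times> (A <+> B)) =
    (\<lambda>z. F {z}) ` (X \<times> A) <+> (\<lambda>z. F' {z}) ` (X \<times> B)"
  by (force simp: Plus_def image_iff)

lemma biset_isoE: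
  assumes "biset_iso H\<^sub>2 H\<^sub>1 X Y"
  obtains f where "bij_betw f (pts X) (pts Y)"
    and "\<And>h x. h \<in> H\<^sub>2 \<Longrightarrow> x \<in> pts X \<Longrightarrow> f (lact X h x) = lact Y h (f x)"
    and "\<And>h x. h \<in> H\<^sub>1 \<Longrightarrow> x \<in> pts X \<Longrightarrow> f (ract X x h) = ract Y (f x) h"
proof -
  obtain f where f: "bij_betw f (pts X) (pts Y)"
      "\<forall>h \<in> H\<^sub>2. \<forall>x \<in> pts X. f (lact X h x) = lact Y h (f x)"
      "\<forall>h \<in> H\<^sub>1. \<forall>x \<in> pts X. f (ract X x h) = ract Y (f x) h"
    using assms unfolding biset_iso_def by blast
  show thesis by (rule that[of f]) (use f in simp_all)
qed

locale plain_group = group G for G :: "'g monoid" (structure)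
begin

lemma bifree_bisetD:
  assumes "bifree_biset G H\<^sub>2 H\<^sub>1 X"
  shows "finite (pts X)"
    and "\<And>h x. h \<in> H\<^sub>2 \<Longrightarrow> x \<in> pts X \<Longrightarrow> lact X h x \<in> pts X"
    and "\<And>x. x \<in> pts X \<Longrightarrow> lact X \<one> x = x"
    and "\<And>h k x. h \<in> H\<^sub>2 \<Longrightarrow> k \<in> H\<^sub>2 \<Longrightarrow> x \<in> pts X \<Longrightarrow> lact X (h \<otimes> k) x = lact X h (lact X k x)"
    and "\<And>h x. h \<in> H\<^sub>1 \<Longrightarrow> x \<in> pts X \<Longrightarrow> ract X x h \<in> pts X"
    and "\<And>x. x \<in> pts X \<Longrightarrow> ract X x \<one> = x"
    and "\<And>h k x. h \<in> H\<^sub>1 \<Longrightarrow> k \<in> H\<^sub>1 \<Longrightarrow> x \<in> pts X \<Longrightarrow> ract X x (h \<otimes> k) = ract X (ract X x h) k"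
    and "\<And>h k x. h \<in> H\<^sub>2 \<Longrightarrow> k \<in> H\<^sub>1 \<Longrightarrow> x \<in> pts X \<Longrightarrow>
      lact X h (ract X x k) = ract X (lact X h x) k"
  using assms by (simp_all add: bifree_biset_def is_biset_def)

lemma bifree_biset_freeD:
  assumes "bifree_biset G H\<^sub>2 H\<^sub>1 X"
  shows "\<And>h x. h \<in> H\<^sub>2 \<Longrightarrow> x \<in> pts X \<Longrightarrow> lact X h x = x \<Longrightarrow> h = \<one>"
    and "\<And>h x. h \<in> H\<^sub>1 \<Longrightarrow> x \<in> pts X \<Longrightarrow> ract X x h = x \<Longrightarrow> h = \<one>"
  using assms unfolding bifree_biset_def by blast+

text \<open>Nothing is assumed about \<open>Z\<close> itself: all its points have the form
  \<open>f x\<close>, and equivariance dictates the actions there. To equate two classes it is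
  therefore enough to know that the source of an isomorphism is bifree.\<close>

lemma bifree_biset_iso:
  assumes H: "subgroup H\<^sub>2 G" "subgroup H\<^sub>1 G" and X: "bifree_biset G H\<^sub>2 H\<^sub>1 X"
    and "biset_iso H\<^sub>2 H\<^sub>1 X Z"
  shows "bifree_biset G H\<^sub>2 H\<^sub>1 Z"
proof -
  obtain f where f: "bij_betw f (pts X) (pts Z)"
      "\<And>h x. h \<in> H\<^sub>2 \<Longrightarrow> x \<in> pts X \<Longrightarrow> f (lact X h x) = lact Z h (f x)"
      "\<And>h x. h \<in> H\<^sub>1 \<Longrightarrow> x \<in> pts X \<Longrightarrow> f (ract X x h) = ract Z (f x) h"
    by (rule biset_isoE[OF assms(4)]) blast
  have p: "pts Z = f ` pts X" using f(1) by (simp add: bij_betw_def)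
  have inj: "f x = f y \<longleftrightarrow> x = y" if "x \<in> pts X" "y \<in> pts X" for x y
    using that f(1) by (auto simp: bij_betw_def dest: inj_onD)
  note XD = bifree_bisetD[OF X]
  have "is_biset G H\<^sub>2 H\<^sub>1 Z"
    unfolding is_biset_def p
    using H[THEN subgroup.one_closed] H[THEN subgroup.m_closed]
    by (simp add: f(2,3)[symmetric] XD)
  moreover have "h = \<one>" if "h \<in> H\<^sub>2" "x \<in> pts X" "lact Z h (f x) = f x" for h x
    using that bifree_biset_freeD(1)[OF X] by (simp add: f(2)[symmetric] inj XD)
  moreover have "h = \<one>" if "h \<in> H\<^sub>1" "x \<in> pts X" "ract Z (f x) h = f x" for h x
    using that bifree_biset_freeD(2)[OF X] by (simp add: f(3)[symmetric] inj XD)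
  ultimately show ?thesis using XD(1) unfolding bifree_biset_def p by blast
qed

lemma biset_class_eqI:
  assumes "subgroup H\<^sub>2 G" "subgroup H\<^sub>1 G" "bifree_biset G H\<^sub>2 H\<^sub>1 X" "biset_iso H\<^sub>2 H\<^sub>1 X Y"
  shows "biset_class G H\<^sub>2 H\<^sub>1 X = biset_class G H\<^sub>2 H\<^sub>1 Y"
  using bifree_biset_iso[OF assms] assms
  by (intro biset_class_cong) (simp_all add: bifree_biset_def)

lemma biset_class_memD:
  assumes "subgroup H\<^sub>2 G" "subgroup H\<^sub>1 G" "bifree_biset G H\<^sub>2 H\<^sub>1 X" "Z \<in> biset_class G H\<^sub>2 H\<^sub>1 X"
  shows "bifree_biset G H\<^sub>2 H\<^sub>1 Z" "biset_iso H\<^sub>2 H\<^sub>1 X Z"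
  using assms by (auto simp: biset_class_def)

text \<open>Members of a class have points in \<open>nat\<close>, so a finite biset over another
  type must first be copied there. Without a member, the unions that define sum and composition of
  classes would be empty.\<close>

lemma biset_class_nonempty:
  assumes X: "bifree_biset G H\<^sub>2 H\<^sub>1 X" and H: "subgroup H\<^sub>2 G" "subgroup H\<^sub>1 G"
  shows "\<exists>Z. Z \<in> biset_class G H\<^sub>2 H\<^sub>1 X"
proof -
  obtain f :: "_ \<Rightarrow> nat" and n where f: "inj_on f (pts X)"
    using finite_imp_inj_to_nat_seg[OF bifree_bisetD(1)[OF X]] by blast
  define u where "u = inv_into (pts X) f"
  have uf [simp]: "u (f x) = x" if "x \<in> pts X" for x
    using that f by (simp add: u_def)
  define Z where "Z = \<lparr>pts = f ` pts X, lact = (\<lambda>h z. f (lact X h (u z))),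
    ract = (\<lambda>z h. f (ract X (u z) h))\<rparr>"
  have "biset_iso H\<^sub>2 H\<^sub>1 X Z"
    unfolding biset_iso_def using f by (intro exI[of _ f]) (auto simp: Z_def bij_betw_def)
  then show ?thesis
    using bifree_biset_iso[OF H X] by (auto simp: biset_class_def)
qed

lemma biset_class_in:
  assumes X: "bifree_biset G H\<^sub>2 H\<^sub>1 X" and H: "subgroup H\<^sub>2 G" "subgroup H\<^sub>1 G"
  shows "biset_class G H\<^sub>2 H\<^sub>1 X \<in> carrier (biset_monoid G H\<^sub>2 H\<^sub>1)"
proof -
  obtain Z where Z: "Z \<in> biset_class G H\<^sub>2 H\<^sub>1 X" using biset_class_nonempty[OF assms] by blast
  note Z = biset_class_memD[OF H X Z]
  from biset_class_eqI[OF H X Z(2)] Z(1) show ?thesis by (auto simp: biset_monoid_def)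
qed

section \<open>The commutative monoid of isomorphism classes under disjoint union\<close>

lemma biset_monoid_cases:
  assumes "A \<in> carrier (biset_monoid G H\<^sub>2 H\<^sub>1)"
  obtains X :: "('g, nat) biset" where "bifree_biset G H\<^sub>2 H\<^sub>1 X" "A = biset_class G H\<^sub>2 H\<^sub>1 X"
  using assms by (auto simp: biset_monoid_def)

lemma biset_iso_sum:
  assumes "biset_iso H\<^sub>2 H\<^sub>1 X X'" "biset_iso H\<^sub>2 H\<^sub>1 Y Y'"
  shows "biset_iso H\<^sub>2 H\<^sub>1 (biset_sum X Y) (biset_sum X' Y')"
proof -
  obtain f where f: "bij_betw f (pts X) (pts X')"
      "\<And>h x. h \<in> H\<^sub>2 \<Longrightarrow> x \<in> pts X \<Longrightarrow> f (lact X h x) = lact X' h (f x)"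
      "\<And>h x. h \<in> H\<^sub>1 \<Longrightarrow> x \<in> pts X \<Longrightarrow> f (ract X x h) = ract X' (f x) h"
    by (rule biset_isoE[OF assms(1)]) blast
  obtain g where g: "bij_betw g (pts Y) (pts Y')"
      "\<And>h x. h \<in> H\<^sub>2 \<Longrightarrow> x \<in> pts Y \<Longrightarrow> g (lact Y h x) = lact Y' h (g x)"
      "\<And>h x. h \<in> H\<^sub>1 \<Longrightarrow> x \<in> pts Y \<Longrightarrow> g (ract Y x h) = ract Y' (g x) h"
    by (rule biset_isoE[OF assms(2)]) blast
  have "bij_betw (map_sum f g) (pts X <+> pts Y) (pts X' <+> pts Y')"
    using f(1) g(1) unfolding bij_betw_def
    by (auto simp: inj_on_eq_iff Plus_def image_Un image_image intro!: inj_onI)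
  then show ?thesis
    unfolding biset_iso_def biset_sum_def using f(2,3) g(2,3)
    by (intro exI[of _ "map_sum f g"]) auto
qed

lemma bifree_biset_sum:
  assumes "bifree_biset G H\<^sub>2 H\<^sub>1 X" "bifree_biset G H\<^sub>2 H\<^sub>1 Y"
  shows "bifree_biset G H\<^sub>2 H\<^sub>1 (biset_sum X Y)"
  unfolding bifree_biset_def is_biset_def biset_sum_def
  using bifree_biset_freeD[OF assms(1)] bifree_biset_freeD[OF assms(2)]
  by (auto simp: bifree_bisetD[OF assms(1)] bifree_bisetD[OF assms(2)])

lemma bifree_biset_empty: "bifree_biset G H\<^sub>2 H\<^sub>1 biset_empty"
  by (simp add: bifree_biset_def is_biset_def biset_empty_def)

text \<open>The union defining \<open>mult\<close> runs over all pairs of members. Each pair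
  contributes the same class, and both factors are inhabited, so the union is that class.\<close>

lemma biset_class_mult:
  assumes H: "subgroup H\<^sub>2 G" "subgroup H\<^sub>1 G"
    and X: "bifree_biset G H\<^sub>2 H\<^sub>1 X" and Y: "bifree_biset G H\<^sub>2 H\<^sub>1 Y"
  shows "biset_class G H\<^sub>2 H\<^sub>1 X \<otimes>\<^bsub>biset_monoid G H\<^sub>2 H\<^sub>1\<^esub> biset_class G H\<^sub>2 H\<^sub>1 Y =
    biset_class G H\<^sub>2 H\<^sub>1 (biset_sum X Y)"
proof -
  have "biset_class G H\<^sub>2 H\<^sub>1 (biset_sum X' Y') = biset_class G H\<^sub>2 H\<^sub>1 (biset_sum X Y)"
    if "X' \<in> biset_class G H\<^sub>2 H\<^sub>1 X" "Y' \<in> biset_class G H\<^sub>2 H\<^sub>1 Y" for X' Y'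
    using biset_class_memD[OF H X that(1)] biset_class_memD[OF H Y that(2)]
    by (intro sym[OF biset_class_eqI[OF H]] bifree_biset_sum X Y biset_iso_sum)
  then show ?thesis
    using biset_class_nonempty[OF X H] biset_class_nonempty[OF Y H]
    by (auto simp: biset_monoid_def)
qed

lemma biset_iso_sum_assoc:
  fixes X :: "('g, 'a) biset" and Y :: "('g, 'b) biset" and Z :: "('g, 'c) biset"
  shows "biset_iso H\<^sub>2 H\<^sub>1 (biset_sum (biset_sum X Y) Z) (biset_sum X (biset_sum Y Z))"
proof -
  define f :: "('a + 'b) + 'c \<Rightarrow> 'a + ('b + 'c)"
    where "f = case_sum (map_sum id Inl) (Inr \<circ> Inr)"
  define g :: "'a + ('b + 'c) \<Rightarrow> ('a + 'b) + 'c"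
    where "g = case_sum (Inl \<circ> Inl) (map_sum Inr id)"
  have "bij_betw f ((pts X <+> pts Y) <+> pts Z) (pts X <+> (pts Y <+> pts Z))"
    by (rule bij_betw_byWitness[where f' = g]) (auto simp: f_def g_def)
  then show ?thesis
    unfolding biset_iso_def biset_sum_def by (intro exI[of _ f]) (auto simp: f_def)
qed

lemma biset_iso_sum_comm: "biset_iso H\<^sub>2 H\<^sub>1 (biset_sum X Y) (biset_sum Y X)"
proof -
  have "bij_betw (case_sum Inr Inl) (pts X <+> pts Y) (pts Y <+> pts X)"
    by (rule bij_betw_byWitness[where f' = "case_sum Inr Inl"]) auto
  then show ?thesis
    unfolding biset_iso_def biset_sum_def by (intro exI[of _ "case_sum Inr Inl"]) auto
qed

lemma biset_iso_sum_empty: "biset_iso H\<^sub>2 H\<^sub>1 X (biset_sum biset_empty X)"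
  unfolding biset_iso_def biset_sum_def biset_empty_def
  by (intro exI[of _ Inr]) (auto simp: bij_betw_def)

text \<open>The actions are left arbitrary, because empty span bisets and empty pieces of a biset
  come with actions other than those of \<open>biset_empty\<close>.\<close>

lemma biset_class_empty:
  assumes H: "subgroup H\<^sub>2 G" "subgroup H\<^sub>1 G" and "pts X = {}"
  shows "biset_class G H\<^sub>2 H\<^sub>1 X = \<one>\<^bsub>biset_monoid G H\<^sub>2 H\<^sub>1\<^esub>"
  using assms(3) unfolding biset_monoid_def monoid.simps
  by (intro biset_class_eqI[OF H]) (auto simp: bifree_biset_def is_biset_def biset_iso_def biset_empty_def bij_betw_def)

lemma groth_monoid_biset_monoid:
  assumes H: "subgroup H\<^sub>2 G" "subgroup H\<^sub>1 G"
  shows "groth_monoid (biset_monoid G H\<^sub>2 H\<^sub>1)"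
proof (intro groth_monoid.intro comm_monoidI)
  show "\<one>\<^bsub>biset_monoid G H\<^sub>2 H\<^sub>1\<^esub> \<in> carrier (biset_monoid G H\<^sub>2 H\<^sub>1)"
    using biset_class_in[OF bifree_biset_empty H] by (simp add: biset_monoid_def)
next
  fix A assume "A \<in> carrier (biset_monoid G H\<^sub>2 H\<^sub>1)"
  then obtain X :: "('g, nat) biset" where X: "bifree_biset G H\<^sub>2 H\<^sub>1 X" "A = biset_class G H\<^sub>2 H\<^sub>1 X"
    by (rule biset_monoid_cases)
  have "\<one>\<^bsub>biset_monoid G H\<^sub>2 H\<^sub>1\<^esub> = biset_class G H\<^sub>2 H\<^sub>1 (biset_empty :: ('g, nat) biset)"
    by (simp add: biset_monoid_def)
  then show "\<one>\<^bsub>biset_monoid G H\<^sub>2 H\<^sub>1\<^esub> \<otimes>\<^bsub>biset_monoid G H\<^sub>2 H\<^sub>1\<^esub> A = A"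
    by (simp add: X biset_class_mult[OF H bifree_biset_empty]
        biset_class_eqI[OF H X(1) biset_iso_sum_empty, symmetric])
next
  fix A B assume "A \<in> carrier (biset_monoid G H\<^sub>2 H\<^sub>1)" "B \<in> carrier (biset_monoid G H\<^sub>2 H\<^sub>1)"
  then obtain X Y :: "('g, nat) biset" where X: "bifree_biset G H\<^sub>2 H\<^sub>1 X" "A = biset_class G H\<^sub>2 H\<^sub>1 X"
    and Y: "bifree_biset G H\<^sub>2 H\<^sub>1 Y" "B = biset_class G H\<^sub>2 H\<^sub>1 Y"
    by (meson biset_monoid_cases)
  note XY = bifree_biset_sum[OF X(1) Y(1)]
  show "A \<otimes>\<^bsub>biset_monoid G H\<^sub>2 H\<^sub>1\<^esub> B \<in> carrier (biset_monoid G H\<^sub>2 H\<^sub>1)"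
    using biset_class_in[OF XY H] by (simp add: X Y biset_class_mult[OF H])
  show "A \<otimes>\<^bsub>biset_monoid G H\<^sub>2 H\<^sub>1\<^esub> B = B \<otimes>\<^bsub>biset_monoid G H\<^sub>2 H\<^sub>1\<^esub> A"
    using biset_class_eqI[OF H XY biset_iso_sum_comm] by (simp add: X Y biset_class_mult[OF H])
  fix C assume "C \<in> carrier (biset_monoid G H\<^sub>2 H\<^sub>1)"
  then obtain Z :: "('g, nat) biset" where Z: "bifree_biset G H\<^sub>2 H\<^sub>1 Z" "C = biset_class G H\<^sub>2 H\<^sub>1 Z"
    by (rule biset_monoid_cases)
  show "A \<otimes>\<^bsub>biset_monoid G H\<^sub>2 H\<^sub>1\<^esub> B \<otimes>\<^bsub>biset_monoid G H\<^sub>2 H\<^sub>1\<^esub> C =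
      A \<otimes>\<^bsub>biset_monoid G H\<^sub>2 H\<^sub>1\<^esub> (B \<otimes>\<^bsub>biset_monoid G H\<^sub>2 H\<^sub>1\<^esub> C)"
    using biset_class_eqI[OF H bifree_biset_sum[OF XY Z(1)] biset_iso_sum_assoc]
    by (simp add: X Y Z biset_class_mult[OF H] bifree_biset_sum)
qed

section \<open>Balanced products over a subgroup\<close>

text \<open>\<open>balanced_rel\<close> consists of single moves, with no closure taken. Since
  \<open>H\<^sub>2\<close> is a group acting on both factors, a single move already reaches
  everything equivalent to \<open>(x, y)\<close>, and the class is an orbit.\<close>

lemma balanced_class:
  assumes H: "subgroup H\<^sub>2 G"
    and X: "bifree_biset G H\<^sub>3 H\<^sub>2 X" and Y: "bifree_biset G H\<^sub>2 H\<^sub>1 Y"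
    and "x \<in> pts X" "y \<in> pts Y"
  shows "balanced_rel H\<^sub>2 X Y `` {(x, y)} = (\<lambda>u. (ract X x u, lact Y (inv u) y)) ` H\<^sub>2"
    (is "?L = ?R")
proof
  note XD = bifree_bisetD[OF X] and YD = bifree_bisetD[OF Y]
  note S = subgroup.m_inv_closed[OF H] subgroup.one_closed[OF H] subgroup.mem_carrier[OF H]
  show "?L \<subseteq> ?R"
  proof
    fix z assume "z \<in> ?L"
    then obtain x' h where z: "z = (x', lact Y h y)" "x' \<in> pts X" "h \<in> H\<^sub>2" "x = ract X x' h"
      by (auto simp: balanced_rel_def)
    \<comment> \<open>The move starts at \<open>(x' h, y)\<close>, so \<open>x'\<close> is recovered
      from \<open>x\<close> by the inverse of \<open>h\<close>.\<close>
    have "ract X x (inv h) = x'"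
      using z XD(7)[of h "inv h" x'] XD(6)[of x'] S by simp
    with z S show "z \<in> ?R" by (intro image_eqI[of _ _ "inv h"]) auto
  qed
  show "?R \<subseteq> ?L"
  proof (rule image_subsetI)
    fix u assume u: "u \<in> H\<^sub>2"
    then have "ract X (ract X x u) (inv u) = x"
      using assms(4) XD(7)[of u "inv u" x] XD(6)[of x] S by simp
    moreover have "((ract X (ract X x u) (inv u), y), (ract X x u, lact Y (inv u) y)) \<in> balanced_rel H\<^sub>2 X Y"
      unfolding balanced_rel_def using u assms(4,5) XD(5) S(1) by blast
    ultimately show "(ract X x u, lact Y (inv u) y) \<in> ?L" by simp
  qed
qed

lemma balanced_class_eq_iff:
  assumes H: "subgroup H\<^sub>2 G"
    and X: "bifree_biset G H\<^sub>3 H\<^sub>2 X" and Y: "bifree_biset G H\<^sub>2 H\<^sub>1 Y"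
    and "x \<in> pts X" "y \<in> pts Y" "x' \<in> pts X" "y' \<in> pts Y"
  shows "balanced_rel H\<^sub>2 X Y `` {(x, y)} = balanced_rel H\<^sub>2 X Y `` {(x', y')} \<longleftrightarrow>
    (\<exists>u \<in> H\<^sub>2. x' = ract X x u \<and> y = lact Y u y')" (is "?l = ?r \<longleftrightarrow> _")
proof
  note XD = bifree_bisetD[OF X] and YD = bifree_bisetD[OF Y]
  note [simp] = subgroup.m_inv_closed[OF H] subgroup.one_closed[OF H] subgroup.mem_carrier[OF H]
    subgroup.m_closed[OF H]
  note B = balanced_class[OF H X Y]
  assume eq: "?l = ?r"
  have "(x', y') \<in> ?r"
    unfolding B[OF assms(6,7)] using assms(6,7) XD(6) YD(3) by (intro image_eqI[of _ _ \<one>]) simp_all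
  then have "(x', y') \<in> ?l" unfolding eq .
  then obtain u where u: "u \<in> H\<^sub>2" "x' = ract X x u" "y' = lact Y (inv u) y"
    unfolding B[OF assms(4,5)] by blast
  have "lact Y u y' = y" using u(1) YD(3)[of y] YD(4)[of u "inv u" y] assms(5) by (simp add: u(3))
  from u(1,2) this[symmetric] show "\<exists>u \<in> H\<^sub>2. x' = ract X x u \<and> y = lact Y u y'"
    by (intro bexI[of _ u] conjI)
next
  note XD = bifree_bisetD[OF X] and YD = bifree_bisetD[OF Y]
  note [simp] = subgroup.m_inv_closed[OF H] subgroup.one_closed[OF H] subgroup.mem_carrier[OF H]
    subgroup.m_closed[OF H]
  assume "\<exists>u \<in> H\<^sub>2. x' = ract X x u \<and> y = lact Y u y'"
  then obtain u where u: "u \<in> H\<^sub>2" "x' = ract X x u" "y = lact Y u y'"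
    by (elim bexE conjE)
  \<comment> \<open>Left translation by \<open>u\<close> permutes \<open>H\<^sub>2\<close>;
    reindexing by it turns the orbit of \<open>(x, y)\<close> into that of
    \<open>(x', y')\<close>.\<close>
  have img: "(\<otimes>) u ` H\<^sub>2 = H\<^sub>2"
  proof
    show "(\<otimes>) u ` H\<^sub>2 \<subseteq> H\<^sub>2" using u(1) by (intro image_subsetI) simp
    show "H\<^sub>2 \<subseteq> (\<otimes>) u ` H\<^sub>2"
    proof
      fix v assume "v \<in> H\<^sub>2"
      with u(1) show "v \<in> (\<otimes>) u ` H\<^sub>2"
        by (intro image_eqI[of _ _ "inv u \<otimes> v"]) (simp_all add: m_assoc[symmetric])
    qed
  qed
  have y': "lact Y (inv v) y' = lact Y (inv (u \<otimes> v)) y" if "v \<in> H\<^sub>2" for v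
    using that u(1) assms(7) YD(4)[of "inv v \<otimes> inv u" u y'] by (simp add: u(3) inv_mult_group m_assoc)
  have "?r = (\<lambda>v. (ract X x v, lact Y (inv v) y)) ` (\<otimes>) u ` H\<^sub>2"
    unfolding balanced_class[OF H X Y assms(6,7)] image_image
  proof (intro image_cong refl)
    fix v assume "v \<in> H\<^sub>2"
    then show "(ract X x' v, lact Y (inv v) y') = (ract X x (u \<otimes> v), lact Y (inv (u \<otimes> v)) y)"
      using u(1,2) assms(4) y' XD(7)[of u v x] by simp
  qed
  then show "?l = ?r"
    unfolding img balanced_class[OF H X Y assms(4,5)] by simp
qed

text \<open>The outer actions are defined on a class as images of all its members. They commute with
  moving a middle element from one factor to the other, so the image is again a full class.\<close>

lemma balanced_product_simps:
  assumes H: "subgroup H\<^sub>2 G"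
    and X: "bifree_biset G H\<^sub>3 H\<^sub>2 X" and Y: "bifree_biset G H\<^sub>2 H\<^sub>1 Y"
  defines "P \<equiv> balanced_product H\<^sub>2 X Y"
  shows "pts P = (\<lambda>z. balanced_rel H\<^sub>2 X Y `` {z}) ` (pts X \<times> pts Y)"
    and "h \<in> H\<^sub>3 \<Longrightarrow> x \<in> pts X \<Longrightarrow> y \<in> pts Y \<Longrightarrow> lact P h (balanced_rel H\<^sub>2 X Y `` {(x, y)}) =
      balanced_rel H\<^sub>2 X Y `` {(lact X h x, y)}"
    and "k \<in> H\<^sub>1 \<Longrightarrow> x \<in> pts X \<Longrightarrow> y \<in> pts Y \<Longrightarrow> ract P (balanced_rel H\<^sub>2 X Y `` {(x, y)}) k =
      balanced_rel H\<^sub>2 X Y `` {(x, ract Y y k)}"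
proof -
  note XD = bifree_bisetD[OF X] and YD = bifree_bisetD[OF Y]
  show "pts P = (\<lambda>z. balanced_rel H\<^sub>2 X Y `` {z}) ` (pts X \<times> pts Y)"
    by (auto simp: P_def balanced_product_def quotient_def)
  show "lact P h (balanced_rel H\<^sub>2 X Y `` {(x, y)}) = balanced_rel H\<^sub>2 X Y `` {(lact X h x, y)}"
    if "h \<in> H\<^sub>3" "x \<in> pts X" "y \<in> pts Y"
    using that XD(2,8) unfolding P_def balanced_product_def biset.simps
    by (subst (1 2) balanced_class[OF H X Y]) (auto simp: image_image cong: image_cong)
  show "ract P (balanced_rel H\<^sub>2 X Y `` {(x, y)}) k = balanced_rel H\<^sub>2 X Y `` {(x, ract Y y k)}"
    if "k \<in> H\<^sub>1" "x \<in> pts X" "y \<in> pts Y"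
    using that YD(5,8) subgroup.m_inv_closed[OF H] unfolding P_def balanced_product_def biset.simps
    by (subst (1 2) balanced_class[OF H X Y]) (auto simp: image_image cong: image_cong)
qed

text \<open>If \<open>h\<close> fixes the class of \<open>(x, y)\<close>, some \<open>u\<close> in
  the middle group satisfies \<open>y = u y\<close> and \<open>x = h x u\<close>. Left freeness of
  \<open>Y\<close> gives \<open>u = \<one>\<close>, then left freeness of \<open>X\<close> gives
  \<open>h = \<one>\<close>. The other side is symmetric.\<close>

lemma bifree_balanced_product:
  assumes H: "subgroup H\<^sub>2 G"
    and X: "bifree_biset G H\<^sub>3 H\<^sub>2 X" and Y: "bifree_biset G H\<^sub>2 H\<^sub>1 Y"
    and H3: "subgroup H\<^sub>3 G" and H1: "subgroup H\<^sub>1 G"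
  shows "bifree_biset G H\<^sub>3 H\<^sub>1 (balanced_product H\<^sub>2 X Y)"
proof -
  note XD = bifree_bisetD[OF X] and YD = bifree_bisetD[OF Y]
  note P = balanced_product_simps[OF H X Y]
  have fl: "h = \<one>" if h: "h \<in> H\<^sub>3" and xy: "x \<in> pts X" "y \<in> pts Y" and
    "balanced_rel H\<^sub>2 X Y `` {(lact X h x, y)} = balanced_rel H\<^sub>2 X Y `` {(x, y)}" for h x y
  proof -
    from that obtain u where u: "u \<in> H\<^sub>2" "x = ract X (lact X h x) u" "y = lact Y u y"
      by (subst (asm) balanced_class_eq_iff[OF H X Y]) (auto simp: XD)
    then have "u = \<one>" using bifree_biset_freeD(1)[OF Y] xy by metis
    with u h xy show ?thesis using XD(2,6) bifree_biset_freeD(1)[OF X] by metis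
  qed
  have fr: "k = \<one>" if k: "k \<in> H\<^sub>1" and xy: "x \<in> pts X" "y \<in> pts Y" and
    "balanced_rel H\<^sub>2 X Y `` {(x, ract Y y k)} = balanced_rel H\<^sub>2 X Y `` {(x, y)}" for k x y
  proof -
    from that obtain u where u: "u \<in> H\<^sub>2" "x = ract X x u" "ract Y y k = lact Y u y"
      by (subst (asm) balanced_class_eq_iff[OF H X Y]) (auto simp: YD)
    then have "u = \<one>" using bifree_biset_freeD(2)[OF X] xy by metis
    with u k xy show ?thesis using YD(3) bifree_biset_freeD(2)[OF Y] by metis
  qed
  have "h = \<one>" if "h \<in> H\<^sub>3" "c \<in> pts (balanced_product H\<^sub>2 X Y)"
      "lact (balanced_product H\<^sub>2 X Y) h c = c" for h c
    using that unfolding P(1) by (elim imageE) (clarify, rule fl, simp_all only: P(2))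
  moreover have "h = \<one>" if "h \<in> H\<^sub>1" "c \<in> pts (balanced_product H\<^sub>2 X Y)"
      "ract (balanced_product H\<^sub>2 X Y) c h = c" for h c
    using that unfolding P(1) by (elim imageE) (clarify, rule fr, simp_all only: P(3))
  moreover have "is_biset G H\<^sub>3 H\<^sub>1 (balanced_product H\<^sub>2 X Y)"
    unfolding is_biset_def P(1) using assms(4,5)[THEN subgroup.one_closed]
      assms(4,5)[THEN subgroup.m_closed]
    by (simp add: P(2,3) XD YD del: Image_singleton_iff)
  moreover have "finite (pts (balanced_product H\<^sub>2 X Y))"
    unfolding P(1) using XD(1) YD(1) by simp
  ultimately show ?thesis unfolding bifree_biset_def by blast
qed

text \<open>The universal property of the quotient, in a form that spares its users the classes: an
  equivariant surjection from pairs whose fibres are exactly the orbits of the middle group descends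
  to an isomorphism.\<close>

lemma balanced_product_isoI:
  assumes H: "subgroup H\<^sub>2 G"
    and X: "bifree_biset G H\<^sub>3 H\<^sub>2 X" and Y: "bifree_biset G H\<^sub>2 H\<^sub>1 Y"
    and surj: "(\<lambda>(x, y). f x y) ` (pts X \<times> pts Y) = pts Z"
    and rel: "\<And>x y x' y'. x \<in> pts X \<Longrightarrow> y \<in> pts Y \<Longrightarrow> x' \<in> pts X \<Longrightarrow> y' \<in> pts Y \<Longrightarrow>
      f x y = f x' y' \<longleftrightarrow> (\<exists>u \<in> H\<^sub>2. x' = ract X x u \<and> y = lact Y u y')"
    and l: "\<And>h x y. h \<in> H\<^sub>3 \<Longrightarrow> x \<in> pts X \<Longrightarrow> y \<in> pts Y \<Longrightarrow> f (lact X h x) y = lact Z h (f x y)"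
    and r: "\<And>h x y. h \<in> H\<^sub>1 \<Longrightarrow> x \<in> pts X \<Longrightarrow> y \<in> pts Y \<Longrightarrow> f x (ract Y y h) = ract Z (f x y) h"
  shows "biset_iso H\<^sub>3 H\<^sub>1 (balanced_product H\<^sub>2 X Y) Z"
proof -
  note XD = bifree_bisetD[OF X] and YD = bifree_bisetD[OF Y]
  note P = balanced_product_simps[OF H X Y]
  have rel': "f x y = f x' y' \<longleftrightarrow>
      balanced_rel H\<^sub>2 X Y `` {(x, y)} = balanced_rel H\<^sub>2 X Y `` {(x', y')}"
    if "x \<in> pts X" "y \<in> pts Y" "x' \<in> pts X" "y' \<in> pts Y" for x y x' y'
    using that by (simp add: rel balanced_class_eq_iff[OF H X Y])
  \<comment> \<open>\<open>F\<close> evaluates \<open>f\<close> at some representative of a class;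
    by \<open>rel'\<close> the choice of representative does not affect the value.\<close>
  define F where "F = (\<lambda>c. SOME z. \<exists>x \<in> pts X. \<exists>y \<in> pts Y.
    c = balanced_rel H\<^sub>2 X Y `` {(x, y)} \<and> z = f x y)"
  have F: "F (balanced_rel H\<^sub>2 X Y `` {(x, y)}) = f x y" if "x \<in> pts X" "y \<in> pts Y" for x y
    unfolding F_def
  proof (rule some_equality)
    fix z assume "\<exists>x' \<in> pts X. \<exists>y' \<in> pts Y.
      balanced_rel H\<^sub>2 X Y `` {(x, y)} = balanced_rel H\<^sub>2 X Y `` {(x', y')} \<and> z = f x' y'"
    then show "z = f x y" using rel'[OF that] by metis
  qed (use that in blast)
  have "bij_betw F (pts (balanced_product H\<^sub>2 X Y)) (pts Z)"
    unfolding bij_betw_def P(1)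
  proof
    show "inj_on F ((\<lambda>z. balanced_rel H\<^sub>2 X Y `` {z}) ` (pts X \<times> pts Y))"
      by (rule inj_onI) (auto simp: F rel' simp del: Image_singleton_iff)
    show "F ` (\<lambda>z. balanced_rel H\<^sub>2 X Y `` {z}) ` (pts X \<times> pts Y) = pts Z"
      unfolding surj[symmetric] image_image by (intro image_cong) (auto simp: F)
  qed
  then show ?thesis
    unfolding biset_iso_def
    by (intro exI[of _ F]) (auto simp: P F XD YD l r simp del: Image_singleton_iff)
qed

lemma balanced_product_cong:
  assumes H: "subgroup H\<^sub>2 G"
    and X: "bifree_biset G H\<^sub>3 H\<^sub>2 X" "bifree_biset G H\<^sub>3 H\<^sub>2 X'" "biset_iso H\<^sub>3 H\<^sub>2 X X'"
    and Y: "bifree_biset G H\<^sub>2 H\<^sub>1 Y" "bifree_biset G H\<^sub>2 H\<^sub>1 Y'" "biset_iso H\<^sub>2 H\<^sub>1 Y Y'"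
  shows "biset_iso H\<^sub>3 H\<^sub>1 (balanced_product H\<^sub>2 X Y) (balanced_product H\<^sub>2 X' Y')"
proof -
  obtain f where f: "bij_betw f (pts X) (pts X')"
      "\<And>h x. h \<in> H\<^sub>3 \<Longrightarrow> x \<in> pts X \<Longrightarrow> f (lact X h x) = lact X' h (f x)"
      "\<And>h x. h \<in> H\<^sub>2 \<Longrightarrow> x \<in> pts X \<Longrightarrow> f (ract X x h) = ract X' (f x) h"
    by (rule biset_isoE[OF X(3)]) blast
  obtain g where g: "bij_betw g (pts Y) (pts Y')"
      "\<And>h x. h \<in> H\<^sub>2 \<Longrightarrow> x \<in> pts Y \<Longrightarrow> g (lact Y h x) = lact Y' h (g x)"
      "\<And>h x. h \<in> H\<^sub>1 \<Longrightarrow> x \<in> pts Y \<Longrightarrow> g (ract Y x h) = ract Y' (g x) h"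
    by (rule biset_isoE[OF Y(3)]) blast
  have fX: "f x \<in> pts X'" if "x \<in> pts X" for x using f(1) that by (auto simp: bij_betw_def)
  have gY: "g y \<in> pts Y'" if "y \<in> pts Y" for y using g(1) that by (auto simp: bij_betw_def)
  have fi: "f x = f x' \<longleftrightarrow> x = x'" if "x \<in> pts X" "x' \<in> pts X" for x x'
    using f(1) that by (auto simp: bij_betw_def dest: inj_onD)
  have gi: "g y = g y' \<longleftrightarrow> y = y'" if "y \<in> pts Y" "y' \<in> pts Y" for y y'
    using g(1) that by (auto simp: bij_betw_def dest: inj_onD)
  note XD = bifree_bisetD[OF X(1)] and YD = bifree_bisetD[OF Y(1)]
  note P' = balanced_product_simps[OF H X(2) Y(2)]
  show ?thesis
  proof (rule balanced_product_isoI[OF H X(1) Y(1),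
        where f = "\<lambda>x y. balanced_rel H\<^sub>2 X' Y' `` {(f x, g y)}"])
    have "(\<lambda>(x, y). balanced_rel H\<^sub>2 X' Y' `` {(f x, g y)}) ` (pts X \<times> pts Y) =
        (\<lambda>z. balanced_rel H\<^sub>2 X' Y' `` {z}) ` (map_prod f g ` (pts X \<times> pts Y))"
      by (simp add: image_image case_prod_beta map_prod_def)
    also have "map_prod f g ` (pts X \<times> pts Y) = pts X' \<times> pts Y'"
      using f(1) g(1) by (simp add: bij_betw_def map_prod_surj_on)
    finally show "(\<lambda>(x, y). balanced_rel H\<^sub>2 X' Y' `` {(f x, g y)}) ` (pts X \<times> pts Y) =
        pts (balanced_product H\<^sub>2 X' Y')" by (simp add: P'(1))
  next
    fix x y x' y' assume xy: "x \<in> pts X" "y \<in> pts Y" "x' \<in> pts X" "y' \<in> pts Y"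
    have "(\<exists>u \<in> H\<^sub>2. f x' = ract X' (f x) u \<and> g y = lact Y' u (g y')) \<longleftrightarrow>
        (\<exists>u \<in> H\<^sub>2. x' = ract X x u \<and> y = lact Y u y')"
      using xy by (intro bex_cong refl) (simp add: f(3)[symmetric] g(2)[symmetric] fi gi XD YD)
    then show "balanced_rel H\<^sub>2 X' Y' `` {(f x, g y)} = balanced_rel H\<^sub>2 X' Y' `` {(f x', g y')} \<longleftrightarrow>
        (\<exists>u \<in> H\<^sub>2. x' = ract X x u \<and> y = lact Y u y')"
      using xy by (simp add: balanced_class_eq_iff[OF H X(2) Y(2)] fX gY)
  next
    fix h x y assume "h \<in> H\<^sub>3" "x \<in> pts X" "y \<in> pts Y"
    then show "balanced_rel H\<^sub>2 X' Y' `` {(f (lact X h x), g y)} =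
        lact (balanced_product H\<^sub>2 X' Y') h (balanced_rel H\<^sub>2 X' Y' `` {(f x, g y)})"
      by (simp only: P'(2) fX gY f(2))
  next
    fix h x y assume "h \<in> H\<^sub>1" "x \<in> pts X" "y \<in> pts Y"
    then show "balanced_rel H\<^sub>2 X' Y' `` {(f x, g (ract Y y h))} =
        ract (balanced_product H\<^sub>2 X' Y') (balanced_rel H\<^sub>2 X' Y' `` {(f x, g y)}) h"
      by (simp only: P'(3) fX gY g(3))
  qed
qed

subsection \<open>Morphisms of the Burnside category\<close>

lemma bclass_comp_biset_class:
  assumes H: "subgroup H\<^sub>3 G" "subgroup H\<^sub>2 G" "subgroup H\<^sub>1 G"
    and X: "bifree_biset G H\<^sub>3 H\<^sub>2 X" and Y: "bifree_biset G H\<^sub>2 H\<^sub>1 Y"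
  shows "bclass_comp G H\<^sub>3 H\<^sub>2 H\<^sub>1 (biset_class G H\<^sub>3 H\<^sub>2 X) (biset_class G H\<^sub>2 H\<^sub>1 Y) =
    biset_class G H\<^sub>3 H\<^sub>1 (balanced_product H\<^sub>2 X Y)"
proof -
  have "biset_class G H\<^sub>3 H\<^sub>1 (balanced_product H\<^sub>2 X' Y') =
      biset_class G H\<^sub>3 H\<^sub>1 (balanced_product H\<^sub>2 X Y)"
    if "X' \<in> biset_class G H\<^sub>3 H\<^sub>2 X" "Y' \<in> biset_class G H\<^sub>2 H\<^sub>1 Y" for X' Y'
    using biset_class_memD[OF H(1,2) X that(1)] biset_class_memD[OF H(2,3) Y that(2)]
    by (intro sym[OF biset_class_eqI[OF H(1,3)]] bifree_balanced_product balanced_product_cong H X Y)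
  then show ?thesis
    using biset_class_nonempty[OF X H(1,2)] biset_class_nonempty[OF Y H(2,3)]
    by (auto simp: bclass_comp_def)
qed

text \<open>Together with its mirror image below, this supplies the biadditivity by which
  composition extends to virtual bisets.\<close>

lemma balanced_product_sum_left:
  assumes H: "subgroup H\<^sub>2 G"
    and X: "bifree_biset G H\<^sub>3 H\<^sub>2 X" "bifree_biset G H\<^sub>3 H\<^sub>2 X'" and Y: "bifree_biset G H\<^sub>2 H\<^sub>1 Y"
  shows "biset_iso H\<^sub>3 H\<^sub>1 (balanced_product H\<^sub>2 (biset_sum X X') Y)
    (biset_sum (balanced_product H\<^sub>2 X Y) (balanced_product H\<^sub>2 X' Y))"
proof (rule balanced_product_isoI[OF H bifree_biset_sum[OF X] Y, where
      f = "\<lambda>s y. map_sum (\<lambda>x. balanced_rel H\<^sub>2 X Y `` {(x, y)}) (\<lambda>x. balanced_rel H\<^sub>2 X' Y `` {(x, y)}) s"])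
  note P = balanced_product_simps[OF H X(1) Y] balanced_product_simps[OF H X(2) Y]
  show "(\<lambda>(s, y). map_sum (\<lambda>x. balanced_rel H\<^sub>2 X Y `` {(x, y)})
      (\<lambda>x. balanced_rel H\<^sub>2 X' Y `` {(x, y)}) s) ` (pts (biset_sum X X') \<times> pts Y) =
    pts (biset_sum (balanced_product H\<^sub>2 X Y) (balanced_product H\<^sub>2 X' Y))"
    by (simp only: biset_sum_def biset.simps P image_map_sum_left)
next
  fix s y s' y' assume "s \<in> pts (biset_sum X X')" "y \<in> pts Y" "s' \<in> pts (biset_sum X X')" "y' \<in> pts Y"
  then show "map_sum (\<lambda>x. balanced_rel H\<^sub>2 X Y `` {(x, y)}) (\<lambda>x. balanced_rel H\<^sub>2 X' Y `` {(x, y)}) s =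
      map_sum (\<lambda>x. balanced_rel H\<^sub>2 X Y `` {(x, y')}) (\<lambda>x. balanced_rel H\<^sub>2 X' Y `` {(x, y')}) s' \<longleftrightarrow>
    (\<exists>u \<in> H\<^sub>2. s' = ract (biset_sum X X') s u \<and> y = lact Y u y')"
    by (cases s; cases s') (simp_all add: biset_sum_def mem_Plus_iff balanced_class_eq_iff[OF H X(1) Y]
        balanced_class_eq_iff[OF H X(2) Y] del: Image_singleton_iff)
next
  fix h s y assume "h \<in> H\<^sub>3" "s \<in> pts (biset_sum X X')" "y \<in> pts Y"
  then show "map_sum (\<lambda>x. balanced_rel H\<^sub>2 X Y `` {(x, y)}) (\<lambda>x. balanced_rel H\<^sub>2 X' Y `` {(x, y)})
      (lact (biset_sum X X') h s) =
    lact (biset_sum (balanced_product H\<^sub>2 X Y) (balanced_product H\<^sub>2 X' Y)) h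
      (map_sum (\<lambda>x. balanced_rel H\<^sub>2 X Y `` {(x, y)}) (\<lambda>x. balanced_rel H\<^sub>2 X' Y `` {(x, y)}) s)"
    by (cases s) (simp_all add: biset_sum_def mem_Plus_iff balanced_product_simps(2)[OF H X(1) Y]
        balanced_product_simps(2)[OF H X(2) Y] del: Image_singleton_iff)
next
  fix h s y assume "h \<in> H\<^sub>1" "s \<in> pts (biset_sum X X')" "y \<in> pts Y"
  then show "map_sum (\<lambda>x. balanced_rel H\<^sub>2 X Y `` {(x, ract Y y h)})
      (\<lambda>x. balanced_rel H\<^sub>2 X' Y `` {(x, ract Y y h)}) s =
    ract (biset_sum (balanced_product H\<^sub>2 X Y) (balanced_product H\<^sub>2 X' Y))
      (map_sum (\<lambda>x. balanced_rel H\<^sub>2 X Y `` {(x, y)}) (\<lambda>x. balanced_rel H\<^sub>2 X' Y `` {(x, y)}) s) h"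
    by (cases s) (simp_all add: biset_sum_def mem_Plus_iff balanced_product_simps(3)[OF H X(1) Y]
        balanced_product_simps(3)[OF H X(2) Y] del: Image_singleton_iff)
qed

lemma balanced_product_sum_right:
  assumes H: "subgroup H\<^sub>2 G"
    and X: "bifree_biset G H\<^sub>3 H\<^sub>2 X" and Y: "bifree_biset G H\<^sub>2 H\<^sub>1 Y" "bifree_biset G H\<^sub>2 H\<^sub>1 Y'"
  shows "biset_iso H\<^sub>3 H\<^sub>1 (balanced_product H\<^sub>2 X (biset_sum Y Y'))
    (biset_sum (balanced_product H\<^sub>2 X Y) (balanced_product H\<^sub>2 X Y'))"
proof (rule balanced_product_isoI[OF H X bifree_biset_sum[OF Y], where
      f = "\<lambda>x. map_sum (\<lambda>y. balanced_rel H\<^sub>2 X Y `` {(x, y)}) (\<lambda>y. balanced_rel H\<^sub>2 X Y' `` {(x, y)})"])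
  note P = balanced_product_simps[OF H X Y(1)] balanced_product_simps[OF H X Y(2)]
  show "(\<lambda>(x, s). map_sum (\<lambda>y. balanced_rel H\<^sub>2 X Y `` {(x, y)})
      (\<lambda>y. balanced_rel H\<^sub>2 X Y' `` {(x, y)}) s) ` (pts X \<times> pts (biset_sum Y Y')) =
    pts (biset_sum (balanced_product H\<^sub>2 X Y) (balanced_product H\<^sub>2 X Y'))"
    by (simp only: biset_sum_def biset.simps P image_map_sum_right)
next
  fix x s x' s' assume "x \<in> pts X" "s \<in> pts (biset_sum Y Y')" "x' \<in> pts X" "s' \<in> pts (biset_sum Y Y')"
  then show "map_sum (\<lambda>y. balanced_rel H\<^sub>2 X Y `` {(x, y)}) (\<lambda>y. balanced_rel H\<^sub>2 X Y' `` {(x, y)}) s =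
      map_sum (\<lambda>y. balanced_rel H\<^sub>2 X Y `` {(x', y)}) (\<lambda>y. balanced_rel H\<^sub>2 X Y' `` {(x', y)}) s' \<longleftrightarrow>
    (\<exists>u \<in> H\<^sub>2. x' = ract X x u \<and> s = lact (biset_sum Y Y') u s')"
    by (cases s; cases s') (simp_all add: biset_sum_def mem_Plus_iff balanced_class_eq_iff[OF H X Y(1)]
        balanced_class_eq_iff[OF H X Y(2)] del: Image_singleton_iff)
next
  fix h x s assume "h \<in> H\<^sub>3" "x \<in> pts X" "s \<in> pts (biset_sum Y Y')"
  then show "map_sum (\<lambda>y. balanced_rel H\<^sub>2 X Y `` {(lact X h x, y)})
      (\<lambda>y. balanced_rel H\<^sub>2 X Y' `` {(lact X h x, y)}) s =
    lact (biset_sum (balanced_product H\<^sub>2 X Y) (balanced_product H\<^sub>2 X Y')) h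
      (map_sum (\<lambda>y. balanced_rel H\<^sub>2 X Y `` {(x, y)}) (\<lambda>y. balanced_rel H\<^sub>2 X Y' `` {(x, y)}) s)"
    by (cases s) (simp_all add: biset_sum_def mem_Plus_iff balanced_product_simps(2)[OF H X Y(1)]
        balanced_product_simps(2)[OF H X Y(2)] del: Image_singleton_iff)
next
  fix h x s assume "h \<in> H\<^sub>1" "x \<in> pts X" "s \<in> pts (biset_sum Y Y')"
  then show "map_sum (\<lambda>y. balanced_rel H\<^sub>2 X Y `` {(x, y)}) (\<lambda>y. balanced_rel H\<^sub>2 X Y' `` {(x, y)})
      (ract (biset_sum Y Y') s h) =
    ract (biset_sum (balanced_product H\<^sub>2 X Y) (balanced_product H\<^sub>2 X Y'))
      (map_sum (\<lambda>y. balanced_rel H\<^sub>2 X Y `` {(x, y)}) (\<lambda>y. balanced_rel H\<^sub>2 X Y' `` {(x, y)}) s) h"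
    by (cases s) (simp_all add: biset_sum_def mem_Plus_iff balanced_product_simps(3)[OF H X Y(1)]
        balanced_product_simps(3)[OF H X Y(2)] del: Image_singleton_iff)
qed

text \<open>This is \<open>groth_biadditive\<close> for the composition of classes. From here on
  formal differences no longer appear: composing classes of bisets means forming balanced
  products.\<close>

lemma Comp_biset_mor:
  assumes H: "subgroup H\<^sub>3 G" "subgroup H\<^sub>2 G" "subgroup H\<^sub>1 G"
    and X: "bifree_biset G H\<^sub>3 H\<^sub>2 X" and Y: "bifree_biset G H\<^sub>2 H\<^sub>1 Y"
  shows "Comp (burnside_cat G) H\<^sub>1 H\<^sub>2 H\<^sub>3 (biset_mor G H\<^sub>3 H\<^sub>2 X) (biset_mor G H\<^sub>2 H\<^sub>1 Y) =
    biset_mor G H\<^sub>3 H\<^sub>1 (balanced_product H\<^sub>2 X Y)"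
proof -
  let ?M = "biset_monoid G H\<^sub>3 H\<^sub>2" and ?N = "biset_monoid G H\<^sub>2 H\<^sub>1" and ?L = "biset_monoid G H\<^sub>3 H\<^sub>1"
  let ?m = "bclass_comp G H\<^sub>3 H\<^sub>2 H\<^sub>1"
  have cm: "comm_monoid (biset_monoid G K K')" if "subgroup K G" "subgroup K' G" for K K'
    using groth_monoid_biset_monoid[OF that] by (simp add: groth_monoid_def)
  have "groth_rel ?L `` {(?m a c \<otimes>\<^bsub>?L\<^esub> ?m b d, ?m a d \<otimes>\<^bsub>?L\<^esub> ?m b c) | a b c d.
      (a, b) \<in> groth_of ?M (biset_class G H\<^sub>3 H\<^sub>2 X) \<and> (c, d) \<in> groth_of ?N (biset_class G H\<^sub>2 H\<^sub>1 Y)} =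
    groth_of ?L (?m (biset_class G H\<^sub>3 H\<^sub>2 X) (biset_class G H\<^sub>2 H\<^sub>1 Y))"
  proof (rule groth_biadditive)
    fix A C assume A: "A \<in> carrier ?M" and C: "C \<in> carrier ?N"
    obtain X :: "('g, nat) biset" where X: "bifree_biset G H\<^sub>3 H\<^sub>2 X" "A = biset_class G H\<^sub>3 H\<^sub>2 X"
      by (rule biset_monoid_cases[OF A])
    obtain Y :: "('g, nat) biset" where Y: "bifree_biset G H\<^sub>2 H\<^sub>1 Y" "C = biset_class G H\<^sub>2 H\<^sub>1 Y"
      by (rule biset_monoid_cases[OF C])
    show "?m A C \<in> carrier ?L"
      unfolding X(2) Y(2) bclass_comp_biset_class[OF H X(1) Y(1)]
      by (intro biset_class_in bifree_balanced_product H X Y)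
    {
      fix B assume B: "B \<in> carrier ?M"
      obtain X' :: "('g, nat) biset" where X': "bifree_biset G H\<^sub>3 H\<^sub>2 X'" "B = biset_class G H\<^sub>3 H\<^sub>2 X'"
        by (rule biset_monoid_cases[OF B])
      show "?m (A \<otimes>\<^bsub>?M\<^esub> B) C = ?m A C \<otimes>\<^bsub>?L\<^esub> ?m B C"
        using biset_class_eqI[OF H(1,3) bifree_balanced_product
            balanced_product_sum_left[OF H(2) X(1) X'(1) Y(1)]]
        by (simp add: X X' Y H biset_class_mult bclass_comp_biset_class bifree_biset_sum
            bifree_balanced_product)
    next
      fix D assume D: "D \<in> carrier ?N"
      obtain Y' :: "('g, nat) biset" where Y': "bifree_biset G H\<^sub>2 H\<^sub>1 Y'" "D = biset_class G H\<^sub>2 H\<^sub>1 Y'"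
        by (rule biset_monoid_cases[OF D])
      show "?m A (C \<otimes>\<^bsub>?N\<^esub> D) = ?m A C \<otimes>\<^bsub>?L\<^esub> ?m A D"
        using biset_class_eqI[OF H(1,3) bifree_balanced_product
            balanced_product_sum_right[OF H(2) X(1) Y(1) Y'(1)]]
        by (simp add: X Y Y' H biset_class_mult bclass_comp_biset_class bifree_biset_sum
            bifree_balanced_product)
    }
  qed (use H X Y in \<open>simp_all add: cm biset_class_in\<close>)
  then show ?thesis
    by (simp add: burnside_cat_def biset_mor_def Let_def bclass_comp_biset_class[OF H X Y])
qed

lemma hom_group_burnside_cat:
  "hom_group (burnside_cat G) H\<^sub>1 H\<^sub>2 = groth_group (biset_monoid G H\<^sub>2 H\<^sub>1)"
  by (simp add: hom_group_def burnside_cat_def)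

lemma comm_group_hom_group:
  assumes "subgroup H\<^sub>2 G" "subgroup H\<^sub>1 G"
  shows "comm_group (hom_group (burnside_cat G) H\<^sub>1 H\<^sub>2)"
  unfolding hom_group_burnside_cat
  by (rule groth_monoid.comm_group_groth_group[OF groth_monoid_biset_monoid[OF assms]])

lemma biset_mor_in:
  assumes "bifree_biset G H\<^sub>2 H\<^sub>1 X" "subgroup H\<^sub>2 G" "subgroup H\<^sub>1 G"
  shows "biset_mor G H\<^sub>2 H\<^sub>1 X \<in> Mor (burnside_cat G) H\<^sub>1 H\<^sub>2"
    and "biset_mor G H\<^sub>2 H\<^sub>1 X \<in> carrier (hom_group (burnside_cat G) H\<^sub>1 H\<^sub>2)"
  using groth_monoid.groth_of_in[OF groth_monoid_biset_monoid[OF assms(2,3)] biset_class_in[OF assms]]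
  by (simp_all add: burnside_cat_def biset_mor_def hom_group_def)

lemma biset_mor_eqI:
  assumes "subgroup H\<^sub>2 G" "subgroup H\<^sub>1 G" "bifree_biset G H\<^sub>2 H\<^sub>1 X" "biset_iso H\<^sub>2 H\<^sub>1 X Y"
  shows "biset_mor G H\<^sub>2 H\<^sub>1 X = biset_mor G H\<^sub>2 H\<^sub>1 Y"
  unfolding biset_mor_def by (simp only: biset_class_eqI[OF assms])

lemma biset_mor_empty:
  assumes "subgroup H\<^sub>2 G" "subgroup H\<^sub>1 G" "pts X = {}"
  shows "biset_mor G H\<^sub>2 H\<^sub>1 X = Zero (burnside_cat G) H\<^sub>1 H\<^sub>2"
  by (simp add: biset_mor_def biset_class_empty[OF assms] burnside_cat_def
      groth_monoid.groth_of_one[OF groth_monoid_biset_monoid[OF assms(1,2)]])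

lemma biset_mor_sum:
  assumes H: "subgroup H\<^sub>2 G" "subgroup H\<^sub>1 G"
    and "bifree_biset G H\<^sub>2 H\<^sub>1 X" "bifree_biset G H\<^sub>2 H\<^sub>1 Y"
  shows "biset_mor G H\<^sub>2 H\<^sub>1 (biset_sum X Y) =
    Add (burnside_cat G) H\<^sub>1 H\<^sub>2 (biset_mor G H\<^sub>2 H\<^sub>1 X) (biset_mor G H\<^sub>2 H\<^sub>1 Y)"
  by (simp add: biset_mor_def burnside_cat_def biset_class_mult[OF assms, symmetric]
      groth_monoid.groth_of_mult[OF groth_monoid_biset_monoid[OF H]] biset_class_in assms)

section \<open>Cutting a biset into invariant pieces\<close>

lemma biset_mor_partition:
  assumes H: "subgroup H\<^sub>2 G" "subgroup H\<^sub>1 G"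
    and Z: "bifree_biset G H\<^sub>2 H\<^sub>1 Z"
    and X: "bifree_biset G H\<^sub>2 H\<^sub>1 (Z\<lparr>pts := A\<rparr>)" and Y: "bifree_biset G H\<^sub>2 H\<^sub>1 (Z\<lparr>pts := B\<rparr>)"
    and AB: "A \<union> B = pts Z" "A \<inter> B = {}"
  shows "biset_mor G H\<^sub>2 H\<^sub>1 Z = Add (burnside_cat G) H\<^sub>1 H\<^sub>2
    (biset_mor G H\<^sub>2 H\<^sub>1 (Z\<lparr>pts := A\<rparr>)) (biset_mor G H\<^sub>2 H\<^sub>1 (Z\<lparr>pts := B\<rparr>))"
proof -
  have "bij_betw (case_sum id id) (A <+> B) (pts Z)"
    using AB by (auto simp: bij_betw_def inj_on_def Plus_def image_Un image_image)
  then have "biset_iso H\<^sub>2 H\<^sub>1 (biset_sum (Z\<lparr>pts := A\<rparr>) (Z\<lparr>pts := B\<rparr>)) Z"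
    unfolding biset_iso_def by (intro exI[of _ "case_sum id id"]) (auto simp: biset_sum_def)
  from biset_mor_eqI[OF H bifree_biset_sum[OF X Y] this] show ?thesis
    by (simp add: biset_mor_sum[OF H X Y])
qed

lemma bifree_biset_subset:
  assumes Z: "bifree_biset G H\<^sub>2 H\<^sub>1 Z" and "A \<subseteq> pts Z"
    and "\<And>h x. h \<in> H\<^sub>2 \<Longrightarrow> x \<in> A \<Longrightarrow> lact Z h x \<in> A"
    and "\<And>h x. h \<in> H\<^sub>1 \<Longrightarrow> x \<in> A \<Longrightarrow> ract Z x h \<in> A"
  shows "bifree_biset G H\<^sub>2 H\<^sub>1 (Z\<lparr>pts := A\<rparr>)"
proof -
  have "x \<in> pts Z" if "x \<in> A" for x using that assms(2) by blast
  then show ?thesis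
    using assms(3,4) bifree_biset_freeD[OF Z] finite_subset[OF assms(2)] bifree_bisetD[OF Z]
    unfolding bifree_biset_def is_biset_def by simp blast
qed

text \<open>The level sets of a function invariant under both actions are sub-bisets, and their
  classes add up to that of \<open>Z\<close>. In a matrix product, \<open>t\<close> will record the
  intermediate index, so that the level sets become the summands.\<close>

lemma biset_mor_finprod:
  assumes H: "subgroup H\<^sub>2 G" "subgroup H\<^sub>1 G"
    and Z: "bifree_biset G H\<^sub>2 H\<^sub>1 Z"
    and l: "\<And>h x. h \<in> H\<^sub>2 \<Longrightarrow> x \<in> pts Z \<Longrightarrow> t (lact Z h x) = t x"
    and r: "\<And>h x. h \<in> H\<^sub>1 \<Longrightarrow> x \<in> pts Z \<Longrightarrow> t (ract Z x h) = t x"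
    and t: "\<And>x. x \<in> pts Z \<Longrightarrow> t x < (n :: nat)"
  shows "biset_mor G H\<^sub>2 H\<^sub>1 Z = finprod (hom_group (burnside_cat G) H\<^sub>1 H\<^sub>2)
    (\<lambda>i. biset_mor G H\<^sub>2 H\<^sub>1 (Z\<lparr>pts := {x \<in> pts Z. t x = i}\<rparr>)) {..<n}"
proof -
  interpret K: comm_group "hom_group (burnside_cat G) H\<^sub>1 H\<^sub>2" by (rule comm_group_hom_group[OF H])
  note ZD = bifree_bisetD[OF Z]
  have bif: "bifree_biset G H\<^sub>2 H\<^sub>1 (Z\<lparr>pts := {x \<in> pts Z. P (t x)}\<rparr>)" for P
    by (rule bifree_biset_subset[OF Z]) (auto simp: ZD l r)
  note bm = biset_mor_in(2)[OF bif H]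
  \<comment> \<open>The bound varies while \<open>Z\<close> and \<open>t\<close> stay fixed: each
    step of the induction adds one more level set.\<close>
  have "biset_mor G H\<^sub>2 H\<^sub>1 (Z\<lparr>pts := {x \<in> pts Z. t x < m}\<rparr>) =
    finprod (hom_group (burnside_cat G) H\<^sub>1 H\<^sub>2)
      (\<lambda>i. biset_mor G H\<^sub>2 H\<^sub>1 (Z\<lparr>pts := {x \<in> pts Z. t x = i}\<rparr>)) {..<m}" for m
  proof (induction m)
    case 0
    then show ?case by (simp add: biset_mor_empty[OF H]) (simp add: hom_group_def)
  next
    case (Suc m)
    have "biset_mor G H\<^sub>2 H\<^sub>1 (Z\<lparr>pts := {x \<in> pts Z. t x < Suc m}\<rparr>) =
      Add (burnside_cat G) H\<^sub>1 H\<^sub>2 (biset_mor G H\<^sub>2 H\<^sub>1 (Z\<lparr>pts := {x \<in> pts Z. t x = m}\<rparr>))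
        (biset_mor G H\<^sub>2 H\<^sub>1 (Z\<lparr>pts := {x \<in> pts Z. t x < m}\<rparr>))"
      using biset_mor_partition[OF H bif[of "\<lambda>i. i < Suc m"], of "{x \<in> pts Z. t x = m}"
          "{x \<in> pts Z. t x < m}"] bif[of "\<lambda>i. i = m"] bif[of "\<lambda>i. i < m"]
      by (auto simp: less_Suc_eq)
    then show ?case
      using bm[of "\<lambda>i. i = _"] by (simp add: lessThan_Suc Suc K.finprod_insert Pi_def)
        (simp add: hom_group_def)
  qed
  from this[of n] have "biset_mor G H\<^sub>2 H\<^sub>1 (Z\<lparr>pts := {x \<in> pts Z. t x < n}\<rparr>) =
    finprod (hom_group (burnside_cat G) H\<^sub>1 H\<^sub>2)
      (\<lambda>i. biset_mor G H\<^sub>2 H\<^sub>1 (Z\<lparr>pts := {x \<in> pts Z. t x = i}\<rparr>)) {..<n}" .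
  also have "Z\<lparr>pts := {x \<in> pts Z. t x < n}\<rparr> = Z"
    using t by (cases Z) auto
  finally show ?thesis .
qed

end

section \<open>Spans of G-sets as matrices of bisets\<close>

text \<open>Only the action laws on the carrier are kept, whereas \<open>group_action\<close> also
  forces each group element to act by an extensional map. This leaves the type of the apex of a span
  free and admits, for instance, the empty set with the action \<open>\<lambda>g x. x\<close>.
  Likewise \<open>gmap\<close> omits extensionality, so that \<open>\<lambda>x. x\<close> can serve
  as a leg.\<close>

definition fin_gset :: "'g monoid \<Rightarrow> ('g, 'x) gset \<Rightarrow> bool" where
  "fin_gset G X \<longleftrightarrow> finite (fst X) \<and>
     (\<forall>g \<in> carrier G. \<forall>x \<in> fst X. snd X g x \<in> fst X) \<and>
     (\<forall>x \<in> fst X. snd X \<one>\<^bsub>G\<^esub> x = x) \<and>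
     (\<forall>g \<in> carrier G. \<forall>h \<in> carrier G. \<forall>x \<in> fst X. snd X (g \<otimes>\<^bsub>G\<^esub> h) x = snd X g (snd X h x))"

definition gmap :: "'g monoid \<Rightarrow> ('g, 'x) gset \<Rightarrow> ('g, 'y) gset \<Rightarrow> ('x \<Rightarrow> 'y) \<Rightarrow> bool" where
  "gmap G X Y f \<longleftrightarrow> (\<forall>x \<in> fst X. f x \<in> fst Y) \<and>
     (\<forall>g \<in> carrier G. \<forall>x \<in> fst X. f (snd X g x) = snd Y g (f x))"

text \<open>
  Over the base points \<open>b\<close> and \<open>c\<close>, a span \<open>p : X \<rightarrow> S\<close>, \<open>q : X \<rightarrow> T\<close> gives the biset of all
  \<open>x \<in> X\<close> above \<open>b\<close> together with a group element moving \<open>q x\<close> to \<open>c\<close>. This involves no choice of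
  the elements \<open>g\<^sub>i\<close> relating images of base points to base points.
\<close>

definition span_biset ::
  "'g monoid \<Rightarrow> ('g, 't) gset \<Rightarrow> ('g, 'x) gset \<Rightarrow> ('x \<Rightarrow> 's) \<Rightarrow> ('x \<Rightarrow> 't) \<Rightarrow> 's \<Rightarrow> 't \<Rightarrow>
   ('g, 'x \<times> 'g) biset" where
  "span_biset G T X p q b c =
     \<lparr>pts = {(x, k). x \<in> fst X \<and> k \<in> carrier G \<and> p x = b \<and> snd T k (q x) = c},
      lact = (\<lambda>h (x, k). (x, h \<otimes>\<^bsub>G\<^esub> k)),
      ract = (\<lambda>(x, k) h. (snd X (inv\<^bsub>G\<^esub> h) x, k \<otimes>\<^bsub>G\<^esub> h))\<rparr>"

text \<open>A label for the orbit of an arbitrary point. It extends \<open>j_index\<close>, which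
  labels only the images of base points.\<close>

definition bp_index ::
  "'g monoid \<Rightarrow> (('g, 's) gset \<Rightarrow> 's list) \<Rightarrow> ('g, 's) gset \<Rightarrow> 's \<Rightarrow> nat" where
  "bp_index G bp T t = (THE a. a < length (bp T) \<and> (\<exists>g \<in> carrier G. t = snd T g (bp T ! a)))"

definition span_mat ::
  "'g monoid \<Rightarrow> (('g, 's) gset \<Rightarrow> 's list) \<Rightarrow> ('g, 's) gset \<Rightarrow> ('g, 's) gset \<Rightarrow> ('g, 'x) gset \<Rightarrow>
   ('x \<Rightarrow> 's) \<Rightarrow> ('x \<Rightarrow> 's) \<Rightarrow> nat \<times> nat \<Rightarrow> 'g vbiset" where
  "span_mat G bp S T X p q = (\<lambda>(a, i) \<in> {..<length (bp T)} \<times> {..<length (bp S)}.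
     biset_mor G (j_ob G bp T ! a) (j_ob G bp S ! i) (span_biset G T X p q (bp S ! i) (bp T ! a)))"

text \<open>The inverse is \<open>(b, c) \<mapsto> i b + j c\<close>: the four identities on
  \<open>B\<close> and \<open>C\<close> give one composite, the decomposition of \<open>a\<close>
  the other. Below, \<open>p\<close> and \<open>q\<close> are contravariant maps of embeddings,
  \<open>i\<close> and \<open>j\<close> the covariant ones.\<close>

lemma biproduct_iso:
  assumes "comm_group A" "comm_group B" "comm_group C"
    and p: "p \<in> hom A B" and q: "q \<in> hom A C" and i: "i \<in> hom B A" and j: "j \<in> hom C A"
    and pi: "\<And>b. b \<in> carrier B \<Longrightarrow> p (i b) = b" and qj: "\<And>c. c \<in> carrier C \<Longrightarrow> q (j c) = c"
    and pj: "\<And>c. c \<in> carrier C \<Longrightarrow> p (j c) = \<one>\<^bsub>B\<^esub>" and qi: "\<And>b. b \<in> carrier B \<Longrightarrow> q (i b) = \<one>\<^bsub>C\<^esub>"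
    and sum: "\<And>a. a \<in> carrier A \<Longrightarrow> i (p a) \<otimes>\<^bsub>A\<^esub> j (q a) = a"
  shows "(\<lambda>a. (p a, q a)) \<in> iso A (B \<times>\<times> C)"
proof -
  interpret A: comm_group A by fact
  interpret B: comm_group B by fact
  interpret C: comm_group C by fact
  note cl = hom_in_carrier[OF p] hom_in_carrier[OF q] hom_in_carrier[OF i] hom_in_carrier[OF j]
  have "(\<lambda>a. (p a, q a)) \<in> hom A (B \<times>\<times> C)"
    using cl by (auto simp: hom_def hom_mult[OF p] hom_mult[OF q])
  moreover have "bij_betw (\<lambda>a. (p a, q a)) (carrier A) (carrier (B \<times>\<times> C))"
  proof (rule bij_betw_byWitness[where f' = "\<lambda>(b, c). i b \<otimes>\<^bsub>A\<^esub> j c"])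
    show "\<forall>bc \<in> carrier (B \<times>\<times> C). (\<lambda>a. (p a, q a)) ((\<lambda>(b, c). i b \<otimes>\<^bsub>A\<^esub> j c) bc) = bc"
      using cl by (auto simp: hom_mult[OF p] hom_mult[OF q] pi qj pj qi)
  qed (use cl in \<open>auto simp: sum\<close>)
  ultimately show ?thesis by (simp add: iso_def)
qed

locale base_points = plain_group G for G :: "'g monoid" (structure) +
  fixes bp :: "('g, 's) gset \<Rightarrow> 's list"
  assumes fin: "finite (carrier G)" and bpc: "base_point_choice G bp"
begin

section \<open>Finite G-sets, base points and labels of orbits\<close>

lemma fin_gsetD:
  assumes "fin_gset G X"
  shows "finite (fst X)"
    and "\<And>g x. g \<in> carrier G \<Longrightarrow> x \<in> fst X \<Longrightarrow> snd X g x \<in> fst X"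
    and "\<And>x. x \<in> fst X \<Longrightarrow> snd X \<one> x = x"
    and "\<And>g h x. g \<in> carrier G \<Longrightarrow> h \<in> carrier G \<Longrightarrow> x \<in> fst X \<Longrightarrow>
      snd X (g \<otimes> h) x = snd X g (snd X h x)"
    and "\<And>g x. g \<in> carrier G \<Longrightarrow> x \<in> fst X \<Longrightarrow> snd X (inv g) (snd X g x) = x"
    and "\<And>g x. g \<in> carrier G \<Longrightarrow> x \<in> fst X \<Longrightarrow> snd X g (snd X (inv g) x) = x"
proof -
  note X = assms[unfolded fin_gset_def]
  show "finite (fst X)" "\<And>g x. g \<in> carrier G \<Longrightarrow> x \<in> fst X \<Longrightarrow> snd X g x \<in> fst X"
    and one: "\<And>x. x \<in> fst X \<Longrightarrow> snd X \<one> x = x"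
    and mult: "\<And>g h x. g \<in> carrier G \<Longrightarrow> h \<in> carrier G \<Longrightarrow> x \<in> fst X \<Longrightarrow>
      snd X (g \<otimes> h) x = snd X g (snd X h x)"
    using X by simp_all
  show "snd X (inv g) (snd X g x) = x" "snd X g (snd X (inv g) x) = x"
    if "g \<in> carrier G" "x \<in> fst X" for g x
    using that by (simp_all add: mult[symmetric] one)
qed

lemma gmapD:
  assumes "gmap G X Y f"
  shows "\<And>x. x \<in> fst X \<Longrightarrow> f x \<in> fst Y"
    and "\<And>g x. g \<in> carrier G \<Longrightarrow> x \<in> fst X \<Longrightarrow> f (snd X g x) = snd Y g (f x)"
  using assms by (simp_all add: gmap_def)

lemma fin_gset_Ob:
  assumes "S \<in> Ob (GSets G)"
  shows "fin_gset G S"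
proof -
  obtain E act where S: "S = (E, act)" "group_action G E act" "finite E"
    using assms by (auto simp: GSets_def)
  interpret group_action G E act by (rule S)
  have "act \<one> x = x" if "x \<in> E" for x
    using that id_eq_one by (metis restrict_apply')
  then show ?thesis
    unfolding fin_gset_def S(1) fst_conv snd_conv
    using S(3) element_image composition_rule by blast
qed

lemma gmap_Mor:
  assumes "\<phi> \<in> Mor (GSets G) S T"
  shows "gmap G S T \<phi>"
  using assms by (cases S; cases T) (auto simp: GSets_def gmap_def)

lemma gmap_ident: "gmap G X X (\<lambda>x. x)"
  by (simp add: gmap_def)

lemma stabilizer_iff: "h \<in> stabilizer G act b \<longleftrightarrow> h \<in> carrier G \<and> act h b = b"
  by (simp add: stabilizer_def)

lemma j_ob_nth: "i < length (bp S) \<Longrightarrow> j_ob G bp S ! i = stabilizer G (snd S) (bp S ! i)"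
  by (simp add: j_ob_def)

lemma length_j_ob: "length (j_ob G bp S) = length (bp S)"
  by (simp add: j_ob_def)

lemma bp_in:
  assumes "S \<in> Ob (GSets G)" "i < length (bp S)"
  shows "bp S ! i \<in> fst S"
proof -
  have "set (bp S) \<subseteq> fst S" using bpc assms(1) unfolding base_point_choice_def by blast
  then show ?thesis using nth_mem[OF assms(2)] by blast
qed

lemma subgroup_j_ob:
  assumes "S \<in> Ob (GSets G)" "i < length (bp S)"
  shows "subgroup (j_ob G bp S ! i) G"
proof -
  have "group_action G (fst S) (snd S)" using assms(1) by (auto simp: GSets_def)
  from group_action.stabilizer_subgroup[OF this bp_in[OF assms]] show ?thesis
    using assms by (simp add: j_ob_nth)
qed

text \<open>A choice of base points provides one in the orbit of \<open>t\<close>. Inverses turn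
  this around, so that \<open>t\<close> becomes a translate of the base point, as
  \<open>j_index\<close> requires.\<close>

lemma ex1_bp_index:
  assumes T: "T \<in> Ob (GSets G)" and t: "t \<in> fst T"
  shows "\<exists>!a. a < length (bp T) \<and> (\<exists>g \<in> carrier G. t = snd T g (bp T ! a))"
proof -
  note TD = fin_gsetD[OF fin_gset_Ob[OF T]]
  have "orbit G (snd T) t \<in> orbits G (fst T) (snd T)"
    using t by (auto simp: orbits_def)
  then have ex1: "\<exists>!a. a < length (bp T) \<and> bp T ! a \<in> orbit G (snd T) t"
    using bpc T unfolding base_point_choice_def by blast
  have eqv: "bp T ! a \<in> orbit G (snd T) t \<longleftrightarrow> (\<exists>g \<in> carrier G. t = snd T g (bp T ! a))"
    if a: "a < length (bp T)" for a
  proof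
    assume "bp T ! a \<in> orbit G (snd T) t"
    then obtain g where "g \<in> carrier G" "bp T ! a = snd T g t" by (auto simp: orbit_def)
    then show "\<exists>g \<in> carrier G. t = snd T g (bp T ! a)"
      using t by (intro bexI[of _ "inv g"]) (simp_all add: TD)
  next
    assume "\<exists>g \<in> carrier G. t = snd T g (bp T ! a)"
    then obtain g where g: "g \<in> carrier G" "t = snd T g (bp T ! a)" by blast
    then have "bp T ! a = snd T (inv g) t" using bp_in[OF T a] by (simp add: TD)
    then show "bp T ! a \<in> orbit G (snd T) t" using g(1) by (auto simp: orbit_def)
  qed
  have "a < length (bp T) \<and> bp T ! a \<in> orbit G (snd T) t \<longleftrightarrow>
      a < length (bp T) \<and> (\<exists>g \<in> carrier G. t = snd T g (bp T ! a))" for a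
    by (rule conj_cong[OF refl eqv])
  with ex1 show ?thesis by (simp only:)
qed

lemma bp_index_props:
  assumes "T \<in> Ob (GSets G)" "t \<in> fst T"
  shows "bp_index G bp T t < length (bp T)"
    and "\<exists>g \<in> carrier G. t = snd T g (bp T ! bp_index G bp T t)"
  using theI'[OF ex1_bp_index[OF assms]] by (simp_all add: bp_index_def)

lemma bp_index_eqI:
  assumes "T \<in> Ob (GSets G)" "t \<in> fst T" "a < length (bp T)" "g \<in> carrier G" "t = snd T g (bp T ! a)"
  shows "bp_index G bp T t = a"
  unfolding bp_index_def
  by (rule the1_equality[OF ex1_bp_index[OF assms(1,2)]]) (use assms(3-5) in blast)

text \<open>Constancy on orbits lets the label cut a biset into pieces stable under the right
  action, which translates points.\<close>

lemma bp_index_translate: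
  assumes T: "T \<in> Ob (GSets G)" and t: "t \<in> fst T" and h: "h \<in> carrier G"
  shows "bp_index G bp T (snd T h t) = bp_index G bp T t"
proof -
  note TD = fin_gsetD[OF fin_gset_Ob[OF T]]
  obtain g where g: "g \<in> carrier G" "t = snd T g (bp T ! bp_index G bp T t)"
    using bp_index_props(2)[OF T t] by blast
  have "snd T h t = snd T (h \<otimes> g) (bp T ! bp_index G bp T t)"
    using g h bp_in[OF T bp_index_props(1)[OF T t]] by (simp add: TD)
  then show ?thesis
    using g(1) h by (intro bp_index_eqI[OF T TD(2)[OF h t] bp_index_props(1)[OF T t]]) simp_all
qed

section \<open>The matrix of a span\<close>

text \<open>Freeness on both sides is visible in the second coordinate, which the acting element
  multiplies. The right action moves \<open>x\<close> by an inverse; it stays above \<open>b\<close>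
  because the inverse of an element fixing \<open>b\<close> fixes \<open>b\<close> too.\<close>

lemma bifree_span_biset:
  assumes T: "T \<in> Ob (GSets G)" and S: "S \<in> Ob (GSets G)" and X: "fin_gset G X"
    and p: "gmap G X S p" and q: "gmap G X T q"
    and i: "i < length (bp S)" and a: "a < length (bp T)"
  shows "bifree_biset G (j_ob G bp T ! a) (j_ob G bp S ! i) (span_biset G T X p q (bp S ! i) (bp T ! a))"
proof -
  note TD = fin_gsetD[OF fin_gset_Ob[OF T]] and SD = fin_gsetD[OF fin_gset_Ob[OF S]]
    and XD = fin_gsetD[OF X] and pD = gmapD[OF p] and qD = gmapD[OF q]
  note simps = span_biset_def j_ob_nth[OF i] j_ob_nth[OF a] stabilizer_iff
  let ?b = "bp S ! i" and ?Z = "span_biset G T X p q (bp S ! i) (bp T ! a)"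
  have b: "?b \<in> fst S" by (rule bp_in[OF S i])
  have inv_b: "snd S (inv h) ?b = ?b" if "h \<in> carrier G" "snd S h ?b = ?b" for h
    using that SD(5)[OF that(1) b] by simp
  have "pts ?Z \<subseteq> fst X \<times> carrier G" by (auto simp: span_biset_def)
  then have "finite (pts ?Z)" using XD(1) fin by (rule finite_subset[OF _ finite_cartesian_product])
  moreover have "is_biset G (j_ob G bp T ! a) (j_ob G bp S ! i) ?Z"
    unfolding is_biset_def
    by (auto simp: simps XD TD pD qD inv_b m_assoc inv_mult_group)
  moreover have "h = \<one>" if "h \<in> j_ob G bp T ! a" "xk \<in> pts ?Z" "lact ?Z h xk = xk" for h xk
    using that by (cases xk) (simp add: simps)
  moreover have "h = \<one>" if "h \<in> j_ob G bp S ! i" "xk \<in> pts ?Z" "ract ?Z xk h = xk" for h xk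
    using that by (cases xk) (simp add: simps)
  ultimately show ?thesis
    unfolding bifree_biset_def by blast
qed

lemma A_bullet_simps:
  shows "Ob (A_bullet G) = lists {H. subgroup H G}"
    and "Mor (A_bullet G) Xs Ys =
      (\<Pi>\<^sub>E (a, b) \<in> {..<length Ys} \<times> {..<length Xs}. Mor (burnside_cat G) (Xs ! b) (Ys ! a))"
    and "Comp (A_bullet G) Xs Ys Zs g f = (\<lambda>(a, c) \<in> {..<length Zs} \<times> {..<length Xs}.
        finprod (hom_group (burnside_cat G) (Xs ! c) (Zs ! a))
          (\<lambda>b. Comp (burnside_cat G) (Xs ! c) (Ys ! b) (Zs ! a) (g (a, b)) (f (b, c))) {..<length Ys})"
    and "Ident (A_bullet G) Xs = (\<lambda>(a, b) \<in> {..<length Xs} \<times> {..<length Xs}.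
        if a = b then Ident (burnside_cat G) (Xs ! a) else Zero (burnside_cat G) (Xs ! b) (Xs ! a))"
    and "Add (A_bullet G) Xs Ys f g = (\<lambda>(a, b) \<in> {..<length Ys} \<times> {..<length Xs}.
        Add (burnside_cat G) (Xs ! b) (Ys ! a) (f (a, b)) (g (a, b)))"
    and "Zero (A_bullet G) Xs Ys = (\<lambda>(a, b) \<in> {..<length Ys} \<times> {..<length Xs}.
        Zero (burnside_cat G) (Xs ! b) (Ys ! a))"
  by (simp_all add: additive_completion_def) (simp add: burnside_cat_def)

lemma j_ob_Ob:
  assumes "S \<in> Ob (GSets G)"
  shows "j_ob G bp S \<in> Ob (A_bullet G)"
proof -
  have "subgroup H G" if "H \<in> set (j_ob G bp S)" for H
    using that subgroup_j_ob[OF assms] by (metis in_set_conv_nth length_j_ob)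
  then show ?thesis by (simp add: A_bullet_simps(1) in_lists_conv_set)
qed

lemma span_mat_in:
  assumes "S \<in> Ob (GSets G)" "T \<in> Ob (GSets G)" "fin_gset G X" "gmap G X S p" "gmap G X T q"
  shows "span_mat G bp S T X p q \<in> Mor (A_bullet G) (j_ob G bp S) (j_ob G bp T)"
proof -
  have "biset_mor G (j_ob G bp T ! a) (j_ob G bp S ! i) (span_biset G T X p q (bp S ! i) (bp T ! a))
      \<in> Mor (burnside_cat G) (j_ob G bp S ! i) (j_ob G bp T ! a)"
    if "a < length (bp T)" "i < length (bp S)" for a i
    using that assms by (intro biset_mor_in(1) bifree_span_biset subgroup_j_ob)
  then show ?thesis
    unfolding A_bullet_simps(2) span_mat_def length_j_ob by (simp add: PiE_iff split_beta)
qed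

lemma span_mat_eqI:
  assumes "M \<in> extensional ({..<length (bp T)} \<times> {..<length (bp S)})"
    and "\<And>a i. a < length (bp T) \<Longrightarrow> i < length (bp S) \<Longrightarrow>
      M (a, i) = biset_mor G (j_ob G bp T ! a) (j_ob G bp S ! i) (span_biset G T X p q (bp S ! i) (bp T ! a))"
  shows "M = span_mat G bp S T X p q"
proof (rule extensionalityI[OF assms(1)])
  show "span_mat G bp S T X p q \<in> extensional ({..<length (bp T)} \<times> {..<length (bp S)})"
    by (simp add: span_mat_def)
  fix ai assume "ai \<in> {..<length (bp T)} \<times> {..<length (bp S)}"
  then show "M ai = span_mat G bp S T X p q ai"
    by (cases ai) (simp add: span_mat_def assms(2))
qed

text \<open>
  A point of the composite at \<open>(z, m)\<close> is a pair \<open>((y, l), (x, k))\<close> with \<open>m = l k\<close> and with \<open>z\<close> lying above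
  \<open>x\<close> and \<open>k\<^sup>-\<^sup>1 y\<close>; the base point of \<open>T\<close> through which it passes is that of the orbit of \<open>q x\<close>.
\<close>

lemma balanced_product_span:
  assumes S: "S \<in> Ob (GSets G)" and T: "T \<in> Ob (GSets G)" and U: "U \<in> Ob (GSets G)"
    and X: "fin_gset G X" and p: "gmap G X S p" and q: "gmap G X T q"
    and Y: "fin_gset G Y" and p': "gmap G Y T p'" and q': "gmap G Y U q'"
    and Z: "fin_gset G Z" and u: "gmap G Z X u" and v: "gmap G Z Y v"
    and bij: "bij_betw (\<lambda>z. (u z, v z)) (fst Z) {(x, y) \<in> fst X \<times> fst Y. q x = p' y}"
    and i: "i < length (bp S)" and a: "a < length (bp T)" and d: "d < length (bp U)"
    and P: "\<And>z. z \<in> fst Z \<Longrightarrow> P z = p (u z)" and Q: "\<And>z. z \<in> fst Z \<Longrightarrow> Q z = q' (v z)"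
  defines "E \<equiv> span_biset G U Z P Q (bp S ! i) (bp U ! d)"
  shows "biset_iso (j_ob G bp U ! d) (j_ob G bp S ! i)
    (balanced_product (j_ob G bp T ! a)
      (span_biset G U Y p' q' (bp T ! a) (bp U ! d)) (span_biset G T X p q (bp S ! i) (bp T ! a)))
    (E\<lparr>pts := {(z, m) \<in> pts E. bp_index G bp T (q (u z)) = a}\<rparr>)"
proof -
  note TD = fin_gsetD[OF fin_gset_Ob[OF T]] and SD = fin_gsetD[OF fin_gset_Ob[OF S]]
    and UD = fin_gsetD[OF fin_gset_Ob[OF U]]
    and XD = fin_gsetD[OF X] and YD = fin_gsetD[OF Y] and ZD = fin_gsetD[OF Z]
    and pD = gmapD[OF p] and qD = gmapD[OF q] and p'D = gmapD[OF p'] and q'D = gmapD[OF q']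
    and uD = gmapD[OF u] and vD = gmapD[OF v]
  note st = j_ob_nth[OF i] j_ob_nth[OF a] j_ob_nth[OF d] stabilizer_iff
  let ?b = "bp S ! i" and ?c = "bp T ! a" and ?d = "bp U ! d"
  let ?Y = "span_biset G U Y p' q' ?c ?d" and ?X = "span_biset G T X p q ?b ?c"
  have c: "?c \<in> fst T" by (rule bp_in[OF T a])
  \<comment> \<open>The inverse of the comparison map: it selects the point of \<open>Z\<close> over
    a compatible pair.\<close>
  define w where "w = (\<lambda>x y. inv_into (fst Z) (\<lambda>z. (u z, v z)) (x, y))"
  have w: "w x y \<in> fst Z" "u (w x y) = x" "v (w x y) = y"
    if "x \<in> fst X" "y \<in> fst Y" "q x = p' y" for x y
  proof -
    have xy: "(x, y) \<in> (\<lambda>z. (u z, v z)) ` fst Z" using bij that by (auto simp: bij_betw_def)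
    show "w x y \<in> fst Z" using inv_into_into[OF xy] by (simp add: w_def)
    show "u (w x y) = x" "v (w x y) = y" using f_inv_into_f[OF xy] by (simp_all add: w_def)
  qed
  have wI: "w x y = z" if "z \<in> fst Z" "u z = x" "v z = y" for x y z
    unfolding w_def using bij that by (intro inv_into_f_eq) (auto simp: bij_betw_def)
  have uv: "q (u z) = p' (v z)" if "z \<in> fst Z" for z
    using bij that by (fastforce simp: bij_betw_def)
  \<comment> \<open>Since \<open>k\<close> takes \<open>q x\<close> to \<open>?c = p' y\<close>, the
    points \<open>x\<close> and \<open>inv k\<close> applied to \<open>y\<close> have the same image
    in \<open>T\<close>. This is what makes the pair a point of the fibre product.\<close>
  have cross: "q x = p' (snd Y (inv k) y)"
    if "x \<in> fst X" "k \<in> carrier G" "snd T k (q x) = ?c" "y \<in> fst Y" "p' y = ?c" for x y k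
    using that TD(5)[OF that(2), of "q x"] by (simp add: p'D qD)
  define f where "f = (\<lambda>(y, l) (x, k). (w x (snd Y (inv k) y), l \<otimes> k))"
  note H = subgroup_j_ob[OF T a]
  note bX = bifree_span_biset[OF T S X p q i a] and bY = bifree_span_biset[OF U T Y p' q' a d]
  show ?thesis
  proof (rule balanced_product_isoI[OF H bY bX, where f = f])
    show "(\<lambda>(yl, xk). f yl xk) ` (pts ?Y \<times> pts ?X) =
        pts (E\<lparr>pts := {(z, m) \<in> pts E. bp_index G bp T (q (u z)) = a}\<rparr>)" (is "?L = ?R")
    proof
      show "?L \<subseteq> ?R"
      proof (rule image_subsetI)
        fix s assume s: "s \<in> pts ?Y \<times> pts ?X"
        obtain y l x k where s': "s = ((y, l), (x, k))" by (metis surj_pair)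
        from s have yl: "y \<in> fst Y" "l \<in> carrier G" "p' y = ?c" "snd U l (q' y) = ?d"
          and xk: "x \<in> fst X" "k \<in> carrier G" "p x = ?b" "snd T k (q x) = ?c"
          by (simp_all add: s' span_biset_def)
        note wz = w[OF xk(1) YD(2)[OF inv_closed[OF xk(2)] yl(1)] cross[OF xk(1,2,4) yl(1,3)]]
        have "q x = snd T (inv k) ?c" using TD(5)[OF xk(2), of "q x"] xk by (simp add: qD)
        then have "bp_index G bp T (q x) = a"
          using xk(2) a by (intro bp_index_eqI[OF T qD(1)[OF xk(1)], of _ "inv k"]) simp_all
        then show "(case s of (yl, xk) \<Rightarrow> f yl xk) \<in> ?R"
          using wz yl xk by (simp add: s' f_def E_def span_biset_def P Q q'D UD)
      qed
      show "?R \<subseteq> ?L"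
      proof (rule subrelI)
        fix z m assume zm: "(z, m) \<in> ?R"
        then have z: "z \<in> fst Z" "m \<in> carrier G" "p (u z) = ?b" "snd U m (q' (v z)) = ?d"
          and ix: "bp_index G bp T (q (u z)) = a"
          by (auto simp: E_def span_biset_def P Q)
        \<comment> \<open>Any \<open>g\<close> taking the base point to \<open>q (u z)\<close>
          splits \<open>(z, m)\<close>: \<open>inv g\<close> is the group element over
          \<open>u z\<close>, and \<open>m \<otimes> g\<close> the one over the correspondingly
          translated \<open>v z\<close>.\<close>
        obtain g where g: "g \<in> carrier G" "q (u z) = snd T g ?c"
          using bp_index_props(2)[OF T, of "q (u z)"] z(1) ix by (auto simp: uD qD)
        have "(u z, inv g) \<in> pts ?X"
          using z g c by (simp add: span_biset_def uD TD)
        moreover have "(snd Y (inv g) (v z), m \<otimes> g) \<in> pts ?Y"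
          using z g c uv[OF z(1)] by (simp add: span_biset_def vD YD TD p'D q'D UD)
        moreover have "f (snd Y (inv g) (v z), m \<otimes> g) (u z, inv g) = (z, m)"
          using z g by (simp add: f_def vD YD wI m_assoc)
        ultimately show "(z, m) \<in> ?L" by force
      qed
    qed
  next
    fix yl xk yl' xk'
    assume "yl \<in> pts ?Y" "xk \<in> pts ?X" "yl' \<in> pts ?Y" "xk' \<in> pts ?X"
    then obtain y l x k y' l' x' k' where yl: "yl = (y, l)" "y \<in> fst Y" "l \<in> carrier G" "p' y = ?c" "snd U l (q' y) = ?d"
      and xk: "xk = (x, k)" "x \<in> fst X" "k \<in> carrier G" "p x = ?b" "snd T k (q x) = ?c"
      and yl': "yl' = (y', l')" "y' \<in> fst Y" "l' \<in> carrier G" "p' y' = ?c" "snd U l' (q' y') = ?d"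
      and xk': "xk' = (x', k')" "x' \<in> fst X" "k' \<in> carrier G" "p x' = ?b" "snd T k' (q x') = ?c"
      by (auto simp: span_biset_def)
    note wz = w[OF xk(2) YD(2)[OF inv_closed[OF xk(3)] yl(2)] cross[OF xk(2,3,5) yl(2,4)]]
    note wz' = w[OF xk'(2) YD(2)[OF inv_closed[OF xk'(3)] yl'(2)] cross[OF xk'(2,3,5) yl'(2,4)]]
    show "f yl xk = f yl' xk' \<longleftrightarrow> (\<exists>h \<in> j_ob G bp T ! a. yl' = ract ?Y yl h \<and> xk = lact ?X h xk')"
    proof
      assume "f yl xk = f yl' xk'"
      then have eq: "w x (snd Y (inv k) y) = w x' (snd Y (inv k') y')" "l \<otimes> k = l' \<otimes> k'"
        by (simp_all add: f_def yl(1) xk(1) yl'(1) xk'(1))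
      have x: "x = x'" using wz(2) wz'(2) eq(1) by simp
      have y: "snd Y (inv k) y = snd Y (inv k') y'" using wz(3) wz'(3) eq(1) by simp
      \<comment> \<open>The equation \<open>k = h \<otimes> k'\<close> leaves no other candidate. It
        fixes \<open>?c\<close> because \<open>k\<close> and \<open>k'\<close> both take
        \<open>q x\<close> to \<open>?c\<close>.\<close>
      let ?h = "k \<otimes> inv k'"
      have "snd T (inv k') ?c = q x" using TD(5)[OF xk'(3), of "q x"] xk' x by (simp add: qD)
      then have "?h \<in> j_ob G bp T ! a" using xk xk'(3) c by (simp add: st TD)
      moreover have "k = ?h \<otimes> k'" using xk(3) xk'(3) by (simp add: m_assoc)
      moreover have "l' = l \<otimes> ?h"
        using eq(2) xk(3) xk'(3) yl(3) yl'(3) by (metis inv_closed inv_solve_right m_assoc m_closed)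
      moreover have "y' = snd Y (inv ?h) y"
        using y xk(3) xk'(3) yl(2) yl'(2) by (simp add: inv_mult_group YD)
      ultimately show "\<exists>h \<in> j_ob G bp T ! a. yl' = ract ?Y yl h \<and> xk = lact ?X h xk'"
        by (intro bexI[of _ ?h]) (simp_all add: yl(1) xk(1) yl'(1) xk'(1) span_biset_def x)
    next
      assume "\<exists>h \<in> j_ob G bp T ! a. yl' = ract ?Y yl h \<and> xk = lact ?X h xk'"
      then obtain h where h: "h \<in> carrier G" and e: "y' = snd Y (inv h) y" "l' = l \<otimes> h" "x = x'" "k = h \<otimes> k'"
        by (auto simp: st yl(1) xk(1) yl'(1) xk'(1) span_biset_def)
      show "f yl xk = f yl' xk'"
        using h yl xk'(2,3) by (simp add: f_def yl(1) xk(1) yl'(1) xk'(1) e inv_mult_group YD m_assoc)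
    qed
  next
    fix h yl xk assume "h \<in> j_ob G bp U ! d" "yl \<in> pts ?Y" "xk \<in> pts ?X"
    then show "f (lact ?Y h yl) xk = lact (E\<lparr>pts := {(z, m) \<in> pts E. bp_index G bp T (q (u z)) = a}\<rparr>) h (f yl xk)"
      by (auto simp: st E_def span_biset_def f_def m_assoc)
  next
    fix h yl xk assume "h \<in> j_ob G bp S ! i" "yl \<in> pts ?Y" "xk \<in> pts ?X"
    then obtain y l x k where h: "h \<in> carrier G"
      and yl: "yl = (y, l)" "y \<in> fst Y" "l \<in> carrier G" "p' y = ?c"
      and xk: "xk = (x, k)" "x \<in> fst X" "k \<in> carrier G" "snd T k (q x) = ?c"
      by (auto simp: st span_biset_def)
    note wz = w[OF xk(2) YD(2)[OF inv_closed[OF xk(3)] yl(2)] cross[OF xk(2,3,4) yl(2,4)]]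
    have "w (snd X (inv h) x) (snd Y (inv (k \<otimes> h)) y) = snd Z (inv h) (w x (snd Y (inv k) y))"
      using wz h yl(2) xk(3) by (intro wI) (simp_all add: ZD uD vD inv_mult_group YD)
    then show "f yl (ract ?X xk h) =
        ract (E\<lparr>pts := {(z, m) \<in> pts E. bp_index G bp T (q (u z)) = a}\<rparr>) (f yl xk) h"
      using h yl xk by (simp add: E_def span_biset_def f_def m_assoc)
  qed
qed

section \<open>Composites, identities and sums of span matrices\<close>

lemma gmap_comp:
  assumes "gmap G X Y f" "gmap G Y Z g" "\<And>x. x \<in> fst X \<Longrightarrow> h x = g (f x)" "fin_gset G X"
  shows "gmap G X Z h"
  using assms fin_gsetD(2)[OF assms(4)] by (simp add: gmap_def)

text \<open>\<open>Z\<close> may be any apex in bijection with the fibre product, and its legs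
  \<open>P\<close>, \<open>Q\<close> are prescribed only on its points. Hence abstract pullback
  squares and composites restricted to a carrier can be inserted directly.\<close>

lemma Comp_span_mat:
  assumes S: "S \<in> Ob (GSets G)" and T: "T \<in> Ob (GSets G)" and U: "U \<in> Ob (GSets G)"
    and X: "fin_gset G X" and p: "gmap G X S p" and q: "gmap G X T q"
    and Y: "fin_gset G Y" and p': "gmap G Y T p'" and q': "gmap G Y U q'"
    and Z: "fin_gset G Z" and u: "gmap G Z X u" and v: "gmap G Z Y v"
    and bij: "bij_betw (\<lambda>z. (u z, v z)) (fst Z) {(x, y) \<in> fst X \<times> fst Y. q x = p' y}"
    and P: "\<And>z. z \<in> fst Z \<Longrightarrow> P z = p (u z)" and Q: "\<And>z. z \<in> fst Z \<Longrightarrow> Q z = q' (v z)"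
  shows "Comp (A_bullet G) (j_ob G bp S) (j_ob G bp T) (j_ob G bp U)
    (span_mat G bp T U Y p' q') (span_mat G bp S T X p q) = span_mat G bp S U Z P Q"
proof (rule span_mat_eqI)
  show "Comp (A_bullet G) (j_ob G bp S) (j_ob G bp T) (j_ob G bp U)
      (span_mat G bp T U Y p' q') (span_mat G bp S T X p q)
    \<in> extensional ({..<length (bp U)} \<times> {..<length (bp S)})"
    by (simp add: A_bullet_simps(3) length_j_ob)
  fix d i assume d: "d < length (bp U)" and i: "i < length (bp S)"
  let ?Hd = "j_ob G bp U ! d" and ?Hi = "j_ob G bp S ! i"
  let ?E = "span_biset G U Z P Q (bp S ! i) (bp U ! d)"
  \<comment> \<open>The label of the orbit in \<open>T\<close> through which a point passes. The
    left action does not touch \<open>z\<close>, and the right action translates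
    \<open>q (u z)\<close> within its orbit, so the label is invariant.\<close>
  let ?t = "\<lambda>(z, m). bp_index G bp T (q (u z))"
  let ?Y = "\<lambda>a. span_biset G U Y p' q' (bp T ! a) (bp U ! d)"
  let ?X = "\<lambda>a. span_biset G T X p q (bp S ! i) (bp T ! a)"
  have sub: "subgroup ?Hd G" "subgroup ?Hi G"
    using subgroup_j_ob[OF U d] subgroup_j_ob[OF S i] .
  interpret K: comm_group "hom_group (burnside_cat G) ?Hi ?Hd" by (rule comm_group_hom_group[OF sub])
  note ZD = fin_gsetD[OF Z] and uD = gmapD[OF u] and qD = gmapD[OF q]
  have E: "bifree_biset G ?Hd ?Hi ?E"
    by (rule bifree_span_biset[OF U S Z gmap_comp[OF u p P Z] gmap_comp[OF v q' Q Z] i d])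
  have l: "?t (lact ?E h zm) = ?t zm" if "h \<in> ?Hd" "zm \<in> pts ?E" for h zm
    by (cases zm) (simp add: span_biset_def)
  have r: "?t (ract ?E zm h) = ?t zm" if "h \<in> ?Hi" "zm \<in> pts ?E" for h zm
    using that by (cases zm) (simp add: span_biset_def j_ob_nth[OF i] stabilizer_iff uD qD
        bp_index_translate[OF T])
  have t: "?t zm < length (bp T)" if "zm \<in> pts ?E" for zm
    using that by (cases zm) (simp add: span_biset_def bp_index_props(1)[OF T] uD qD)
  have comp: "Comp (burnside_cat G) ?Hi (j_ob G bp T ! a) ?Hd
        (span_mat G bp T U Y p' q' (d, a)) (span_mat G bp S T X p q (a, i)) =
      biset_mor G ?Hd ?Hi (?E\<lparr>pts := {zm \<in> pts ?E. ?t zm = a}\<rparr>)"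
    if a: "a < length (bp T)" for a
  proof -
    note bX = bifree_span_biset[OF T S X p q i a] and bY = bifree_span_biset[OF U T Y p' q' a d]
    note sT = subgroup_j_ob[OF T a]
    have "{(z, m) \<in> pts ?E. bp_index G bp T (q (u z)) = a} = {zm \<in> pts ?E. ?t zm = a}"
      by auto
    with balanced_product_span[OF S T U X p q Y p' q' Z u v bij i a d P Q]
    have "biset_iso ?Hd ?Hi (balanced_product (j_ob G bp T ! a) (?Y a) (?X a))
        (?E\<lparr>pts := {zm \<in> pts ?E. ?t zm = a}\<rparr>)" by simp
    from biset_mor_eqI[OF sub bifree_balanced_product[OF sT bY bX sub] this]
    show ?thesis using a d i by (simp add: span_mat_def Comp_biset_mor[OF sub(1) sT sub(2) bY bX])
  qed
  have "biset_mor G ?Hd ?Hi (?E\<lparr>pts := {zm \<in> pts ?E. ?t zm = a}\<rparr>)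
      \<in> carrier (hom_group (burnside_cat G) ?Hi ?Hd)" for a
    by (rule biset_mor_in(2)[OF bifree_biset_subset[OF E] sub])
      (use bifree_bisetD[OF E] l r in auto)
  then have "finprod (hom_group (burnside_cat G) ?Hi ?Hd)
      (\<lambda>a. Comp (burnside_cat G) ?Hi (j_ob G bp T ! a) ?Hd
        (span_mat G bp T U Y p' q' (d, a)) (span_mat G bp S T X p q (a, i))) {..<length (bp T)} =
    finprod (hom_group (burnside_cat G) ?Hi ?Hd)
      (\<lambda>a. biset_mor G ?Hd ?Hi (?E\<lparr>pts := {zm \<in> pts ?E. ?t zm = a}\<rparr>)) {..<length (bp T)}"
    using comp by (intro K.finprod_cong') auto
  also have "\<dots> = biset_mor G ?Hd ?Hi ?E"
    by (rule biset_mor_finprod[OF sub E l r t, symmetric])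
  finally show "Comp (A_bullet G) (j_ob G bp S) (j_ob G bp T) (j_ob G bp U)
      (span_mat G bp T U Y p' q') (span_mat G bp S T X p q) (d, i) = biset_mor G ?Hd ?Hi ?E"
    using d i by (simp add: A_bullet_simps(3) length_j_ob)
qed

text \<open>Points of an entry are group elements moving one base point to another. On the diagonal
  these form the stabilizer; elsewhere there are none, as distinct base points lie in distinct
  orbits.\<close>

lemma span_mat_ident:
  assumes S: "S \<in> Ob (GSets G)"
  shows "span_mat G bp S S S (\<lambda>x. x) (\<lambda>x. x) = Ident (A_bullet G) (j_ob G bp S)"
proof (rule span_mat_eqI[symmetric])
  note SD = fin_gsetD[OF fin_gset_Ob[OF S]]
  fix a i assume a: "a < length (bp S)" and i: "i < length (bp S)"
  let ?E = "span_biset G S S (\<lambda>x. x) (\<lambda>x. x) (bp S ! i) (bp S ! a)"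
  have b: "bp S ! i \<in> fst S" by (rule bp_in[OF S i])
  show "Ident (A_bullet G) (j_ob G bp S) (a, i) = biset_mor G (j_ob G bp S ! a) (j_ob G bp S ! i) ?E"
  proof (cases "a = i")
    case True
    have "bij_betw snd (pts ?E) (j_ob G bp S ! a)"
      by (rule bij_betw_byWitness[where f' = "\<lambda>h. (bp S ! i, h)"])
        (use b True in \<open>auto simp: span_biset_def j_ob_nth[OF i] stabilizer_iff\<close>)
    then have "biset_iso (j_ob G bp S ! a) (j_ob G bp S ! i) ?E
        \<lparr>pts = j_ob G bp S ! a, lact = mult G, ract = mult G\<rparr>"
      unfolding biset_iso_def by (intro exI[of _ snd]) (auto simp: span_biset_def)
    from biset_mor_eqI[OF subgroup_j_ob[OF S a] subgroup_j_ob[OF S i]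
        bifree_span_biset[OF S S fin_gset_Ob[OF S] gmap_ident gmap_ident i a] this]
    show ?thesis using True a i
      by (simp add: A_bullet_simps(4) length_j_ob) (simp add: burnside_cat_def)
  next
    case False
    have "pts ?E = {}"
    proof (rule ccontr)
      assume "pts ?E \<noteq> {}"
      then obtain k where k: "k \<in> carrier G" "snd S k (bp S ! i) = bp S ! a"
        by (auto simp: span_biset_def)
      then have "bp_index G bp S (bp S ! a) = i"
        using i by (intro bp_index_eqI[OF S bp_in[OF S a] _ k(1)]) simp_all
      moreover have "bp_index G bp S (bp S ! a) = a"
        using a by (intro bp_index_eqI[OF S bp_in[OF S a] a, of \<one>]) (simp_all add: SD bp_in[OF S])
      ultimately show False using False by simp
    qed
    from biset_mor_empty[OF subgroup_j_ob[OF S a] subgroup_j_ob[OF S i] this] show ?thesis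
      using False a i by (simp add: A_bullet_simps(4) length_j_ob)
  qed
qed (simp add: A_bullet_simps(4) length_j_ob)

text \<open>Besides decomposing the identity of a disjoint union, this is applied with all three
  apexes empty, where it says that the matrix equals its own double.\<close>

lemma span_mat_sum:
  assumes S: "S \<in> Ob (GSets G)" and T: "T \<in> Ob (GSets G)"
    and Z: "fin_gset G Z" and P: "gmap G Z S P" and Q: "gmap G Z T Q"
    and X: "fin_gset G X" and Y: "fin_gset G Y"
    and u: "gmap G X Z u" "inj_on u (fst X)" and v: "gmap G Y Z v" "inj_on v (fst Y)"
    and uv: "u ` fst X \<inter> v ` fst Y = {}" "u ` fst X \<union> v ` fst Y = fst Z"
  shows "Add (A_bullet G) (j_ob G bp S) (j_ob G bp T)
      (span_mat G bp S T X (\<lambda>x. P (u x)) (\<lambda>x. Q (u x)))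
      (span_mat G bp S T Y (\<lambda>y. P (v y)) (\<lambda>y. Q (v y))) = span_mat G bp S T Z P Q"
proof (rule span_mat_eqI)
  note uD = gmapD[OF u(1)] and vD = gmapD[OF v(1)]
  fix a i assume a: "a < length (bp T)" and i: "i < length (bp S)"
  let ?H = "j_ob G bp T ! a" and ?K = "j_ob G bp S ! i"
  let ?X = "span_biset G T X (\<lambda>x. P (u x)) (\<lambda>x. Q (u x)) (bp S ! i) (bp T ! a)"
  let ?Y = "span_biset G T Y (\<lambda>x. P (v x)) (\<lambda>x. Q (v x)) (bp S ! i) (bp T ! a)"
  let ?Z = "span_biset G T Z P Q (bp S ! i) (bp T ! a)"
  have sub: "subgroup ?H G" "subgroup ?K G"
    using subgroup_j_ob[OF T a] subgroup_j_ob[OF S i] .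
  have bX: "bifree_biset G ?H ?K ?X"
    by (intro bifree_span_biset T S X gmap_comp[OF u(1) P] gmap_comp[OF u(1) Q] i a refl)
  have bY: "bifree_biset G ?H ?K ?Y"
    by (intro bifree_span_biset T S Y gmap_comp[OF v(1) P] gmap_comp[OF v(1) Q] i a refl)
  define f where "f = case_sum (\<lambda>(x, k). (u x, k :: 'g)) (\<lambda>(y, k). (v y, k))"
  have "bij_betw f (pts ?X <+> pts ?Y) (pts ?Z)"
    unfolding bij_betw_def
  proof
    have "u x \<noteq> v y" "v y \<noteq> u x" if "x \<in> fst X" "y \<in> fst Y" for x y using uv(1) that by blast+
    then show "inj_on f (pts ?X <+> pts ?Y)"
      by (intro inj_onI)
        (auto simp: f_def span_biset_def dest: inj_onD[OF u(2)] inj_onD[OF v(2)] not_sym)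
    have "pts ?Z = {(z, k). (z \<in> u ` fst X \<or> z \<in> v ` fst Y) \<and> k \<in> carrier G \<and> P z = bp S ! i \<and>
        snd T k (Q z) = bp T ! a}"
      unfolding uv(2)[symmetric] span_biset_def by auto
    also have "\<dots> = f ` (pts ?X <+> pts ?Y)"
      by (force simp: f_def span_biset_def Plus_def image_Un image_image)
    finally show "f ` (pts ?X <+> pts ?Y) = pts ?Z" ..
  qed
  then have "biset_iso ?H ?K (biset_sum ?X ?Y) ?Z"
    unfolding biset_iso_def
    by (intro exI[of _ f])
      (auto simp: f_def biset_sum_def span_biset_def j_ob_nth[OF i] stabilizer_iff uD vD)
  from biset_mor_eqI[OF sub bifree_biset_sum[OF bX bY] this]
  show "Add (A_bullet G) (j_ob G bp S) (j_ob G bp T)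
      (span_mat G bp S T X (\<lambda>x. P (u x)) (\<lambda>x. Q (u x)))
      (span_mat G bp S T Y (\<lambda>y. P (v y)) (\<lambda>y. Q (v y))) (a, i) = biset_mor G ?H ?K ?Z"
    using a i by (simp add: A_bullet_simps(5) length_j_ob span_mat_def biset_mor_sum[OF sub bX bY])
qed (simp add: A_bullet_simps(5) length_j_ob)

subsection \<open>The bivariant functor j in terms of spans\<close>

lemma j_index_eq: "j_index G bp S T \<phi> i = bp_index G bp T (\<phi> (bp S ! i))"
  by (simp add: j_index_def bp_index_def)

text \<open>The first leg forces \<open>x = b\<close>, and \<open>k\<close> takes
  \<open>\<phi> b = g c\<close> to \<open>c\<close>, so \<open>k \<otimes> g\<close> lies in the
  stabilizer of \<open>c\<close>. Right multiplication by \<open>g\<close> thus matches the span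
  biset with the biset built from the chosen \<open>g\<close>.\<close>

lemma j_cov_eq_span_mat:
  assumes S: "S \<in> Ob (GSets G)" and T: "T \<in> Ob (GSets G)" and \<phi>: "\<phi> \<in> Mor (GSets G) S T"
  shows "j_cov G bp S T \<phi> = span_mat G bp S T S (\<lambda>x. x) \<phi>"
proof (rule span_mat_eqI)
  note SD = fin_gsetD[OF fin_gset_Ob[OF S]] and TD = fin_gsetD[OF fin_gset_Ob[OF T]]
    and \<phi>D = gmapD[OF gmap_Mor[OF \<phi>]]
  fix a i assume a: "a < length (bp T)" and i: "i < length (bp S)"
  let ?H = "j_ob G bp T ! a" and ?K = "j_ob G bp S ! i" and ?b = "bp S ! i" and ?c = "bp T ! a"
  let ?E = "span_biset G T S (\<lambda>x. x) \<phi> ?b ?c"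
  note jp = j_elem_props[OF bpc S T \<phi> i]
  have b: "?b \<in> fst S" and c: "?c \<in> fst T" using bp_in S T i a by auto
  have sub: "subgroup ?H G" "subgroup ?K G"
    using subgroup_j_ob[OF T a] subgroup_j_ob[OF S i] .
  show "j_cov G bp S T \<phi> (a, i) = biset_mor G ?H ?K ?E"
  proof (cases "a = j_index G bp S T \<phi> i")
    case True
    define g where "g = j_elem G bp S T \<phi> i"
    have g: "g \<in> carrier G" "\<phi> ?b = snd T g ?c" using jp(2,3) True by (simp_all add: g_def)
    have "bij_betw (\<lambda>(x, k). k \<otimes> g) (pts ?E) ?H"
      by (rule bij_betw_byWitness[where f' = "\<lambda>k. (?b, k \<otimes> inv g)"])
        (use b c g in \<open>auto simp: span_biset_def j_ob_nth[OF a] stabilizer_iff TD m_assoc\<close>)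
    then have "biset_iso ?H ?K ?E (cov_biset G ?H g)"
      unfolding biset_iso_def
      by (intro exI[of _ "\<lambda>(x, k). k \<otimes> g"])
        (use g in \<open>auto simp: span_biset_def cov_biset_def j_ob_nth[OF a] j_ob_nth[OF i]
          stabilizer_iff m_assoc cancel_inv\<close>)
    from biset_mor_eqI[OF sub bifree_span_biset[OF T S fin_gset_Ob[OF S] gmap_ident gmap_Mor[OF \<phi>] i a] this]
    show ?thesis using a i True by (simp add: j_cov_def g_def)
  next
    case False
    have "pts ?E = {}"
    proof (rule ccontr)
      assume "pts ?E \<noteq> {}"
      then obtain k where k: "k \<in> carrier G" "snd T k (\<phi> ?b) = ?c"
        by (auto simp: span_biset_def)
      then have "\<phi> ?b = snd T (inv k) ?c" using b by (metis TD(5) \<phi>D(1))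
      then have "bp_index G bp T (\<phi> ?b) = a"
        using k(1) by (intro bp_index_eqI[OF T \<phi>D(1)[OF b] a, of "inv k"]) simp_all
      then show False using False by (simp add: j_index_eq)
    qed
    then show ?thesis
      using False a i by (simp add: j_cov_def biset_mor_empty[OF sub] biset_empty_def)
  qed
qed (simp add: j_cov_def)

text \<open>Now the second leg is the identity, so \<open>k x = b\<close> makes \<open>x\<close> the
  translate of \<open>b\<close> by \<open>inv k\<close>, and \<open>k\<close> alone parametrizes the
  points. The condition on the first leg becomes \<open>inv g \<otimes> k\<close> fixing
  \<open>c\<close>.\<close>

lemma j_con_eq_span_mat:
  assumes S: "S \<in> Ob (GSets G)" and T: "T \<in> Ob (GSets G)" and \<phi>: "\<phi> \<in> Mor (GSets G) S T"
  shows "j_con G bp S T \<phi> = span_mat G bp T S S \<phi> (\<lambda>x. x)"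
proof (rule span_mat_eqI)
  note SD = fin_gsetD[OF fin_gset_Ob[OF S]] and TD = fin_gsetD[OF fin_gset_Ob[OF T]]
    and \<phi>D = gmapD[OF gmap_Mor[OF \<phi>]]
  fix i a assume i: "i < length (bp S)" and a: "a < length (bp T)"
  let ?H = "j_ob G bp T ! a" and ?K = "j_ob G bp S ! i" and ?b = "bp S ! i" and ?c = "bp T ! a"
  let ?E = "span_biset G S S \<phi> (\<lambda>x. x) ?c ?b"
  note jp = j_elem_props[OF bpc S T \<phi> i]
  have b: "?b \<in> fst S" and c: "?c \<in> fst T" using bp_in S T i a by auto
  have sub: "subgroup ?K G" "subgroup ?H G"
    using subgroup_j_ob[OF S i] subgroup_j_ob[OF T a] .
  have E: "(x, k) \<in> pts ?E \<longleftrightarrow> k \<in> carrier G \<and> x = snd S (inv k) ?b \<and> snd T (inv k) (\<phi> ?b) = ?c" for x k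
  proof
    assume "(x, k) \<in> pts ?E"
    then have x: "x \<in> fst S" "k \<in> carrier G" "\<phi> x = ?c" "snd S k x = ?b"
      by (simp_all add: span_biset_def)
    then have "x = snd S (inv k) ?b" using SD(5)[OF x(2,1)] by simp
    with x b show "k \<in> carrier G \<and> x = snd S (inv k) ?b \<and> snd T (inv k) (\<phi> ?b) = ?c"
      by (simp add: \<phi>D)
  qed (use b in \<open>simp add: span_biset_def SD \<phi>D\<close>)
  show "j_con G bp S T \<phi> (i, a) = biset_mor G ?K ?H ?E"
  proof (cases "a = j_index G bp S T \<phi> i")
    case True
    define g where "g = j_elem G bp S T \<phi> i"
    have g: "g \<in> carrier G" "\<phi> ?b = snd T g ?c" using jp(2,3) True by (simp_all add: g_def)
    \<comment> \<open>With \<open>\<phi> b = g c\<close>, the left side says that \<open>g\<close>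
      and \<open>k\<close> move \<open>c\<close> to the same point.\<close>
    have gk: "snd T (inv k) (\<phi> ?b) = ?c \<longleftrightarrow> inv g \<otimes> k \<in> ?H" if k: "k \<in> carrier G" for k
    proof -
      have "snd T (inv k) (\<phi> ?b) = ?c \<longleftrightarrow> \<phi> ?b = snd T k ?c"
        using k b c by (metis TD(5,6) \<phi>D(1))
      also have "\<dots> \<longleftrightarrow> snd T (inv g) (snd T k ?c) = ?c"
        unfolding g(2) using k c g(1) by (metis TD(2,5,6))
      finally show ?thesis using k c g(1) by (simp add: j_ob_nth[OF a] stabilizer_iff TD)
    qed
    have "bij_betw (\<lambda>(x, k). inv g \<otimes> k) (pts ?E) ?H"
    proof (rule bij_betw_byWitness[where f' = "\<lambda>k. (snd S (inv (g \<otimes> k)) ?b, g \<otimes> k)"])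
      show "\<forall>xk \<in> pts ?E. (\<lambda>k. (snd S (inv (g \<otimes> k)) ?b, g \<otimes> k)) ((\<lambda>(x, k). inv g \<otimes> k) xk) = xk"
        using g(1) by (auto simp: E cancel_inv)
      show "\<forall>k \<in> ?H. (\<lambda>(x, k). inv g \<otimes> k) (snd S (inv (g \<otimes> k)) ?b, g \<otimes> k) = k"
        using g(1) by (auto simp: j_ob_nth[OF a] stabilizer_iff cancel_inv')
      show "(\<lambda>(x, k). inv g \<otimes> k) ` pts ?E \<subseteq> ?H"
        by (auto simp: E gk)
      show "(\<lambda>k. (snd S (inv (g \<otimes> k)) ?b, g \<otimes> k)) ` ?H \<subseteq> pts ?E"
        using g(1) subgroup.mem_carrier[OF sub(2)] by (auto simp: E gk cancel_inv')
    qed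
    then have "biset_iso ?K ?H ?E (con_biset G ?H g)"
      unfolding biset_iso_def
      by (intro exI[of _ "\<lambda>(x, k). inv g \<otimes> k"])
        (use g(1) subgroup.mem_carrier[OF sub(1)] subgroup.mem_carrier[OF sub(2)] in
          \<open>auto simp: span_biset_def con_biset_def m_assoc cancel_inv\<close>)
    from biset_mor_eqI[OF sub bifree_span_biset[OF S T fin_gset_Ob[OF S] gmap_Mor[OF \<phi>] gmap_ident a i] this]
    show ?thesis using a i True by (simp add: j_con_def g_def)
  next
    case False
    have "pts ?E = {}"
    proof (rule ccontr)
      assume "pts ?E \<noteq> {}"
      then obtain k where k: "k \<in> carrier G" "snd T (inv k) (\<phi> ?b) = ?c"
        by (auto simp: E)
      then have "\<phi> ?b = snd T k ?c" using b by (metis TD(6) \<phi>D(1))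
      then have "bp_index G bp T (\<phi> ?b) = a"
        using k(1) by (intro bp_index_eqI[OF T \<phi>D(1)[OF b] a, of k]) simp_all
      then show False using False by (simp add: j_index_eq)
    qed
    then show ?thesis
      using False a i by (simp add: j_con_def biset_mor_empty[OF sub] biset_empty_def)
  qed
qed (simp add: j_con_def)

section \<open>Functoriality of j and the pullback formula\<close>

lemma Mor_GSets_iff:
  "\<phi> \<in> Mor (GSets G) S T \<longleftrightarrow> \<phi> \<in> extensional (fst S) \<and> gmap G S T \<phi>"
  by (cases S; cases T) (auto simp: GSets_def gmap_def PiE_def Pi_def)

lemma GSets_simps:
  "Ident (GSets G) S = (\<lambda>x \<in> fst S. x)"
  "Comp (GSets G) S T U \<psi> \<phi> = compose (fst S) \<psi> \<phi>"
  by (simp_all add: GSets_def)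

lemma Ident_GSets_Mor: "Ident (GSets G) S \<in> Mor (GSets G) S S" if "S \<in> Ob (GSets G)"
  using fin_gsetD(2)[OF fin_gset_Ob[OF that]] by (simp add: Mor_GSets_iff gmap_def GSets_simps)

lemma Comp_GSets_Mor:
  assumes "S \<in> Ob (GSets G)" "\<phi> \<in> Mor (GSets G) S T" "\<psi> \<in> Mor (GSets G) T U"
  shows "Comp (GSets G) S T U \<psi> \<phi> \<in> Mor (GSets G) S U"
  using assms fin_gsetD(2)[OF fin_gset_Ob[OF assms(1)]]
  by (simp add: Mor_GSets_iff gmap_def GSets_simps compose_eq)

text \<open>Identities in \<open>GSets\<close> are restricted to the carrier and so differ from
  \<open>\<lambda>x. x\<close> as functions; for a span, only values on the apex count.\<close>

lemma span_mat_cong: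
  assumes "\<And>x. x \<in> fst X \<Longrightarrow> p x = p' x" "\<And>x. x \<in> fst X \<Longrightarrow> q x = q' x"
  shows "span_mat G bp S T X p q = span_mat G bp S T X p' q'"
proof -
  have "span_biset G T X p q = span_biset G T X p' q'"
    using assms by (auto simp: span_biset_def fun_eq_iff)
  then show ?thesis by (simp add: span_mat_def)
qed

lemma j_mor_A_bullet:
  assumes S: "S \<in> Ob (GSets G)" and T: "T \<in> Ob (GSets G)" and \<phi>: "\<phi> \<in> Mor (GSets G) S T"
  shows "j_cov G bp S T \<phi> \<in> Mor (A_bullet G) (j_ob G bp S) (j_ob G bp T)"
    and "j_con G bp S T \<phi> \<in> Mor (A_bullet G) (j_ob G bp T) (j_ob G bp S)"
  using span_mat_in[OF S T fin_gset_Ob[OF S] gmap_ident gmap_Mor[OF \<phi>]]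
    span_mat_in[OF T S fin_gset_Ob[OF S] gmap_Mor[OF \<phi>] gmap_ident]
  by (simp_all add: j_cov_eq_span_mat[OF assms] j_con_eq_span_mat[OF assms])

lemma j_ident:
  assumes S: "S \<in> Ob (GSets G)"
  shows "j_cov G bp S S (Ident (GSets G) S) = Ident (A_bullet G) (j_ob G bp S)"
    and "j_con G bp S S (Ident (GSets G) S) = Ident (A_bullet G) (j_ob G bp S)"
proof -
  have *: "Ident (GSets G) S x = x" if "x \<in> fst S" for x
    using that by (simp add: GSets_def)
  show "j_cov G bp S S (Ident (GSets G) S) = Ident (A_bullet G) (j_ob G bp S)"
    unfolding j_cov_eq_span_mat[OF S S Ident_GSets_Mor[OF S]] span_mat_ident[OF S, symmetric]
    by (rule span_mat_cong) (simp_all add: *)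
  show "j_con G bp S S (Ident (GSets G) S) = Ident (A_bullet G) (j_ob G bp S)"
    unfolding j_con_eq_span_mat[OF S S Ident_GSets_Mor[OF S]] span_mat_ident[OF S, symmetric]
    by (rule span_mat_cong) (simp_all add: *)
qed

text \<open>In both composites the pullback is taken along an identity leg, so the fibre product is
  the graph of \<open>\<phi>\<close> and \<open>S\<close> serves as its apex.\<close>

lemma j_comp:
  assumes S: "S \<in> Ob (GSets G)" and T: "T \<in> Ob (GSets G)" and U: "U \<in> Ob (GSets G)"
    and \<phi>: "\<phi> \<in> Mor (GSets G) S T" and \<psi>: "\<psi> \<in> Mor (GSets G) T U"
  shows "j_cov G bp S U (Comp (GSets G) S T U \<psi> \<phi>) =
      Comp (A_bullet G) (j_ob G bp S) (j_ob G bp T) (j_ob G bp U) (j_cov G bp T U \<psi>) (j_cov G bp S T \<phi>)"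
    and "j_con G bp S U (Comp (GSets G) S T U \<psi> \<phi>) =
      Comp (A_bullet G) (j_ob G bp U) (j_ob G bp T) (j_ob G bp S) (j_con G bp S T \<phi>) (j_con G bp T U \<psi>)"
proof -
  note \<phi>\<psi> = Comp_GSets_Mor[OF S \<phi> \<psi>]
  note m = gmap_Mor[OF \<phi>] gmap_Mor[OF \<psi>] and f = fin_gset_Ob[OF S] fin_gset_Ob[OF T]
  have *: "Comp (GSets G) S T U \<psi> \<phi> x = \<psi> (\<phi> x)" if "x \<in> fst S" for x
    using that by (simp add: GSets_def compose_eq)
  have "bij_betw (\<lambda>x. (x, \<phi> x)) (fst S) {(x, y) \<in> fst S \<times> fst T. \<phi> x = y}"
    using gmapD(1)[OF m(1)] by (auto simp: bij_betw_def inj_on_def)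
  from Comp_span_mat[OF S T U f(1) gmap_ident m(1) f(2) gmap_ident m(2) f(1) gmap_ident m(1) this
      refl *]
  show "j_cov G bp S U (Comp (GSets G) S T U \<psi> \<phi>) =
      Comp (A_bullet G) (j_ob G bp S) (j_ob G bp T) (j_ob G bp U) (j_cov G bp T U \<psi>) (j_cov G bp S T \<phi>)"
    by (simp add: j_cov_eq_span_mat S T U \<phi> \<psi> \<phi>\<psi>)
  have "bij_betw (\<lambda>x. (\<phi> x, x)) (fst S) {(x, y) \<in> fst T \<times> fst S. x = \<phi> y}"
    using gmapD(1)[OF m(1)] by (auto simp: bij_betw_def inj_on_def)
  from Comp_span_mat[OF U T S f(2) m(2) gmap_ident f(1) m(1) gmap_ident f(1) m(1) gmap_ident this
      * refl]
  show "j_con G bp S U (Comp (GSets G) S T U \<psi> \<phi>) =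
      Comp (A_bullet G) (j_ob G bp U) (j_ob G bp T) (j_ob G bp S) (j_con G bp S T \<phi>) (j_con G bp T U \<psi>)"
    by (simp add: j_con_eq_span_mat S T U \<phi> \<psi> \<phi>\<psi>)
qed

text \<open>The middle object is the apex itself, joined by two identity legs, so the fibre product
  is the diagonal. Every span between objects thus factors into a contravariant map followed by a
  covariant one.\<close>

lemma j_cov_after_con:
  assumes Z: "Z \<in> Ob (GSets G)" and S: "S \<in> Ob (GSets G)" and T: "T \<in> Ob (GSets G)"
    and \<phi>: "\<phi> \<in> Mor (GSets G) Z S" and \<psi>: "\<psi> \<in> Mor (GSets G) Z T"
  shows "Comp (A_bullet G) (j_ob G bp S) (j_ob G bp Z) (j_ob G bp T) (j_cov G bp Z T \<psi>) (j_con G bp Z S \<phi>) =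
    span_mat G bp S T Z \<phi> \<psi>"
proof -
  note m = gmap_Mor[OF \<phi>] gmap_Mor[OF \<psi>] and f = fin_gset_Ob[OF Z]
  have "bij_betw (\<lambda>x. (x, x)) (fst Z) {(x, y) \<in> fst Z \<times> fst Z. x = y}"
    by (auto simp: bij_betw_def inj_on_def)
  from Comp_span_mat[OF S Z T f m(1) gmap_ident f gmap_ident m(2) f gmap_ident gmap_ident this refl refl]
  show ?thesis by (simp add: j_cov_eq_span_mat j_con_eq_span_mat S T Z \<phi> \<psi>)
qed

text \<open>One formula serves three situations: the abstract pullback of (M1), the diagonal as
  pullback of an injective map with itself, and the empty set as pullback of maps with disjoint
  images.\<close>

lemma j_con_after_cov:
  assumes X: "X \<in> Ob (GSets G)" and Y: "Y \<in> Ob (GSets G)" and T: "T \<in> Ob (GSets G)"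
    and \<psi>: "\<psi> \<in> Mor (GSets G) X T" and \<phi>: "\<phi> \<in> Mor (GSets G) Y T"
    and Z: "fin_gset G Z" and u: "gmap G Z X u" and v: "gmap G Z Y v"
    and bij: "bij_betw (\<lambda>z. (u z, v z)) (fst Z) {(x, y) \<in> fst X \<times> fst Y. \<psi> x = \<phi> y}"
  shows "Comp (A_bullet G) (j_ob G bp X) (j_ob G bp T) (j_ob G bp Y) (j_con G bp Y T \<phi>) (j_cov G bp X T \<psi>) =
    span_mat G bp X Y Z u v"
  using Comp_span_mat[OF X T Y fin_gset_Ob[OF X] gmap_ident gmap_Mor[OF \<psi>]
      fin_gset_Ob[OF Y] gmap_Mor[OF \<phi>] gmap_ident Z u v bij refl refl]
  by (simp add: j_cov_eq_span_mat j_con_eq_span_mat X Y T \<phi> \<psi>)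

lemma pullback_square_j:
  assumes "pullback_square G S S\<^sub>1 S\<^sub>2 T \<Psi> \<Phi> \<phi> \<psi>"
  shows "Comp (A_bullet G) (j_ob G bp S\<^sub>2) (j_ob G bp T) (j_ob G bp S\<^sub>1) (j_con G bp S\<^sub>1 T \<phi>) (j_cov G bp S\<^sub>2 T \<psi>) =
    Comp (A_bullet G) (j_ob G bp S\<^sub>2) (j_ob G bp S) (j_ob G bp S\<^sub>1) (j_cov G bp S S\<^sub>1 \<Psi>) (j_con G bp S S\<^sub>2 \<Phi>)"
proof -
  have ob: "S \<in> Ob (GSets G)" "S\<^sub>1 \<in> Ob (GSets G)" "S\<^sub>2 \<in> Ob (GSets G)" "T \<in> Ob (GSets G)"
    and mor: "\<Psi> \<in> Mor (GSets G) S S\<^sub>1" "\<Phi> \<in> Mor (GSets G) S S\<^sub>2"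
      "\<phi> \<in> Mor (GSets G) S\<^sub>1 T" "\<psi> \<in> Mor (GSets G) S\<^sub>2 T"
    and bij: "bij_betw (\<lambda>x. (\<Psi> x, \<Phi> x)) (fst S) {(x, y) \<in> fst S\<^sub>1 \<times> fst S\<^sub>2. \<phi> x = \<psi> y}"
    using assms by (simp_all add: pullback_square_def)
  \<comment> \<open>The composite runs from \<open>S\<^sub>2\<close> to \<open>S\<^sub>1\<close>,
    whereas the pullback square lists \<open>S\<^sub>1\<close> first.\<close>
  have "bij_betw prod.swap {(x, y) \<in> fst S\<^sub>1 \<times> fst S\<^sub>2. \<phi> x = \<psi> y} {(x, y) \<in> fst S\<^sub>2 \<times> fst S\<^sub>1. \<psi> x = \<phi> y}"
    by (rule bij_betw_byWitness[where f' = prod.swap]) auto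
  from bij_betw_trans[OF bij this]
  have "bij_betw (\<lambda>x. (\<Phi> x, \<Psi> x)) (fst S) {(x, y) \<in> fst S\<^sub>2 \<times> fst S\<^sub>1. \<psi> x = \<phi> y}"
    by (simp add: comp_def)
  from j_con_after_cov[OF ob(3,2,4) mor(4,3) fin_gset_Ob[OF ob(1)] gmap_Mor[OF mor(2)] gmap_Mor[OF mor(1)] this]
  show ?thesis by (simp add: j_cov_after_con[OF ob(1,3,2) mor(2,1)])
qed

subsection \<open>Additive functors give Mackey functors\<close>

lemma mackey_functor_additive_comp:
  fixes F :: "('g set list, nat \<times> nat \<Rightarrow> 'g vbiset, 'b monoid, 'b \<Rightarrow> 'b) cfunctor"
  assumes F: "additive_functor (A_bullet G) Ab F"
  shows "mackey_functor G (F \<circ>\<^sub>b j_functor G bp)"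
proof -
  define M where "M = F \<circ>\<^sub>b j_functor G bp"
  let ?J = "j_ob G bp"
  have M: "bi_ob M S = on_ob F (?J S)"
      "bi_cov M S T \<phi> = on_mor F (?J S) (?J T) (j_cov G bp S T \<phi>)"
      "bi_con M S T \<phi> = on_mor F (?J T) (?J S) (j_con G bp S T \<phi>)" for S T \<phi>
    by (simp_all add: M_def comp_bi_def j_functor_def)
  have func: "is_functor (A_bullet G) Ab F" using F by (simp add: additive_functor_def)
  have FOb: "comm_group (on_ob F X)" if "X \<in> Ob (A_bullet G)" for X
    using func that by (auto simp: is_functor_def Ab_def)
  have FMor: "on_mor F X Y f \<in> Mor Ab (on_ob F X) (on_ob F Y)"
    if "X \<in> Ob (A_bullet G)" "Y \<in> Ob (A_bullet G)" "f \<in> Mor (A_bullet G) X Y" for X Y f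
    using func that by (simp add: is_functor_def)
  have FId: "on_mor F X X (Ident (A_bullet G) X) = Ident Ab (on_ob F X)"
    if "X \<in> Ob (A_bullet G)" for X
    using func that by (simp add: is_functor_def)
  have FComp: "on_mor F X Z (Comp (A_bullet G) X Y Z g f) =
      Comp Ab (on_ob F X) (on_ob F Y) (on_ob F Z) (on_mor F Y Z g) (on_mor F X Y f)"
    if "X \<in> Ob (A_bullet G)" "Y \<in> Ob (A_bullet G)" "Z \<in> Ob (A_bullet G)"
      "f \<in> Mor (A_bullet G) X Y" "g \<in> Mor (A_bullet G) Y Z" for X Y Z f g
    using func that by (simp add: is_functor_def)
  have FAdd: "on_mor F X Y (Add (A_bullet G) X Y f g) =
      Add Ab (on_ob F X) (on_ob F Y) (on_mor F X Y f) (on_mor F X Y g)"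
    if "X \<in> Ob (A_bullet G)" "Y \<in> Ob (A_bullet G)"
      "f \<in> Mor (A_bullet G) X Y" "g \<in> Mor (A_bullet G) X Y" for X Y f g
    using F that by (simp add: additive_functor_def)
  have MOb: "comm_group (bi_ob M S)" if "S \<in> Ob (GSets G)" for S
    using FOb[OF j_ob_Ob[OF that]] by (simp add: M)
  have cov: "bi_cov M S T \<phi> \<in> Mor Ab (bi_ob M S) (bi_ob M T)"
    and con: "bi_con M S T \<phi> \<in> Mor Ab (bi_ob M T) (bi_ob M S)"
    if "S \<in> Ob (GSets G)" "T \<in> Ob (GSets G)" "\<phi> \<in> Mor (GSets G) S T" for S T \<phi>
    using that by (simp_all add: M FMor j_ob_Ob j_mor_A_bullet)
  have biv: "bivariant_functor (GSets G) Ab M"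
    unfolding bivariant_functor_def is_functor_def cfunctor.simps
  proof (intro conjI ballI)
    fix S :: "('g, 's) gset" assume "S \<in> Ob (GSets G)"
    then show "bi_ob M S \<in> Ob Ab" using MOb by (simp add: Ab_def)
  next
    fix S :: "('g, 's) gset" assume "S \<in> Ob (opposite (GSets G))"
    then show "bi_ob M S \<in> Ob Ab" using MOb by (simp add: Ab_def opposite_def)
  next
    fix S T :: "('g, 's) gset" and \<phi> assume "S \<in> Ob (GSets G)" "T \<in> Ob (GSets G)" "\<phi> \<in> Mor (GSets G) S T"
    then show "bi_cov M S T \<phi> \<in> Mor Ab (bi_ob M S) (bi_ob M T)" by (rule cov)
  next
    fix T S :: "('g, 's) gset" and \<phi> assume "T \<in> Ob (opposite (GSets G))" "S \<in> Ob (opposite (GSets G))"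
      "\<phi> \<in> Mor (opposite (GSets G)) T S"
    then show "bi_con M S T \<phi> \<in> Mor Ab (bi_ob M T) (bi_ob M S)"
      by (intro con) (simp_all add: opposite_def)
  next
    fix S :: "('g, 's) gset" assume "S \<in> Ob (GSets G)"
    then show "bi_cov M S S (Ident (GSets G) S) = Ident Ab (bi_ob M S)"
      by (simp only: M j_ident FId j_ob_Ob)
  next
    fix S :: "('g, 's) gset" assume "S \<in> Ob (opposite (GSets G))"
    then have S: "S \<in> Ob (GSets G)" by (simp add: opposite_def)
    have "Ident (opposite (GSets G)) S = Ident (GSets G) S" by (simp add: opposite_def)
    then show "bi_con M S S (Ident (opposite (GSets G)) S) = Ident Ab (bi_ob M S)"
      using S by (simp only: M j_ident FId j_ob_Ob)
  next
    fix S T U :: "('g, 's) gset" and \<phi> \<psi> assume "S \<in> Ob (GSets G)" "T \<in> Ob (GSets G)" "U \<in> Ob (GSets G)"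
      "\<phi> \<in> Mor (GSets G) S T" "\<psi> \<in> Mor (GSets G) T U"
    then show "bi_cov M S U (Comp (GSets G) S T U \<psi> \<phi>) =
        Comp Ab (bi_ob M S) (bi_ob M T) (bi_ob M U) (bi_cov M T U \<psi>) (bi_cov M S T \<phi>)"
      by (simp only: M j_comp FComp j_ob_Ob j_mor_A_bullet)
  next
    fix U T S :: "('g, 's) gset" and \<psi> \<phi> assume "U \<in> Ob (opposite (GSets G))" "T \<in> Ob (opposite (GSets G))"
      "S \<in> Ob (opposite (GSets G))" "\<psi> \<in> Mor (opposite (GSets G)) U T"
      "\<phi> \<in> Mor (opposite (GSets G)) T S"
    then have *: "S \<in> Ob (GSets G)" "T \<in> Ob (GSets G)" "U \<in> Ob (GSets G)"
      "\<phi> \<in> Mor (GSets G) S T" "\<psi> \<in> Mor (GSets G) T U" by (simp_all add: opposite_def)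
    have "Comp (opposite (GSets G)) U T S \<phi> \<psi> = Comp (GSets G) S T U \<psi> \<phi>"
      by (simp add: opposite_def)
    then show "bi_con M S U (Comp (opposite (GSets G)) U T S \<phi> \<psi>) =
        Comp Ab (bi_ob M U) (bi_ob M T) (bi_ob M S) (bi_con M S T \<phi>) (bi_con M T U \<psi>)"
      using * by (simp only: M j_comp FComp j_ob_Ob j_mor_A_bullet)
  qed
  have pb: "Comp Ab (bi_ob M S\<^sub>2) (bi_ob M T) (bi_ob M S\<^sub>1) (bi_con M S\<^sub>1 T \<phi>) (bi_cov M S\<^sub>2 T \<psi>) =
      Comp Ab (bi_ob M S\<^sub>2) (bi_ob M S) (bi_ob M S\<^sub>1) (bi_cov M S S\<^sub>1 \<Psi>) (bi_con M S S\<^sub>2 \<Phi>)"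
    if pb: "pullback_square G S S\<^sub>1 S\<^sub>2 T \<Psi> \<Phi> \<phi> \<psi>" for S S\<^sub>1 S\<^sub>2 T \<Psi> \<Phi> \<phi> \<psi>
  proof -
    have ob: "S \<in> Ob (GSets G)" "S\<^sub>1 \<in> Ob (GSets G)" "S\<^sub>2 \<in> Ob (GSets G)" "T \<in> Ob (GSets G)"
      and mor: "\<Psi> \<in> Mor (GSets G) S S\<^sub>1" "\<Phi> \<in> Mor (GSets G) S S\<^sub>2"
        "\<phi> \<in> Mor (GSets G) S\<^sub>1 T" "\<psi> \<in> Mor (GSets G) S\<^sub>2 T"
      using pb by (simp_all add: pullback_square_def)
    note J = j_ob_Ob[OF ob(1)] j_ob_Ob[OF ob(2)] j_ob_Ob[OF ob(3)] j_ob_Ob[OF ob(4)]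
    show ?thesis
      unfolding M
      using FComp[OF J(3,4,2) j_mor_A_bullet(1)[OF ob(3,4) mor(4)] j_mor_A_bullet(2)[OF ob(2,4) mor(3)]]
        FComp[OF J(3,1,2) j_mor_A_bullet(2)[OF ob(1,3) mor(2)] j_mor_A_bullet(1)[OF ob(1,2) mor(1)]]
      by (simp only: pullback_square_j[OF pb])
  qed
  \<comment> \<open>A span with empty apex is the sum of two copies of itself, so its image
    \<open>?y\<close> satisfies \<open>?y + ?y = ?y\<close> and cancels to the neutral
    element.\<close>
  have Fzero: "on_mor F (?J S) (?J T) (span_mat G bp S T E p q) x = \<one>\<^bsub>on_ob F (?J T)\<^esub>"
    if S: "S \<in> Ob (GSets G)" and T: "T \<in> Ob (GSets G)" and E: "fst E = {}"
      and x: "x \<in> carrier (on_ob F (?J S))"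
    for S T :: "('g, 's) gset" and E :: "('g, 's) gset" and p q x
  proof -
    note J = j_ob_Ob[OF S] j_ob_Ob[OF T]
    interpret B: comm_group "on_ob F (?J T)" by (rule FOb[OF J(2)])
    have fE: "fin_gset G E" "gmap G E S p" "gmap G E T q"
      using E by (simp_all add: fin_gset_def gmap_def)
    note z = span_mat_in[OF S T fE]
    have "Add (A_bullet G) (?J S) (?J T) (span_mat G bp S T E p q) (span_mat G bp S T E p q) =
        span_mat G bp S T E p q"
      by (rule span_mat_sum[OF S T fE fE(1) fE(1) gmap_ident _ gmap_ident]) (simp_all add: E)
    with FAdd[OF J z z] have eq: "Add Ab (on_ob F (?J S)) (on_ob F (?J T))
        (on_mor F (?J S) (?J T) (span_mat G bp S T E p q))
        (on_mor F (?J S) (?J T) (span_mat G bp S T E p q)) =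
      on_mor F (?J S) (?J T) (span_mat G bp S T E p q)" by simp
    let ?y = "on_mor F (?J S) (?J T) (span_mat G bp S T E p q) x"
    have "?y \<otimes>\<^bsub>on_ob F (?J T)\<^esub> ?y = ?y" using fun_cong[OF eq, of x] x by (simp add: Ab_def)
    moreover have "?y \<in> carrier (on_ob F (?J T))"
      using FMor[OF J z] x by (auto simp: Ab_def dest: hom_in_carrier)
    ultimately show ?thesis by simp
  qed
  have du: "(\<lambda>x. (bi_con M S\<^sub>1 S i\<^sub>1 x, bi_con M S\<^sub>2 S i\<^sub>2 x)) \<in> iso (bi_ob M S) (bi_ob M S\<^sub>1 \<times>\<times> bi_ob M S\<^sub>2)"
    if du: "disjoint_union G S S\<^sub>1 S\<^sub>2 i\<^sub>1 i\<^sub>2" for S S\<^sub>1 S\<^sub>2 i\<^sub>1 i\<^sub>2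
  proof -
    have S: "S \<in> Ob (GSets G)" and S1: "S\<^sub>1 \<in> Ob (GSets G)" and S2: "S\<^sub>2 \<in> Ob (GSets G)"
      and i1: "i\<^sub>1 \<in> Mor (GSets G) S\<^sub>1 S" and i2: "i\<^sub>2 \<in> Mor (GSets G) S\<^sub>2 S"
      and inj: "inj_on i\<^sub>1 (fst S\<^sub>1)" "inj_on i\<^sub>2 (fst S\<^sub>2)"
      and disj: "i\<^sub>1 ` fst S\<^sub>1 \<inter> i\<^sub>2 ` fst S\<^sub>2 = {}" and un: "i\<^sub>1 ` fst S\<^sub>1 \<union> i\<^sub>2 ` fst S\<^sub>2 = fst S"
      using du by (simp_all add: disjoint_union_def)
    note J = j_ob_Ob[OF S] j_ob_Ob[OF S1] j_ob_Ob[OF S2]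
    have hom: "f \<in> Mor Ab A B \<Longrightarrow> f \<in> hom A B" for f :: "'b \<Rightarrow> 'b" and A B
      by (simp add: Ab_def)
    have comp: "on_mor F (?J Y) (?J Z) g (on_mor F (?J X) (?J Y) f x) =
        on_mor F (?J X) (?J Z) (Comp (A_bullet G) (?J X) (?J Y) (?J Z) g f) x"
      if "X \<in> Ob (GSets G)" "Y \<in> Ob (GSets G)" "Z \<in> Ob (GSets G)"
        "f \<in> Mor (A_bullet G) (?J X) (?J Y)" "g \<in> Mor (A_bullet G) (?J Y) (?J Z)"
        "x \<in> carrier (bi_ob M X)" for X Y Z f g x
      using that by (simp add: FComp j_ob_Ob) (simp add: Ab_def compose_eq M)
    \<comment> \<open>Injectivity of \<open>i\<close> says that its fibre product with itself is the
      diagonal, so the composite is the identity span.\<close>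
    have retract: "bi_con M X S i (bi_cov M X S i x) = x"
      if X: "X \<in> Ob (GSets G)" and i: "i \<in> Mor (GSets G) X S" and inj: "inj_on i (fst X)"
        and x: "x \<in> carrier (bi_ob M X)" for X i x
    proof -
      have "bij_betw (\<lambda>x. (x, x)) (fst X) {(x, y) \<in> fst X \<times> fst X. i x = i y}"
        using inj by (auto simp: bij_betw_def inj_on_def)
      from j_con_after_cov[OF X X S i i fin_gset_Ob[OF X] gmap_ident gmap_ident this]
      show ?thesis
        using x FId[OF j_ob_Ob[OF X]]
        by (simp add: M(2,3) comp X S j_mor_A_bullet i span_mat_ident) (simp add: Ab_def M)
    qed
    \<comment> \<open>Disjoint images have an empty fibre product, so the composite is a zero
      morphism and \<open>Fzero\<close> applies.\<close>
    have cross: "bi_con M Y S k (bi_cov M X S i x) = \<one>\<^bsub>bi_ob M Y\<^esub>"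
      if X: "X \<in> Ob (GSets G)" and i: "i \<in> Mor (GSets G) X S"
        and Y: "Y \<in> Ob (GSets G)" and k: "k \<in> Mor (GSets G) Y S"
        and disj: "i ` fst X \<inter> k ` fst Y = {}" and x: "x \<in> carrier (bi_ob M X)" for X Y i k x
    proof -
      define E :: "('g, 's) gset" where "E = ({}, \<lambda>g x. x)"
      have "{(x, y) \<in> fst X \<times> fst Y. i x = k y} = {}" using disj by auto
      then have "bij_betw (\<lambda>x. (x, x)) (fst E) {(x, y) \<in> fst X \<times> fst Y. i x = k y}"
        by (simp add: E_def bij_betw_def)
      moreover have "fin_gset G E" "gmap G E X (\<lambda>x. x)" "gmap G E Y (\<lambda>x. x)"
        by (simp_all add: E_def fin_gset_def gmap_def)
      ultimately have "Comp (A_bullet G) (?J X) (?J S) (?J Y) (j_con G bp Y S k) (j_cov G bp X S i) =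
          span_mat G bp X Y E (\<lambda>x. x) (\<lambda>x. x)"
        by (intro j_con_after_cov[OF X Y S i k])
      then show ?thesis
        using x Fzero[OF X Y, of E x "\<lambda>x. x" "\<lambda>x. x"]
        by (simp add: M comp X Y S j_mor_A_bullet i k E_def)
    qed
    \<comment> \<open>Each covariant map after its contravariant one is the span with both legs
      equal to the embedding. Their apexes together make up \<open>S\<close>, so the two matrices
      add up to the identity span of \<open>S\<close>.\<close>
    have sum: "bi_cov M S\<^sub>1 S i\<^sub>1 (bi_con M S\<^sub>1 S i\<^sub>1 x) \<otimes>\<^bsub>bi_ob M S\<^esub> bi_cov M S\<^sub>2 S i\<^sub>2 (bi_con M S\<^sub>2 S i\<^sub>2 x) = x"
      if x: "x \<in> carrier (bi_ob M S)" for x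
    proof -
      note g1 = gmap_Mor[OF i1] and g2 = gmap_Mor[OF i2]
      note z1 = span_mat_in[OF S S fin_gset_Ob[OF S1] g1 g1]
        and z2 = span_mat_in[OF S S fin_gset_Ob[OF S2] g2 g2]
      have "Add (A_bullet G) (?J S) (?J S) (span_mat G bp S S S\<^sub>1 i\<^sub>1 i\<^sub>1) (span_mat G bp S S S\<^sub>2 i\<^sub>2 i\<^sub>2) =
          Ident (A_bullet G) (?J S)"
        using span_mat_sum[OF S S fin_gset_Ob[OF S] gmap_ident gmap_ident fin_gset_Ob[OF S1]
            fin_gset_Ob[OF S2] g1 inj(1) g2 inj(2) disj un]
        by (simp add: span_mat_ident[OF S])
      with FAdd[OF J(1,1) z1 z2] FId[OF J(1)]
      have "Add Ab (on_ob F (?J S)) (on_ob F (?J S))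
          (on_mor F (?J S) (?J S) (span_mat G bp S S S\<^sub>1 i\<^sub>1 i\<^sub>1))
          (on_mor F (?J S) (?J S) (span_mat G bp S S S\<^sub>2 i\<^sub>2 i\<^sub>2)) = Ident Ab (on_ob F (?J S))"
        by simp
      from fun_cong[OF this, of x]
      have "Add Ab (on_ob F (?J S)) (on_ob F (?J S))
          (on_mor F (?J S) (?J S) (span_mat G bp S S S\<^sub>1 i\<^sub>1 i\<^sub>1))
          (on_mor F (?J S) (?J S) (span_mat G bp S S S\<^sub>2 i\<^sub>2 i\<^sub>2)) x = x"
        using x by (simp add: Ab_def M)
      then show ?thesis
        using x by (simp add: M comp S S1 S2 i1 i2 j_mor_A_bullet j_cov_after_con) (simp add: Ab_def)
    qed
    show ?thesis
      by (rule biproduct_iso[OF MOb[OF S] MOb[OF S1] MOb[OF S2] hom[OF con[OF S1 S i1]]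
            hom[OF con[OF S2 S i2]] hom[OF cov[OF S1 S i1]] hom[OF cov[OF S2 S i2]]])
        (use disj in \<open>simp_all add: retract[OF S1 i1 inj(1)] retract[OF S2 i2 inj(2)]
          cross[OF S1 i1 S2 i2] cross[OF S2 i2 S1 i1] sum Int_commute\<close>)
  qed
  \<comment> \<open>For empty \<open>S\<close> the identity span has empty apex, so the identity of
    the group is also the trivial map.\<close>
  have em: "carrier (bi_ob M S) = {\<one>\<^bsub>bi_ob M S\<^esub>}" if S: "S \<in> Ob (GSets G)" and E: "fst S = {}" for S
  proof -
    interpret A: comm_group "bi_ob M S" by (rule MOb[OF S])
    have "x = \<one>\<^bsub>bi_ob M S\<^esub>" if "x \<in> carrier (bi_ob M S)" for x
      using that Fzero[OF S S E, of x "\<lambda>x. x" "\<lambda>x. x"] FId[OF j_ob_Ob[OF S]]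
      by (simp add: span_mat_ident[OF S] M) (simp add: Ab_def)
    then show ?thesis by auto
  qed
  show ?thesis
    unfolding mackey_functor_def M_def[symmetric] using biv pb du em by blast
qed

end

theorem corollaryB:
  fixes G :: "'g monoid"
    and bp :: "('g, 's) gset \<Rightarrow> 's list"
    and F :: "('g set list, nat \<times> nat \<Rightarrow> 'g vbiset, 'b monoid, 'b \<Rightarrow> 'b) cfunctor"
  assumes "group G" and "finite (carrier G)"
    and "base_point_choice G bp"
    and "additive_functor (A_bullet G) Ab F"
  shows "mackey_functor G (F \<circ>\<^sub>b j_functor G bp)"
proof -
  interpret base_points G bp
    using assms(1-3) by (simp add: base_points_def plain_group_def base_points_axioms_def)
  show ?thesis by (rule mackey_functor_additive_comp[OF assms(4)])
qed

end
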